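(* It is provable in $\mathbf{ZF}$ that $\mathbf{CMC}$ implies the following: if $\mathbf{X}$ is a strongly zero-dimensional space, then every zero-set in $\mathbf{X}$ is the intersection of a countable family of clopen sets in $\mathbf{X}$ and, moreover, $A(\mathbf{X})=U_{\aleph_0}(\mathbf{X})=C(\mathbf{X})$.
   Context: The base theory is $\mathbf{ZF}$ (no Axiom of Choice). A set is countable if it is equipotent to a subset of $\omega$, and denumerable if it is infinite and countable. A multiple choice function of a family $\{A_j:j\in J\}$ is a function assigning to each $j\in J$ a non-empty finite subset of $A_j$. $\mathbf{CMC}$: every denumerable family of non-empty sets has a multiple choice function. For a topological space $\mathbf{X}$ with underlying set $X$, $C(\mathbf{X})$ is the set of continuous functions $X\to\mathbb{R}$. A zero-set of $\mathbf{X}$ is a set $Z(f)=f^{-1}[\{0\}]$ with $f\in C(\mathbf{X})$; a co-zero set is the complement of a zero-set. $\mathbf{X}$ is completely regular if its co-zero sets form a base of $\mathbf{X}$. $\mathbf{X}$ is strongly zero-dimensional if it is completely regular and for every pair $Z_1,Z_2$ of disjoint zero-sets there is a clopen set $U$ with $Z_1\subseteq U\subseteq X\setminus Z_2$. $A(\mathbf{X})$ is the set of all $f\in C(\mathbf{X})$ such that for each open $O\subseteq\mathbb{R}$ the set $f^{-1}[O]$ is a countable union of clopen sets of $\mathbf{X}$. $U_{\aleph_0}(\mathbf{X})$ is the set of all $f\in C(\mathbf{X})$ such that for each $\varepsilon>0$ there is a countable cover $\mathcal{A}$ of $X$ by clopen sets with $\mathrm{osc}_A(f)=\sup\{|f(x)-f(y)|:x,y\in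 A\}\le\varepsilon$ for all $A\in\mathcal{A}$. *)

theory Defs
  imports Main
begin

text \<open>
  HOL has a choice operator, so a statement of the form ``ZF proves that CMC implies \dots'' is only
  meaningful here for an object-level ZF.  The first-order language of set theory, a
  complete natural deduction calculus for it and the axioms of ZF are therefore embedded deeply.
\<close>

section \<open>First-order logic with equality and one binary relation symbol\<close>

text \<open>De Bruijn indices; index 0 refers to the innermost \<open>Uni\<close>.\<close>

datatype fm =
    Fls
  | Mem nat nat
  | Eql nat nat
  | Imp fm fm
  | Uni fm

primrec ren :: "(nat \<Rightarrow> nat) \<Rightarrow> fm \<Rightarrow> fm" where
  "ren r Fls = Fls"
| "ren r (Mem i j) = Mem (r i) (r j)"
| "ren r (Eql i j) = Eql (r i) (r j)"
| "ren r (Imp p q) = Imp (ren r p) (ren r q)"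
| "ren r (Uni p) = Uni (ren (case_nat 0 (\<lambda>i. Suc (r i))) p)"

text \<open>All free indices of the formula are smaller than \<open>n\<close>.\<close>

primrec bounded_fm :: "nat \<Rightarrow> fm \<Rightarrow> bool" where
  "bounded_fm n Fls \<longleftrightarrow> True"
| "bounded_fm n (Mem i j) \<longleftrightarrow> i < n \<and> j < n"
| "bounded_fm n (Eql i j) \<longleftrightarrow> i < n \<and> j < n"
| "bounded_fm n (Imp p q) \<longleftrightarrow> bounded_fm n p \<and> bounded_fm n q"
| "bounded_fm n (Uni p) \<longleftrightarrow> bounded_fm (Suc n) p"

text \<open>
  Variables are the only terms, so instantiating the outermost bound variable by \<open>x\<close> is the
  renaming \<open>case_nat x id\<close>.  In \<open>UniI\<close>, shifting the hypotheses by \<open>Suc\<close> makes index 0 fresh.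
\<close>

inductive proves :: "fm set \<Rightarrow> fm \<Rightarrow> bool"  (infix "\<turnstile>" 50) where
  Assm: "p \<in> H \<Longrightarrow> H \<turnstile> p"
| ImpI: "insert p H \<turnstile> q \<Longrightarrow> H \<turnstile> Imp p q"
| ImpE: "H \<turnstile> Imp p q \<Longrightarrow> H \<turnstile> p \<Longrightarrow> H \<turnstile> q"
| Contr: "insert (Imp p Fls) H \<turnstile> Fls \<Longrightarrow> H \<turnstile> p"
| UniI: "ren Suc ` H \<turnstile> p \<Longrightarrow> H \<turnstile> Uni p"
| UniE: "H \<turnstile> Uni p \<Longrightarrow> H \<turnstile> ren (case_nat x id) p"
| EqlI: "H \<turnstile> Eql x x"
| EqlE: "H \<turnstile> Eql x y \<Longrightarrow> H \<turnstile> ren (case_nat x id) p \<Longrightarrow> H \<turnstile> ren (case_nat y id) p"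


section \<open>Notation for formulas\<close>

text \<open>
  To write formulas with named bound variables, a formula is represented by a function of the
  number \<open>d\<close> of quantifiers above it, and a variable by its level, i.e. the number of quantifiers
  above the one that binds it; at depth \<open>d\<close> level \<open>a\<close> has de Bruijn index \<open>d - Suc a\<close>.
  A sentence \<open>F\<close> in this notation denotes the \<open>fm\<close> given by \<open>F 0\<close>.
\<close>

type_synonym var = nat
type_synonym form = "nat \<Rightarrow> fm"

definition f_mem :: "var \<Rightarrow> var \<Rightarrow> form"  (infix "\<^bold>\<in>" 60) where
  "(a \<^bold>\<in> b) = (\<lambda>d. Mem (d - Suc a) (d - Suc b))"

definition f_eq :: "var \<Rightarrow> var \<Rightarrow> form"  (infix "\<^bold>=" 60) where
  "(a \<^bold>= b) = (\<lambda>d. Eql (d - Suc a) (d - Suc b))"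

definition f_imp :: "form \<Rightarrow> form \<Rightarrow> form"  (infixr "\<^bold>\<longrightarrow>" 25) where
  "(F \<^bold>\<longrightarrow> G) = (\<lambda>d. Imp (F d) (G d))"

definition f_not :: "form \<Rightarrow> form"  ("\<^bold>\<not> _" [40] 40) where
  "(\<^bold>\<not> F) = (\<lambda>d. Imp (F d) Fls)"

definition f_and :: "form \<Rightarrow> form \<Rightarrow> form"  (infixr "\<^bold>\<and>" 35) where
  "(F \<^bold>\<and> G) = (\<^bold>\<not> (F \<^bold>\<longrightarrow> \<^bold>\<not> G))"

definition f_or :: "form \<Rightarrow> form \<Rightarrow> form"  (infixr "\<^bold>\<or>" 30) where
  "(F \<^bold>\<or> G) = (\<^bold>\<not> F \<^bold>\<longrightarrow> G)"

definition f_iff :: "form \<Rightarrow> form \<Rightarrow> form"  (infix "\<^bold>\<longleftrightarrow>" 25) where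
  "(F \<^bold>\<longleftrightarrow> G) = ((F \<^bold>\<longrightarrow> G) \<^bold>\<and> (G \<^bold>\<longrightarrow> F))"

definition f_all :: "(var \<Rightarrow> form) \<Rightarrow> form"  (binder "\<^bold>\<forall>" 10) where
  "f_all F = (\<lambda>d. Uni (F d (Suc d)))"

definition f_ex :: "(var \<Rightarrow> form) \<Rightarrow> form"  (binder "\<^bold>\<exists>" 10) where
  "(\<^bold>\<exists>x. F x) = (\<^bold>\<not> (\<^bold>\<forall>x. \<^bold>\<not> F x))"

text \<open>
  An arbitrary formula \<open>p\<close> of the object language as an instance of a schema: its indices
  \<open>0, 1, \<dots>\<close> are read as the variables in \<open>xs\<close>, the remaining ones as the
  outermost variables (levels \<open>0, 1, \<dots>\<close>), which serve as parameters.
\<close>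

definition schema_inst :: "fm \<Rightarrow> var list \<Rightarrow> form" where
  "schema_inst p xs =
     (\<lambda>d. ren (\<lambda>i. d - Suc (if i < length xs then xs ! i else i - length xs)) p)"

text \<open>\<open>F\<close> preceded by quantifiers over the \<open>n\<close> parameters (levels \<open>0, \<dots>, n - 1\<close>).\<close>

definition univ_closure :: "nat \<Rightarrow> form \<Rightarrow> fm" where
  "univ_closure n F = (Uni ^^ n) (F n)"


section \<open>Basic set theory\<close>

definition is_sub :: "var \<Rightarrow> var \<Rightarrow> form"  (infix "\<^bold>\<subseteq>" 60) where
  "(a \<^bold>\<subseteq> b) = (\<^bold>\<forall>x. x \<^bold>\<in> a \<^bold>\<longrightarrow> x \<^bold>\<in> b)"

definition is_empty :: "var \<Rightarrow> form" where
  "is_empty a = (\<^bold>\<forall>x. \<^bold>\<not> x \<^bold>\<in> a)"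

text \<open>In the following, the first argument is the value: e.g. \<open>is_pair p a b\<close> says that \<open>p\<close> is the
  (Kuratowski) pair of \<open>a\<close> and \<open>b\<close>.\<close>

definition is_Union :: "var \<Rightarrow> var \<Rightarrow> form" where
  "is_Union u a = (\<^bold>\<forall>x. x \<^bold>\<in> u \<^bold>\<longleftrightarrow> (\<^bold>\<exists>y. y \<^bold>\<in> a \<^bold>\<and> x \<^bold>\<in> y))"

text \<open>Only for non-empty families.\<close>

definition is_Inter :: "var \<Rightarrow> var \<Rightarrow> form" where
  "is_Inter v a = (\<^bold>\<not> is_empty a \<^bold>\<and> (\<^bold>\<forall>x. x \<^bold>\<in> v \<^bold>\<longleftrightarrow> (\<^bold>\<forall>y. y \<^bold>\<in> a \<^bold>\<longrightarrow> x \<^bold>\<in> y)))"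

definition is_inter :: "var \<Rightarrow> var \<Rightarrow> var \<Rightarrow> form" where
  "is_inter c a b = (\<^bold>\<forall>x. x \<^bold>\<in> c \<^bold>\<longleftrightarrow> x \<^bold>\<in> a \<^bold>\<and> x \<^bold>\<in> b)"

definition is_diff :: "var \<Rightarrow> var \<Rightarrow> var \<Rightarrow> form" where
  "is_diff c a b = (\<^bold>\<forall>x. x \<^bold>\<in> c \<^bold>\<longleftrightarrow> x \<^bold>\<in> a \<^bold>\<and> \<^bold>\<not> x \<^bold>\<in> b)"

definition is_upair :: "var \<Rightarrow> var \<Rightarrow> var \<Rightarrow> form" where
  "is_upair p a b = (\<^bold>\<forall>x. x \<^bold>\<in> p \<^bold>\<longleftrightarrow> x \<^bold>= a \<^bold>\<or> x \<^bold>= b)"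

definition is_pair :: "var \<Rightarrow> var \<Rightarrow> var \<Rightarrow> form" where
  "is_pair p a b = (\<^bold>\<exists>s t. is_upair s a a \<^bold>\<and> is_upair t a b \<^bold>\<and> is_upair p s t)"

definition is_prod :: "var \<Rightarrow> var \<Rightarrow> var \<Rightarrow> form" where
  "is_prod q a b = (\<^bold>\<forall>p. p \<^bold>\<in> q \<^bold>\<longleftrightarrow> (\<^bold>\<exists>x y. x \<^bold>\<in> a \<^bold>\<and> y \<^bold>\<in> b \<^bold>\<and> is_pair p x y))"

text \<open>The pair of \<open>x\<close> and \<open>y\<close> is an element of \<open>f\<close>; for a function \<open>f\<close> this says that \<open>f(x) = y\<close>.\<close>

definition maps :: "var \<Rightarrow> var \<Rightarrow> var \<Rightarrow> form" where
  "maps f x y = (\<^bold>\<exists>p. is_pair p x y \<^bold>\<and> p \<^bold>\<in> f)"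

definition fun_on :: "var \<Rightarrow> var \<Rightarrow> form" where
  "fun_on f a =
     ((\<^bold>\<forall>p. p \<^bold>\<in> f \<^bold>\<longrightarrow> (\<^bold>\<exists>x y. x \<^bold>\<in> a \<^bold>\<and> is_pair p x y)) \<^bold>\<and>
      (\<^bold>\<forall>x. x \<^bold>\<in> a \<^bold>\<longrightarrow> (\<^bold>\<exists>y. maps f x y \<^bold>\<and> (\<^bold>\<forall>z. maps f x z \<^bold>\<longrightarrow> z \<^bold>= y))))"

definition fun_to :: "var \<Rightarrow> var \<Rightarrow> var \<Rightarrow> form" where
  "fun_to f a b = (fun_on f a \<^bold>\<and> (\<^bold>\<forall>x y. maps f x y \<^bold>\<longrightarrow> y \<^bold>\<in> b))"

definition is_bij :: "var \<Rightarrow> var \<Rightarrow> var \<Rightarrow> form" where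
  "is_bij f a b =
     (fun_to f a b \<^bold>\<and>
      (\<^bold>\<forall>x y z. maps f x z \<^bold>\<and> maps f y z \<^bold>\<longrightarrow> x \<^bold>= y) \<^bold>\<and>
      (\<^bold>\<forall>y. y \<^bold>\<in> b \<^bold>\<longrightarrow> (\<^bold>\<exists>x. maps f x y)))"

definition equipotent :: "var \<Rightarrow> var \<Rightarrow> form" where
  "equipotent a b = (\<^bold>\<exists>f. is_bij f a b)"

definition is_preimage :: "var \<Rightarrow> var \<Rightarrow> var \<Rightarrow> form" where
  "is_preimage v f b = (\<^bold>\<forall>x. x \<^bold>\<in> v \<^bold>\<longleftrightarrow> (\<^bold>\<exists>y. y \<^bold>\<in> b \<^bold>\<and> maps f x y))"

definition is_succ :: "var \<Rightarrow> var \<Rightarrow> form" where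
  "is_succ s n = (\<^bold>\<forall>x. x \<^bold>\<in> s \<^bold>\<longleftrightarrow> x \<^bold>\<in> n \<^bold>\<or> x \<^bold>= n)"

definition is_inductive :: "var \<Rightarrow> form" where
  "is_inductive w =
     ((\<^bold>\<exists>e. is_empty e \<^bold>\<and> e \<^bold>\<in> w) \<^bold>\<and> (\<^bold>\<forall>n. n \<^bold>\<in> w \<^bold>\<longrightarrow> (\<^bold>\<exists>s. is_succ s n \<^bold>\<and> s \<^bold>\<in> w)))"

definition is_omega :: "var \<Rightarrow> form" where
  "is_omega w = (is_inductive w \<^bold>\<and> (\<^bold>\<forall>v. is_inductive v \<^bold>\<longrightarrow> w \<^bold>\<subseteq> v))"

definition is_finite :: "var \<Rightarrow> form" where
  "is_finite a = (\<^bold>\<exists>w n. is_omega w \<^bold>\<and> n \<^bold>\<in> w \<^bold>\<and> equipotent a n)"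

definition is_countable :: "var \<Rightarrow> form" where
  "is_countable a = (\<^bold>\<exists>w s. is_omega w \<^bold>\<and> s \<^bold>\<subseteq> w \<^bold>\<and> equipotent a s)"

definition is_denumerable :: "var \<Rightarrow> form" where
  "is_denumerable a = (\<^bold>\<not> is_finite a \<^bold>\<and> is_countable a)"


section \<open>The axioms of ZF\<close>

definition ax_extensionality :: form where
  "ax_extensionality = (\<^bold>\<forall>a b. (\<^bold>\<forall>x. x \<^bold>\<in> a \<^bold>\<longleftrightarrow> x \<^bold>\<in> b) \<^bold>\<longrightarrow> a \<^bold>= b)"

definition ax_foundation :: form where
  "ax_foundation =
     (\<^bold>\<forall>a. \<^bold>\<not> is_empty a \<^bold>\<longrightarrow> (\<^bold>\<exists>x. x \<^bold>\<in> a \<^bold>\<and> \<^bold>\<not> (\<^bold>\<exists>y. y \<^bold>\<in> x \<^bold>\<and> y \<^bold>\<in> a)))"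

definition ax_pairing :: form where
  "ax_pairing = (\<^bold>\<forall>a b. \<^bold>\<exists>p. is_upair p a b)"

definition ax_union :: form where
  "ax_union = (\<^bold>\<forall>a. \<^bold>\<exists>u. is_Union u a)"

definition ax_power :: form where
  "ax_power = (\<^bold>\<forall>a. \<^bold>\<exists>b. \<^bold>\<forall>x. x \<^bold>\<in> b \<^bold>\<longleftrightarrow> x \<^bold>\<subseteq> a)"

definition ax_infinity :: form where
  "ax_infinity = (\<^bold>\<exists>w. is_inductive w)"

definition ax_separation :: "fm \<Rightarrow> form" where
  "ax_separation p = (\<^bold>\<forall>a. \<^bold>\<exists>b. \<^bold>\<forall>x. x \<^bold>\<in> b \<^bold>\<longleftrightarrow> x \<^bold>\<in> a \<^bold>\<and> schema_inst p [x, a])"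

definition ax_replacement :: "fm \<Rightarrow> form" where
  "ax_replacement p =
     (\<^bold>\<forall>a. (\<^bold>\<forall>x y z. x \<^bold>\<in> a \<^bold>\<and> schema_inst p [x, y, a] \<^bold>\<and> schema_inst p [x, z, a] \<^bold>\<longrightarrow> y \<^bold>= z) \<^bold>\<longrightarrow>
           (\<^bold>\<exists>b. \<^bold>\<forall>y. y \<^bold>\<in> b \<^bold>\<longleftrightarrow> (\<^bold>\<exists>x. x \<^bold>\<in> a \<^bold>\<and> schema_inst p [x, y, a])))"

definition ZF :: "fm set" where
  "ZF = {ax_extensionality 0, ax_foundation 0, ax_pairing 0, ax_union 0, ax_power 0, ax_infinity 0}
      \<union> {univ_closure n (ax_separation p) | n p. bounded_fm (n + 2) p}
      \<union> {univ_closure n (ax_replacement p) | n p. bounded_fm (n + 3) p}"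


section \<open>Countable multiple choice\<close>

text \<open>A family indexed by \<open>J\<close> is a function \<open>A\<close> with domain \<open>J\<close>.\<close>

definition is_mult_choice_fun :: "var \<Rightarrow> var \<Rightarrow> var \<Rightarrow> form" where
  "is_mult_choice_fun g A J =
     (fun_on g J \<^bold>\<and>
      (\<^bold>\<forall>j F B. maps g j F \<^bold>\<and> maps A j B \<^bold>\<longrightarrow> F \<^bold>\<subseteq> B \<^bold>\<and> \<^bold>\<not> is_empty F \<^bold>\<and> is_finite F))"

definition CMC :: form where
  "CMC =
     (\<^bold>\<forall>J A. is_denumerable J \<^bold>\<and> fun_on A J \<^bold>\<and> (\<^bold>\<forall>j B. maps A j B \<^bold>\<longrightarrow> \<^bold>\<not> is_empty B) \<^bold>\<longrightarrow>
            (\<^bold>\<exists>g. is_mult_choice_fun g A J))"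


section \<open>The real line\<close>

text \<open>
  The real line enters as an arbitrary Dedekind-complete ordered field; such a structure exists
  and is unique up to isomorphism, by a theorem of ZF.  The record collects the variables denoting its
  components: the underlying set, the graphs of addition and multiplication, the strict order, and
  the two constants.
\<close>

record real_vars =
  car :: var
  add :: var
  mul :: var
  lt :: var
  r_zero :: var
  r_one :: var

text \<open>\<open>r_sum S a b c\<close>: \<open>a + b = c\<close>, and similarly for \<open>r_prod\<close>.\<close>

definition r_sum :: "real_vars \<Rightarrow> var \<Rightarrow> var \<Rightarrow> var \<Rightarrow> form" where
  "r_sum S a b c = (\<^bold>\<exists>p. is_pair p a b \<^bold>\<and> maps (add S) p c)"

definition r_prod :: "real_vars \<Rightarrow> var \<Rightarrow> var \<Rightarrow> var \<Rightarrow> form" where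
  "r_prod S a b c = (\<^bold>\<exists>p. is_pair p a b \<^bold>\<and> maps (mul S) p c)"

definition r_less :: "real_vars \<Rightarrow> var \<Rightarrow> var \<Rightarrow> form" where
  "r_less S a b = maps (lt S) a b"

definition r_le :: "real_vars \<Rightarrow> var \<Rightarrow> var \<Rightarrow> form" where
  "r_le S a b = (r_less S a b \<^bold>\<or> a \<^bold>= b)"

definition is_upper_bound :: "real_vars \<Rightarrow> var \<Rightarrow> var \<Rightarrow> form" where
  "is_upper_bound S b s = (b \<^bold>\<in> car S \<^bold>\<and> (\<^bold>\<forall>x. x \<^bold>\<in> s \<^bold>\<longrightarrow> r_le S x b))"

definition is_field :: "real_vars \<Rightarrow> form" where
  "is_field S =
     ((\<^bold>\<exists>q. is_prod q (car S) (car S) \<^bold>\<and> fun_to (add S) q (car S) \<^bold>\<and> fun_to (mul S) q (car S)) \<^bold>\<and>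
      r_zero S \<^bold>\<in> car S \<^bold>\<and> r_one S \<^bold>\<in> car S \<^bold>\<and> \<^bold>\<not> r_zero S \<^bold>= r_one S \<^bold>\<and>
      (\<^bold>\<forall>a b c. r_sum S a b c \<^bold>\<longrightarrow> r_sum S b a c) \<^bold>\<and>
      (\<^bold>\<forall>a b c. r_prod S a b c \<^bold>\<longrightarrow> r_prod S b a c) \<^bold>\<and>
      (\<^bold>\<forall>a b c u v w. r_sum S a b u \<^bold>\<and> r_sum S b c v \<^bold>\<longrightarrow> (r_sum S u c w \<^bold>\<longleftrightarrow> r_sum S a v w)) \<^bold>\<and>
      (\<^bold>\<forall>a b c u v w. r_prod S a b u \<^bold>\<and> r_prod S b c v \<^bold>\<longrightarrow> (r_prod S u c w \<^bold>\<longleftrightarrow> r_prod S a v w)) \<^bold>\<and>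
      (\<^bold>\<forall>a b c s u v w. r_sum S a b s \<^bold>\<and> r_prod S a c u \<^bold>\<and> r_prod S b c v \<^bold>\<longrightarrow>
                       (r_prod S s c w \<^bold>\<longleftrightarrow> r_sum S u v w)) \<^bold>\<and>
      (\<^bold>\<forall>a. a \<^bold>\<in> car S \<^bold>\<longrightarrow> r_sum S a (r_zero S) a \<^bold>\<and> r_prod S a (r_one S) a) \<^bold>\<and>
      (\<^bold>\<forall>a. a \<^bold>\<in> car S \<^bold>\<longrightarrow> (\<^bold>\<exists>b. r_sum S a b (r_zero S))) \<^bold>\<and>
      (\<^bold>\<forall>a. a \<^bold>\<in> car S \<^bold>\<and> \<^bold>\<not> a \<^bold>= r_zero S \<^bold>\<longrightarrow> (\<^bold>\<exists>b. r_prod S a b (r_one S))))"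

definition is_ordered_field :: "real_vars \<Rightarrow> form" where
  "is_ordered_field S =
     (is_field S \<^bold>\<and>
      (\<^bold>\<exists>q. is_prod q (car S) (car S) \<^bold>\<and> lt S \<^bold>\<subseteq> q) \<^bold>\<and>
      (\<^bold>\<forall>a. \<^bold>\<not> r_less S a a) \<^bold>\<and>
      (\<^bold>\<forall>a b c. r_less S a b \<^bold>\<and> r_less S b c \<^bold>\<longrightarrow> r_less S a c) \<^bold>\<and>
      (\<^bold>\<forall>a b. a \<^bold>\<in> car S \<^bold>\<and> b \<^bold>\<in> car S \<^bold>\<longrightarrow> r_less S a b \<^bold>\<or> a \<^bold>= b \<^bold>\<or> r_less S b a) \<^bold>\<and>
      (\<^bold>\<forall>a b c u v. r_less S a b \<^bold>\<and> r_sum S a c u \<^bold>\<and> r_sum S b c v \<^bold>\<longrightarrow> r_less S u v) \<^bold>\<and>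
      (\<^bold>\<forall>a b c. r_less S (r_zero S) a \<^bold>\<and> r_less S (r_zero S) b \<^bold>\<and> r_prod S a b c \<^bold>\<longrightarrow> r_less S (r_zero S) c))"

definition is_real_field :: "real_vars \<Rightarrow> form" where
  "is_real_field S =
     (is_ordered_field S \<^bold>\<and>
      (\<^bold>\<forall>s. s \<^bold>\<subseteq> car S \<^bold>\<and> \<^bold>\<not> is_empty s \<^bold>\<and> (\<^bold>\<exists>b. is_upper_bound S b s) \<^bold>\<longrightarrow>
           (\<^bold>\<exists>b. is_upper_bound S b s \<^bold>\<and> (\<^bold>\<forall>c. is_upper_bound S c s \<^bold>\<longrightarrow> r_le S b c))))"

definition for_reals :: "(real_vars \<Rightarrow> form) \<Rightarrow> form"  (binder "\<^bold>\<forall>\<^sub>\<real>" 10) where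
  "for_reals F =
     (\<^bold>\<forall>R P T L z i.
        is_real_field \<lparr>car = R, add = P, mul = T, lt = L, r_zero = z, r_one = i\<rparr> \<^bold>\<longrightarrow>
        F \<lparr>car = R, add = P, mul = T, lt = L, r_zero = z, r_one = i\<rparr>)"

text \<open>\<open>d\<close> is the absolute value of \<open>a - b\<close>, where \<open>u\<close> stands for \<open>a - b\<close>.\<close>

definition is_dist :: "real_vars \<Rightarrow> var \<Rightarrow> var \<Rightarrow> var \<Rightarrow> form" where
  "is_dist S d a b =
     (\<^bold>\<exists>u. r_sum S b u a \<^bold>\<and>
          (r_le S (r_zero S) u \<^bold>\<and> d \<^bold>= u \<^bold>\<or> r_less S u (r_zero S) \<^bold>\<and> r_sum S u d (r_zero S)))"

definition is_open_real :: "real_vars \<Rightarrow> var \<Rightarrow> form" where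
  "is_open_real S W =
     (W \<^bold>\<subseteq> car S \<^bold>\<and>
      (\<^bold>\<forall>x. x \<^bold>\<in> W \<^bold>\<longrightarrow>
        (\<^bold>\<exists>e. r_less S (r_zero S) e \<^bold>\<and> (\<^bold>\<forall>y d. is_dist S d x y \<^bold>\<and> r_less S d e \<^bold>\<longrightarrow> y \<^bold>\<in> W))))"


section \<open>Topological spaces\<close>

text \<open>A space is given by its underlying set \<open>X\<close> and its family \<open>t\<close> of open sets.\<close>

definition is_topology :: "var \<Rightarrow> var \<Rightarrow> form" where
  "is_topology X t =
     ((\<^bold>\<forall>u. u \<^bold>\<in> t \<^bold>\<longrightarrow> u \<^bold>\<subseteq> X) \<^bold>\<and>
      (\<^bold>\<exists>e. is_empty e \<^bold>\<and> e \<^bold>\<in> t) \<^bold>\<and> X \<^bold>\<in> t \<^bold>\<and>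
      (\<^bold>\<forall>a u. a \<^bold>\<subseteq> t \<^bold>\<and> is_Union u a \<^bold>\<longrightarrow> u \<^bold>\<in> t) \<^bold>\<and>
      (\<^bold>\<forall>u v w. u \<^bold>\<in> t \<^bold>\<and> v \<^bold>\<in> t \<^bold>\<and> is_inter w u v \<^bold>\<longrightarrow> w \<^bold>\<in> t))"

definition is_clopen :: "var \<Rightarrow> var \<Rightarrow> var \<Rightarrow> form" where
  "is_clopen X t u = (u \<^bold>\<in> t \<^bold>\<and> (\<^bold>\<exists>c. is_diff c X u \<^bold>\<and> c \<^bold>\<in> t))"

definition clopen_family :: "var \<Rightarrow> var \<Rightarrow> var \<Rightarrow> form" where
  "clopen_family X t U = (\<^bold>\<forall>u. u \<^bold>\<in> U \<^bold>\<longrightarrow> is_clopen X t u)"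

definition in_C :: "real_vars \<Rightarrow> var \<Rightarrow> var \<Rightarrow> var \<Rightarrow> form" where
  "in_C S X t f =
     (fun_to f X (car S) \<^bold>\<and>
      (\<^bold>\<forall>W v. is_open_real S W \<^bold>\<and> is_preimage v f W \<^bold>\<longrightarrow> v \<^bold>\<in> t))"

definition is_zero_set :: "real_vars \<Rightarrow> var \<Rightarrow> var \<Rightarrow> var \<Rightarrow> form" where
  "is_zero_set S X t Z =
     (\<^bold>\<exists>f s. in_C S X t f \<^bold>\<and> is_upair s (r_zero S) (r_zero S) \<^bold>\<and> is_preimage Z f s)"

definition is_cozero_set :: "real_vars \<Rightarrow> var \<Rightarrow> var \<Rightarrow> var \<Rightarrow> form" where
  "is_cozero_set S X t V = (\<^bold>\<exists>Z. is_zero_set S X t Z \<^bold>\<and> is_diff V X Z)"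

definition is_completely_regular :: "real_vars \<Rightarrow> var \<Rightarrow> var \<Rightarrow> form" where
  "is_completely_regular S X t =
     (is_topology X t \<^bold>\<and>
      (\<^bold>\<forall>V. is_cozero_set S X t V \<^bold>\<longrightarrow> V \<^bold>\<in> t) \<^bold>\<and>
      (\<^bold>\<forall>u. u \<^bold>\<in> t \<^bold>\<longrightarrow> (\<^bold>\<exists>a. (\<^bold>\<forall>V. V \<^bold>\<in> a \<^bold>\<longrightarrow> is_cozero_set S X t V) \<^bold>\<and> is_Union u a)))"

definition is_strongly_zero_dim :: "real_vars \<Rightarrow> var \<Rightarrow> var \<Rightarrow> form" where
  "is_strongly_zero_dim S X t =
     (is_completely_regular S X t \<^bold>\<and>
      (\<^bold>\<forall>Z\<^sub>1 Z\<^sub>2. is_zero_set S X t Z\<^sub>1 \<^bold>\<and> is_zero_set S X t Z\<^sub>2 \<^bold>\<and> \<^bold>\<not> (\<^bold>\<exists>x. x \<^bold>\<in> Z\<^sub>1 \<^bold>\<and> x \<^bold>\<in> Z\<^sub>2) \<^bold>\<longrightarrow>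
        (\<^bold>\<exists>U c. is_clopen X t U \<^bold>\<and> Z\<^sub>1 \<^bold>\<subseteq> U \<^bold>\<and> is_diff c X Z\<^sub>2 \<^bold>\<and> U \<^bold>\<subseteq> c)))"

definition in_A :: "real_vars \<Rightarrow> var \<Rightarrow> var \<Rightarrow> var \<Rightarrow> form" where
  "in_A S X t f =
     (in_C S X t f \<^bold>\<and>
      (\<^bold>\<forall>W v. is_open_real S W \<^bold>\<and> is_preimage v f W \<^bold>\<longrightarrow>
        (\<^bold>\<exists>U. is_countable U \<^bold>\<and> clopen_family X t U \<^bold>\<and> is_Union v U)))"

text \<open>
  \<open>s\<close> is the supremum of the distances of \<open>f(x)\<close> and \<open>f(y)\<close> for \<open>x\<close> and \<open>y\<close> in \<open>a\<close>, taken among the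
  non-negative reals, so that it is 0 for empty \<open>a\<close>.  No \<open>s\<close> qualifies if the distances are unbounded.
\<close>

definition osc_bound :: "real_vars \<Rightarrow> var \<Rightarrow> var \<Rightarrow> var \<Rightarrow> form" where
  "osc_bound S s f a =
     (r_le S (r_zero S) s \<^bold>\<and>
      (\<^bold>\<forall>x y u v d. x \<^bold>\<in> a \<^bold>\<and> y \<^bold>\<in> a \<^bold>\<and> maps f x u \<^bold>\<and> maps f y v \<^bold>\<and> is_dist S d u v \<^bold>\<longrightarrow> r_le S d s))"

definition is_osc :: "real_vars \<Rightarrow> var \<Rightarrow> var \<Rightarrow> var \<Rightarrow> form" where
  "is_osc S s f a = (osc_bound S s f a \<^bold>\<and> (\<^bold>\<forall>r. osc_bound S r f a \<^bold>\<longrightarrow> r_le S s r))"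

definition in_U :: "real_vars \<Rightarrow> var \<Rightarrow> var \<Rightarrow> var \<Rightarrow> form" where
  "in_U S X t f =
     (in_C S X t f \<^bold>\<and>
      (\<^bold>\<forall>e. r_less S (r_zero S) e \<^bold>\<longrightarrow>
        (\<^bold>\<exists>U. is_countable U \<^bold>\<and> clopen_family X t U \<^bold>\<and> is_Union X U \<^bold>\<and>
             (\<^bold>\<forall>a. a \<^bold>\<in> U \<^bold>\<longrightarrow> (\<^bold>\<exists>s. is_osc S s f a \<^bold>\<and> r_le S s e)))))"

end

theory Submission
  imports Defs "HOL-Library.Countable_Set"
begin

text \<open>
  By completeness of the calculus it suffices to prove the statement in every model of ZF with
  domain \<open>nat\<close>; separation and replacement are available there for the predicates that are
  definable with parameters.

  In such a model, composing a continuous \<open>f\<close> with the (1-Lipschitz) distance to a closed set \<open>K\<close> shows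
  that \<open>f\<^sup>-\<^sup>1[K]\<close> is a zero-set.  If \<open>K\<^sub>n\<close> and \<open>L\<^sub>n\<close> are disjoint closed sets of reals for each
  \<open>n \<in> \<omega>\<close>, multiple choice selects finitely many clopen sets separating \<open>f\<^sup>-\<^sup>1[K\<^sub>n]\<close> from
  \<open>f\<^sup>-\<^sup>1[L\<^sub>n]\<close>, and the intersection \<open>U\<^sub>n\<close> of these is a clopen set defined without further choice.
  With \<open>K\<^sub>n = {0}\<close> and \<open>L\<^sub>n = {r. \<bar>r\<bar> \<ge> 2\<^sup>-\<^sup>n}\<close> the sets \<open>U\<^sub>n\<close> intersect in the zero-set of \<open>f\<close>, and
  their complements cover its complement.  With \<open>K\<^sub>n = {r. \<bar>r - c\<^sub>n\<bar> \<le> \<eta>/4}\<close> and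
  \<open>L\<^sub>n = {r. \<bar>r - c\<^sub>n\<bar> \<ge> \<eta>/2}\<close>, where \<open>c\<close> enumerates the integer multiples of \<open>\<eta>/4\<close>, the \<open>U\<^sub>n\<close> cover
  the space and \<open>f\<close> has oscillation at most \<open>\<eta>\<close> on each of them.
\<close>

section \<open>Completeness of the calculus\<close>

primrec fv :: "fm \<Rightarrow> nat set" where
  "fv Fls = {}"
| "fv (Mem i j) = {i, j}"
| "fv (Eql i j) = {i, j}"
| "fv (Imp p q) = fv p \<union> fv q"
| "fv (Uni p) = {i. Suc i \<in> fv p}"

lemma finite_fv: "finite (fv p)"
proof (induction p)
  case (Uni p)
  have "fv (Uni p) = Suc -` fv p" by auto
  then show ?case using Uni by (simp add: finite_vimageI)
qed auto

lemma ren_cong: "(\<And>i. i \<in> fv p \<Longrightarrow> r i = s i) \<Longrightarrow> ren r p = ren s p"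
proof (induction p arbitrary: r s)
  case (Uni p)
  have "ren (case_nat 0 (\<lambda>i. Suc (r i))) p = ren (case_nat 0 (\<lambda>i. Suc (s i))) p"
    by (rule Uni.IH) (use Uni.prems in \<open>auto split: nat.split\<close>)
  then show ?case by simp
next
  case (Imp p q)
  then show ?case by (metis UnCI fv.simps(4) ren.simps(4))
qed auto

lemma ren_id [simp]: "ren id p = p" "ren (\<lambda>i. i) p = p"
proof -
  have "ren (\<lambda>i. i) p = p"
  proof (induction p)
    case (Uni p)
    have "(case_nat 0 (\<lambda>i. Suc i)) = (\<lambda>i. i)" by (auto split: nat.split)
    then show ?case using Uni by simp
  qed auto
  then show "ren id p = p" "ren (\<lambda>i. i) p = p" by (simp_all add: id_def)
qed

lemma ren_ren: "ren r (ren s p) = ren (\<lambda>i. r (s i)) p"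
proof (induction p arbitrary: r s)
  case (Uni p)
  have "(\<lambda>i. case_nat 0 (\<lambda>i. Suc (r i)) (case_nat 0 (\<lambda>i. Suc (s i)) i)) =
    case_nat 0 (\<lambda>i. Suc (r (s i)))"
    by (auto split: nat.split)
  then show ?case by (simp add: Uni)
qed auto

lemma proves_weaken: "H \<turnstile> p \<Longrightarrow> H \<subseteq> K \<Longrightarrow> K \<turnstile> p"
proof (induction arbitrary: K rule: proves.induct)
  case (ImpI p H q)
  then show ?case by (meson insert_mono proves.ImpI)
next
  case (Contr p H)
  then show ?case by (meson insert_mono proves.Contr)
next
  case (UniI H p)
  then show ?case by (meson image_mono proves.UniI)
next
  case (EqlE H x y p)
  then show ?case by (meson proves.EqlE)
next
  case (ImpE H p q)
  then show ?case by (meson proves.ImpE)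
qed (auto intro: proves.Assm proves.UniE proves.EqlI)

text \<open>Renaming acts on whole derivations: at \<open>UniI\<close> it is lifted past the binder,
  and at \<open>UniE\<close> and \<open>EqlE\<close> it commutes with the instantiation of index 0.
  This allows free variables to be moved out of the way.\<close>

lemma proves_ren: "H \<turnstile> p \<Longrightarrow> ren r ` H \<turnstile> ren r p"
proof (induction arbitrary: r rule: proves.induct)
  case (UniI H p)
  have "ren (case_nat 0 (\<lambda>i. Suc (r i))) ` ren Suc ` H = ren Suc ` ren r ` H"
    by (auto simp: image_image ren_ren)
  then show ?case using UniI.IH[of "case_nat 0 (\<lambda>i. Suc (r i))"] by (auto intro: proves.UniI)
next
  case (UniE H p x)
  have "ren r (ren (case_nat x id) p) = ren (case_nat (r x) id) (ren (case_nat 0 (\<lambda>i. Suc (r i))) p)"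
    by (auto simp: ren_ren intro!: ren_cong split: nat.split)
  then show ?case using UniE.IH[of r] by (metis proves.UniE ren.simps(5))
next
  case (EqlE H x y p)
  have *: "ren r (ren (case_nat z id) p) = ren (case_nat (r z) id) (ren (case_nat 0 (\<lambda>i. Suc (r i))) p)"
    for z by (auto simp: ren_ren intro!: ren_cong split: nat.split)
  show ?case using EqlE.IH[of r] unfolding * by (metis proves.EqlE ren.simps(3))
next
  case (ImpE H p q)
  then show ?case by (metis proves.ImpE ren.simps(4))
next
  case (Contr p H)
  show ?case using Contr.IH[of r] by (simp add: proves.Contr)
next
  case (ImpI p H q)
  show ?case using ImpI.IH[of r] by (simp add: proves.ImpI)
next
  case (Assm p H)
  then show ?case by (intro proves.Assm imageI)
next
  case (EqlI H x)
  show ?case unfolding ren.simps by (rule proves.EqlI)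
qed

text \<open>This is what makes the union of the Henkin stages consistent.\<close>

lemma proves_finite: "H \<turnstile> p \<Longrightarrow> \<exists>F. finite F \<and> F \<subseteq> H \<and> F \<turnstile> p"
proof (induction rule: proves.induct)
  case (Assm p H)
  then show ?case by (intro exI[of _ "{p}"]) (auto intro: proves.Assm)
next
  case (ImpI p H q)
  then obtain F where F: "finite F" "F \<subseteq> insert p H" "F \<turnstile> q" by blast
  have "F - {p} \<turnstile> Imp p q" by (rule proves.ImpI[OF proves_weaken[OF F(3)]]) auto
  then show ?case using F by (intro exI[of _ "F - {p}"]) auto
next
  case (ImpE H p q)
  then obtain F G where FG: "finite F" "F \<subseteq> H" "F \<turnstile> Imp p q" "finite G" "G \<subseteq> H" "G \<turnstile> p"
    by blast
  have "F \<union> G \<turnstile> q"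
    using proves.ImpE[OF proves_weaken[OF FG(3)] proves_weaken[OF FG(6)]] by blast
  then show ?case using FG by (intro exI[of _ "F \<union> G"]) simp
next
  case (Contr p H)
  then obtain F where F: "finite F" "F \<subseteq> insert (Imp p Fls) H" "F \<turnstile> Fls" by blast
  have "F - {Imp p Fls} \<turnstile> p" by (rule proves.Contr[OF proves_weaken[OF F(3)]]) auto
  then show ?case using F by (intro exI[of _ "F - {Imp p Fls}"]) auto
next
  case (UniI H p)
  then obtain F where "finite F" "F \<subseteq> ren Suc ` H" "F \<turnstile> p" by blast
  then obtain G where "finite G" "G \<subseteq> H" "F = ren Suc ` G" by (meson finite_subset_image)
  then show ?case using \<open>F \<turnstile> p\<close> by (auto intro: proves.UniI)
next
  case (UniE H p x)
  then show ?case by (meson proves.UniE)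
next
  case (EqlI H x)
  then show ?case by (intro exI[of _ "{}"]) (auto intro: proves.EqlI)
next
  case (EqlE H x y p)
  then obtain F G where FG: "finite F" "F \<subseteq> H" "F \<turnstile> Eql x y" "finite G" "G \<subseteq> H"
    "G \<turnstile> ren (case_nat x id) p" by blast
  have "F \<union> G \<turnstile> ren (case_nat y id) p"
    using proves.EqlE[OF proves_weaken[OF FG(3)] proves_weaken[OF FG(6)]] by blast
  then show ?case using FG by (intro exI[of _ "F \<union> G"]) simp
qed

text \<open>The renaming \<open>?r\<close> sends the fresh \<open>x\<close> to 0 and acts as
  \<open>Suc\<close> elsewhere: on \<open>G\<close> it is the shift that \<open>UniI\<close>
  demands, and it undoes the instantiation of \<open>q\<close> at \<open>x\<close>. Read
  contrapositively, a refuting instance at a fresh variable can be added without losing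
  consistency.\<close>

lemma proves_not_Uni:
  assumes x: "x \<notin> \<Union> (fv ` G)" "x \<notin> fv (Uni q)"
    and bot: "insert (Imp (ren (case_nat x id) q) Fls) G \<turnstile> Fls"
  shows "G \<turnstile> Uni q"
proof -
  let ?r = "\<lambda>i. if i = x then 0 else Suc i"
  have "ren ?r ` G \<turnstile> ren ?r (ren (case_nat x id) q)"
    using bot by (rule proves_ren[OF proves.Contr])
  moreover have "ren ?r p = ren Suc p" if "p \<in> G" for p
    using x that by (intro ren_cong) auto
  then have "ren ?r ` G = ren Suc ` G" by force
  moreover have "ren ?r (ren (case_nat x id) q) = ren id q"
    unfolding ren_ren using x by (intro ren_cong) (auto split: nat.split)
  ultimately show ?thesis by (simp add: proves.UniI)
qed

section \<open>Henkin extension of a consistent set\<close>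

instance fm :: countable by countable_datatype

text \<open>Variables play the role of Henkin constants. There is at most one witness formula, and
  none unless \<open>p\<close> is a negated universal formula; freshness refers to \<open>p\<close>
  as well, because \<open>p\<close> enters together with its witness.\<close>

definition witnesses :: "fm set \<Rightarrow> fm \<Rightarrow> fm set" where
  "witnesses G p =
     {Imp (ren (case_nat (SOME x. x \<notin> \<Union> (fv ` insert p G)) id) q) Fls | q. p = Imp (Uni q) Fls}"

primrec henkin :: "fm set \<Rightarrow> nat \<Rightarrow> fm set" where
  "henkin H 0 = H"
| "henkin H (Suc n) =
     (if insert (from_nat n) (henkin H n) \<turnstile> Fls then henkin H n
      else insert (from_nat n) (henkin H n) \<union> witnesses (henkin H n) (from_nat n))"

lemma finite_witnesses: "finite (witnesses G p)"
  by (cases "\<exists>q. p = Imp (Uni q) Fls") (auto simp: witnesses_def)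

lemma henkin_consistent:
  assumes "\<not> H \<turnstile> Fls" and inf: "infinite (- \<Union> (fv ` H))"
  shows "\<not> henkin H n \<turnstile> Fls \<and> infinite (- \<Union> (fv ` henkin H n))"
proof (induction n)
  case (Suc n)
  let ?G = "henkin H n" and ?p = "from_nat n :: fm"
  show ?case
  proof (cases "insert ?p ?G \<turnstile> Fls")
    case False
    have "- \<Union> (fv ` henkin H (Suc n)) = - \<Union> (fv ` ?G) - (fv ?p \<union> \<Union> (fv ` witnesses ?G ?p))"
      using False by auto
    then have inf': "infinite (- \<Union> (fv ` henkin H (Suc n)))"
      using Suc finite_fv finite_witnesses by (simp add: Diff_infinite_finite)
    have "infinite (- \<Union> (fv ` insert ?p ?G))"
    proof -
      have "- \<Union> (fv ` insert ?p ?G) = - \<Union> (fv ` ?G) - fv ?p" by auto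
      then show ?thesis using Suc finite_fv by (simp add: Diff_infinite_finite)
    qed
    then obtain x where "x \<notin> \<Union> (fv ` insert ?p ?G)"
      by (metis Compl_iff all_not_in_conv finite.emptyI)
    then have x: "(SOME x. x \<notin> \<Union> (fv ` insert ?p ?G)) \<notin> \<Union> (fv ` insert ?p ?G)"
      by (rule someI)
    have "\<not> henkin H (Suc n) \<turnstile> Fls"
    proof
      assume bot: "henkin H (Suc n) \<turnstile> Fls"
      show False
      proof (cases "\<exists>q. ?p = Imp (Uni q) Fls")
        case True
        then obtain q where q: "?p = Imp (Uni q) Fls" by blast
        let ?x = "SOME x. x \<notin> \<Union> (fv ` insert ?p ?G)"
        have "witnesses ?G ?p = {Imp (ren (case_nat ?x id) q) Fls}"
          using q by (auto simp: witnesses_def)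
        then have "insert (Imp (ren (case_nat ?x id) q) Fls) (insert ?p ?G) \<turnstile> Fls"
          using bot False by simp
        moreover have "?x \<notin> fv (Uni q)" using x q by auto
        ultimately have "insert ?p ?G \<turnstile> Uni q" using x proves_not_Uni by blast
        moreover have "insert ?p ?G \<turnstile> Imp (Uni q) Fls" using q by (intro proves.Assm) simp
        ultimately show False using False proves.ImpE by blast
      next
        case no: False
        then have "witnesses ?G ?p = {}" by (auto simp: witnesses_def)
        then show False using bot False by simp
      qed
    qed
    then show ?thesis using inf' by blast
  next
    case True
    then have "henkin H (Suc n) = henkin H n" by simp
    then show ?thesis using Suc by metis
  qed
next
  case 0
  show ?case unfolding henkin.simps using assms by blast
qed

section \<open>Maximal consistent sets with witnesses\<close>

locale henkin_set =
  fixes G :: "fm set"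
  assumes consistent: "\<not> G \<turnstile> Fls"
    and complete: "p \<in> G \<or> insert p G \<turnstile> Fls"
    and witness: "Imp (Uni q) Fls \<in> G \<Longrightarrow> \<exists>x. Imp (ren (case_nat x id) q) Fls \<in> G"
begin

lemma closed: "G \<turnstile> p \<longleftrightarrow> p \<in> G"
proof
  assume "G \<turnstile> p"
  then show "p \<in> G" using complete[of p] consistent by (meson proves.ImpE proves.ImpI)
qed (rule proves.Assm)

lemma Fls_iff: "Fls \<notin> G"
  using consistent closed by blast

lemma Imp_iff: "Imp p q \<in> G \<longleftrightarrow> (p \<in> G \<longrightarrow> q \<in> G)"
proof
  show "Imp p q \<in> G \<Longrightarrow> p \<in> G \<longrightarrow> q \<in> G" by (metis closed proves.ImpE)
next
  assume pq: "p \<in> G \<longrightarrow> q \<in> G"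
  have "insert p G \<turnstile> q"
  proof (cases "p \<in> G")
    case True
    then show ?thesis using pq by (auto intro: proves.Assm)
  next
    case False
    then have "insert p G \<turnstile> Fls" using complete by blast
    then show ?thesis by (meson proves.Contr proves_weaken subset_insertI)
  qed
  then show "Imp p q \<in> G" by (metis closed proves.ImpI)
qed

text \<open>If \<open>Uni p\<close> is absent, its negation is present, and the witness of the
  latter yields a missing instance.\<close>

lemma Uni_iff: "Uni p \<in> G \<longleftrightarrow> (\<forall>x. ren (case_nat x id) p \<in> G)"
  by (metis Fls_iff Imp_iff closed proves.UniE witness)

lemma Eql_refl: "Eql x x \<in> G"
  by (metis closed proves.EqlI)

lemma Eql_subst: "Eql x y \<in> G \<Longrightarrow> ren (case_nat x id) p \<in> G \<Longrightarrow> ren (case_nat y id) p \<in> G"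
  by (metis closed proves.EqlE)

text \<open>In the template \<open>Eql 0 (Suc x)\<close> index 0 marks the place to be replaced,
  while \<open>Suc x\<close> becomes \<open>x\<close> under instantiation. The next two lemmas use
  templates of the same kind.\<close>

lemma Eql_sym: "Eql x y \<in> G \<Longrightarrow> Eql y x \<in> G"
  using Eql_subst[of x y "Eql 0 (Suc x)"] Eql_refl by simp

lemma Eql_trans: "Eql x y \<in> G \<Longrightarrow> Eql y z \<in> G \<Longrightarrow> Eql x z \<in> G"
  using Eql_subst[of y z "Eql (Suc x) 0"] by simp

lemma Mem_cong: "Eql x x' \<in> G \<Longrightarrow> Eql y y' \<in> G \<Longrightarrow> Mem x y \<in> G \<Longrightarrow> Mem x' y' \<in> G"
  using Eql_subst[of x x' "Mem 0 (Suc y)"] Eql_subst[of y y' "Mem (Suc x') 0"] by simp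

text \<open>The least member represents its equality class, so the quotient by \<open>Eql\<close> is
  a set of naturals on which equality can be interpreted as identity.\<close>

definition cls :: "nat \<Rightarrow> nat" where
  "cls x = (LEAST y. Eql x y \<in> G)"

lemma cls_eq_iff: "cls x = cls y \<longleftrightarrow> Eql x y \<in> G"
proof
  have *: "Eql z (cls z) \<in> G" for z
    unfolding cls_def by (rule LeastI, rule Eql_refl)
  show "cls x = cls y \<Longrightarrow> Eql x y \<in> G"
    by (metis * Eql_sym Eql_trans)
  assume "Eql x y \<in> G"
  then have "Eql x z \<in> G \<longleftrightarrow> Eql y z \<in> G" for z by (metis Eql_sym Eql_trans)
  then show "cls x = cls y" by (simp add: cls_def)
qed

end

lemma henkin_set_henkin:
  assumes "\<not> H \<turnstile> Fls" and "infinite (- \<Union> (fv ` H))"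
  shows "henkin_set (\<Union> (range (henkin H)))"
proof
  have mono: "henkin H m \<subseteq> henkin H n" if "m \<le> n" for m n
    using that by (induction rule: dec_induct) auto
  show "\<not> \<Union> (range (henkin H)) \<turnstile> Fls"
  proof
    assume "\<Union> (range (henkin H)) \<turnstile> Fls"
    then obtain F where F: "finite F" "F \<subseteq> \<Union> (range (henkin H))" "F \<turnstile> Fls"
      using proves_finite by blast
    from F(1,2) have "\<exists>n. F \<subseteq> henkin H n"
    proof (induction F rule: finite_induct)
      case (insert p F)
      then obtain m n where "F \<subseteq> henkin H n" "p \<in> henkin H m" by auto
      then show ?case using mono[of m "max m n"] mono[of n "max m n"] by (intro exI[of _ "max m n"]) auto
    qed simp
    then show False using F(3) henkin_consistent[OF assms] proves_weaken by blast
  qed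
next
  fix p :: fm
  obtain n :: nat where n: "from_nat n = p" by (metis from_nat_to_nat)
  show "p \<in> \<Union> (range (henkin H)) \<or> insert p (\<Union> (range (henkin H))) \<turnstile> Fls"
  proof (cases "insert p (henkin H n) \<turnstile> Fls")
    case True
    have "insert p (henkin H n) \<subseteq> insert p (\<Union> (range (henkin H)))" by auto
    then show ?thesis using proves_weaken[OF True] by blast
  next
    case False
    then have "p \<in> henkin H (Suc n)" using n by simp
    then show ?thesis by blast
  qed
next
  fix q :: fm
  assume "Imp (Uni q) Fls \<in> \<Union> (range (henkin H))"
  then obtain m where m: "Imp (Uni q) Fls \<in> henkin H m" by blast
  obtain n where n: "from_nat n = Imp (Uni q) Fls" by (metis from_nat_to_nat)
  have mono: "henkin H m \<subseteq> henkin H n" if "m \<le> n" for m n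
    using that by (induction rule: dec_induct) auto
  \<comment> \<open>The formula may have entered at a stage other than its own number
    \<open>n\<close>. Its addition at step \<open>n\<close> was nevertheless consistent, since
    everything involved lies in one later consistent stage; so its witness was added then.\<close>
  have "\<not> insert (from_nat n) (henkin H n) \<turnstile> Fls"
  proof
    assume "insert (from_nat n) (henkin H n) \<turnstile> Fls"
    moreover have "insert (from_nat n) (henkin H n) \<subseteq> henkin H (max m n)"
      using m n mono[of m "max m n"] mono[of n "max m n"] by auto
    ultimately have "henkin H (max m n) \<turnstile> Fls" by (rule proves_weaken)
    then show False using henkin_consistent[OF assms] by blast
  qed
  then have "witnesses (henkin H n) (Imp (Uni q) Fls) \<subseteq> henkin H (Suc n)" using n by auto
  then show "\<exists>x. Imp (ren (case_nat x id) q) Fls \<in> \<Union> (range (henkin H))"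
    unfolding witnesses_def by blast
qed

section \<open>Satisfaction and the term model\<close>

primrec sat :: "'a set \<Rightarrow> ('a \<Rightarrow> 'a \<Rightarrow> bool) \<Rightarrow> (nat \<Rightarrow> 'a) \<Rightarrow> fm \<Rightarrow> bool" where
  "sat D E e Fls \<longleftrightarrow> False"
| "sat D E e (Mem i j) \<longleftrightarrow> E (e i) (e j)"
| "sat D E e (Eql i j) \<longleftrightarrow> e i = e j"
| "sat D E e (Imp p q) \<longleftrightarrow> (sat D E e p \<longrightarrow> sat D E e q)"
| "sat D E e (Uni p) \<longleftrightarrow> (\<forall>x\<in>D. sat D E (case_nat x e) p)"

lemma sat_cong: "(\<And>i. i \<in> fv p \<Longrightarrow> e i = e' i) \<Longrightarrow> sat D E e p \<longleftrightarrow> sat D E e' p"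
proof (induction p arbitrary: e e')
  case (Uni p)
  have "sat D E (case_nat x e) p \<longleftrightarrow> sat D E (case_nat x e') p" for x
    by (rule Uni.IH) (use Uni.prems in \<open>auto split: nat.split\<close>)
  then show ?case by simp
next
  case (Imp p q)
  then show ?case by (metis UnCI fv.simps(4) sat.simps(4))
qed simp_all

lemma sat_ren: "sat D E e (ren r p) \<longleftrightarrow> sat D E (\<lambda>i. e (r i)) p"
proof (induction p arbitrary: e r)
  case (Uni p)
  have "(\<lambda>i. case_nat x e (case_nat 0 (\<lambda>i. Suc (r i)) i)) = case_nat x (\<lambda>i. e (r i))" for x
    by (auto split: nat.split)
  then show ?case by (simp add: Uni)
qed auto

lemma sat_image:
  assumes "inj f"
  shows "sat (range f) E (\<lambda>i. f (e i)) p \<longleftrightarrow> sat UNIV (\<lambda>x y. E (f x) (f y)) e p"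
proof (induction p arbitrary: e)
  case (Uni p)
  have "case_nat (f x) (\<lambda>i. f (e i)) = (\<lambda>i. f (case_nat x e i))" for x
    by (auto split: nat.split)
  then show ?case by (simp add: Uni)
qed (use assms in \<open>simp_all add: inj_eq\<close>)

text \<open>The truth lemma. Valuations of the term model are given by renamings \<open>v\<close>,
  because its elements are classes of variables; the quantifier case then reduces to
  \<open>Uni_iff\<close>.\<close>

lemma (in henkin_set) sat_cls:
  "sat (range cls) (\<lambda>a b. \<exists>x y. a = cls x \<and> b = cls y \<and> Mem x y \<in> G) (\<lambda>i. cls (v i)) p
     \<longleftrightarrow> ren v p \<in> G"
proof (induction p arbitrary: v)
  case Fls
  then show ?case by (simp add: Fls_iff)
next
  case (Mem i j)
  then show ?case by (simp add: cls_eq_iff) (meson Eql_refl Eql_sym Mem_cong)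
next
  case (Eql i j)
  then show ?case by (simp add: cls_eq_iff)
next
  case (Imp p q)
  then show ?case by (simp add: Imp_iff)
next
  case (Uni p)
  have 1: "case_nat (cls x) (\<lambda>i. cls (v i)) = (\<lambda>i. cls (case_nat x v i))" for x
    by (auto split: nat.split)
  have 2: "ren (case_nat x v) p = ren (case_nat x id) (ren (case_nat 0 (\<lambda>i. Suc (v i))) p)" for x
    by (auto simp: ren_ren intro!: ren_cong split: nat.split)
  show ?case using Uni[of "case_nat x v" for x] by (simp add: 1 2 Uni_iff)
qed

text \<open>Doubling all indices leaves the odd ones free for the Henkin witnesses.\<close>

theorem model_existence:
  assumes "\<not> H \<turnstile> Fls"
  shows "\<exists>D (E :: nat \<Rightarrow> nat \<Rightarrow> bool) e. range e \<subseteq> D \<and> (\<forall>p\<in>H. sat D E e p)"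
proof -
  let ?K = "ren (\<lambda>i. 2 * i) ` H"
  have "\<not> ?K \<turnstile> Fls"
  proof
    assume "?K \<turnstile> Fls"
    then have "ren (\<lambda>i. i div 2) ` ?K \<turnstile> ren (\<lambda>i. i div 2) Fls" by (rule proves_ren)
    then show False using assms by (simp add: image_image ren_ren)
  qed
  moreover have "infinite (- \<Union> (fv ` ?K))"
  proof -
    have fv_ren: "fv (ren r p) \<subseteq> r ` fv p" for r p
    proof (induction p arbitrary: r)
      case (Uni p)
      show ?case
      proof
        fix i
        assume "i \<in> fv (ren r (Uni p))"
        then obtain j where "j \<in> fv p" "Suc i = case_nat 0 (\<lambda>i. Suc (r i)) j"
          using Uni[of "case_nat 0 (\<lambda>i. Suc (r i))"] by auto
        then show "i \<in> r ` fv (Uni p)" by (cases j) auto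
      qed
    next
      case (Imp p q)
      then show ?case by (simp add: image_Un) blast
    qed auto
    have "range (\<lambda>i. Suc (2 * i)) \<subseteq> - \<Union> (fv ` ?K)"
    proof -
      have "Suc (2 * i) \<notin> fv (ren (\<lambda>i. 2 * i) p)" for i p
        using fv_ren[of "\<lambda>i. 2 * i" p] by (metis (no_types, lifting) double_not_eq_Suc_double imageE subsetD)
      then show ?thesis by auto
    qed
    moreover have "infinite (range (\<lambda>i. Suc (2 * i)))"
      by (simp add: finite_image_iff inj_def)
    ultimately show ?thesis using finite_subset by blast
  qed
  ultimately interpret henkin_set "\<Union> (range (henkin ?K))" by (rule henkin_set_henkin)
  have "?K \<subseteq> \<Union> (range (henkin ?K))" using henkin.simps(1)[of ?K] by (metis UN_upper UNIV_I)
  then have "ren id (ren (\<lambda>i. 2 * i) p) \<in> \<Union> (range (henkin ?K))" if "p \<in> H" for p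
    using that by auto
  note this[folded sat_cls, unfolded sat_ren]
  moreover have "range (\<lambda>i. cls (id (2 * i))) \<subseteq> range cls" by auto
  ultimately show ?thesis by meson
qed

text \<open>The countermodel lives on some set \<open>D\<close> of naturals. Once finite domains are
  excluded, enumerating \<open>D\<close> transports the structure to all of \<open>nat\<close>, so
  that quantifiers of the object language become unbounded quantifiers of HOL.\<close>

corollary completeness:
  assumes valid: "\<And>(E :: nat \<Rightarrow> nat \<Rightarrow> bool) e. \<forall>h\<in>H. sat UNIV E e h \<Longrightarrow> sat UNIV E e p"
    and no_finite: "\<And>D (E :: nat \<Rightarrow> nat \<Rightarrow> bool) e. finite D \<Longrightarrow> range e \<subseteq> D \<Longrightarrow> \<exists>h\<in>H. \<not> sat D E e h"
  shows "H \<turnstile> p"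
proof (rule ccontr)
  assume "\<not> H \<turnstile> p"
  then have "\<not> insert (Imp p Fls) H \<turnstile> Fls" using proves.Contr by blast
  then obtain D and E :: "nat \<Rightarrow> nat \<Rightarrow> bool" and e
    where e: "range e \<subseteq> D" and sat: "\<forall>h\<in>insert (Imp p Fls) H. sat D E e h"
    using model_existence by meson
  have "infinite D"
  proof
    assume "finite D"
    from no_finite[OF this e] sat show False by blast
  qed
  then have "bij_betw (from_nat_into D) UNIV D" by (simp add: bij_betw_from_nat_into)
  then obtain f :: "nat \<Rightarrow> nat" where f: "inj f" "range f = D" unfolding bij_betw_def by blast
  have "(\<lambda>i. f (inv f (e i))) = e"
  proof
    fix i
    have "e i \<in> range f" using e f(2) by auto
    then show "f (inv f (e i)) = e i" by (rule f_inv_into_f)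
  qed
  then have "sat D E e q \<longleftrightarrow> sat UNIV (\<lambda>x y. E (f x) (f y)) (\<lambda>i. inv f (e i)) q" for q
    using sat_image[OF f(1), of E "\<lambda>i. inv f (e i)" q] f(2) by simp
  then have "\<forall>h\<in>insert (Imp p Fls) H. sat UNIV (\<lambda>x y. E (f x) (f y)) (\<lambda>i. inv f (e i)) h"
    using sat by blast
  then show False using valid by (metis insert_iff sat.simps(1,4))
qed


section \<open>Semantics of the notation\<close>

text \<open>The value of the variable of level \<open>a\<close> below \<open>d\<close> quantifiers.\<close>

definition vl :: "(nat \<Rightarrow> 'a) \<Rightarrow> nat \<Rightarrow> var \<Rightarrow> 'a" where
  "vl e d a = e (d - Suc a)"

lemma vl_case_nat [simp]:
  "a < d \<Longrightarrow> vl (case_nat x e) (Suc d) a = vl e d a"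
  "vl (case_nat x e) (Suc d) d = x"
  by (auto simp: vl_def split: nat.split) (metis Suc_diff_Suc nat.inject)

lemma sat_form:
  "sat D E e ((a \<^bold>\<in> b) d) \<longleftrightarrow> E (vl e d a) (vl e d b)"
  "sat D E e ((a \<^bold>= b) d) \<longleftrightarrow> vl e d a = vl e d b"
  "sat D E e ((\<^bold>\<not> F) d) \<longleftrightarrow> \<not> sat D E e (F d)"
  "sat D E e ((F \<^bold>\<longrightarrow> G) d) \<longleftrightarrow> (sat D E e (F d) \<longrightarrow> sat D E e (G d))"
  "sat D E e ((F \<^bold>\<and> G) d) \<longleftrightarrow> sat D E e (F d) \<and> sat D E e (G d)"
  "sat D E e ((F \<^bold>\<or> G) d) \<longleftrightarrow> sat D E e (F d) \<or> sat D E e (G d)"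
  "sat D E e ((F \<^bold>\<longleftrightarrow> G) d) \<longleftrightarrow> (sat D E e (F d) \<longleftrightarrow> sat D E e (G d))"
  "sat D E e ((\<^bold>\<forall>x. H x) d) \<longleftrightarrow> (\<forall>x\<in>D. sat D E (case_nat x e) (H d (Suc d)))"
  "sat D E e ((\<^bold>\<exists>x. H x) d) \<longleftrightarrow> (\<exists>x\<in>D. sat D E (case_nat x e) (H d (Suc d)))"
  by (auto simp: f_mem_def f_eq_def f_not_def f_imp_def f_and_def f_or_def f_iff_def f_all_def
      f_ex_def vl_def)

lemma sat_schema_inst:
  "sat D E e (schema_inst p xs d) \<longleftrightarrow>
     sat D E (\<lambda>i. vl e d (if i < length xs then xs ! i else i - length xs)) p"
  by (simp add: schema_inst_def sat_ren vl_def)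

lemma sat_schema_inst2:
  "sat D E e (schema_inst p [j, k] d) \<longleftrightarrow>
     sat D E (case_nat (vl e d j) (case_nat (vl e d k) (vl e d))) p"
proof -
  have "(\<lambda>i. vl e d (if i < length [j, k] then [j, k] ! i else i - length [j, k])) =
      case_nat (vl e d j) (case_nat (vl e d k) (vl e d))"
    by (auto split: nat.split)
  then show ?thesis by (simp only: sat_schema_inst)
qed

lemma sat_schema_inst3:
  "sat D E e (schema_inst p [j, k, l] d) \<longleftrightarrow>
     sat D E (case_nat (vl e d j) (case_nat (vl e d k) (case_nat (vl e d l) (vl e d)))) p"
proof -
  have "(\<lambda>i. vl e d (if i < length [j, k, l] then [j, k, l] ! i else i - length [j, k, l])) =
      case_nat (vl e d j) (case_nat (vl e d k) (case_nat (vl e d l) (vl e d)))"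
    by (auto split: nat.split)
  then show ?thesis by (simp only: sat_schema_inst)
qed

lemma sat_Uni_power:
  "sat UNIV E e ((Uni ^^ n) p) \<longleftrightarrow> (\<forall>f. sat UNIV E (\<lambda>i. if i < n then f i else e (i - n)) p)"
proof (induction n arbitrary: e)
  case (Suc n)
  \<comment> \<open>The outermost of the \<open>Suc n\<close> quantifiers binds index
    \<open>n\<close>; its value is therefore stored at place \<open>n\<close> of
    \<open>f\<close>.\<close>
  have eq: "(\<lambda>i. if i < n then f i else case_nat x e (i - n)) =
      (\<lambda>i. if i < Suc n then (f(n := x)) i else e (i - Suc n))" for f x
  proof
    fix i
    show "(if i < n then f i else case_nat x e (i - n)) =
      (if i < Suc n then (f(n := x)) i else e (i - Suc n))"
      by (cases "i < n"; cases "i = n") (auto simp: Suc_diff_Suc[symmetric] not_less less_Suc_eq split: nat.split)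
  qed
  have "sat UNIV E e ((Uni ^^ Suc n) p) \<longleftrightarrow>
      (\<forall>x f. sat UNIV E (\<lambda>i. if i < Suc n then (f(n := x)) i else e (i - Suc n)) p)"
    by (simp add: Suc eq)
  also have "\<dots> \<longleftrightarrow> (\<forall>f. sat UNIV E (\<lambda>i. if i < Suc n then f i else e (i - Suc n)) p)"
    (is "?l \<longleftrightarrow> ?r")
  proof
    assume ?l
    show ?r
    proof
      fix f
      show "sat UNIV E (\<lambda>i. if i < Suc n then f i else e (i - Suc n)) p"
        using spec[OF spec[OF \<open>?l\<close>, of "f n"], of f] by (simp only: fun_upd_triv)
    qed
  qed (rule allI, rule allI, erule spec)
  finally show ?case .
qed simp

lemma bounded_fm_iff: "bounded_fm n p \<longleftrightarrow> fv p \<subseteq> {..<n}"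
proof (induction p arbitrary: n)
  case (Uni p)
  have "fv p \<subseteq> {..<Suc n} \<longleftrightarrow> {i. Suc i \<in> fv p} \<subseteq> {..<n}"
  proof
    assume *: "{i. Suc i \<in> fv p} \<subseteq> {..<n}"
    show "fv p \<subseteq> {..<Suc n}"
    proof
      fix i
      assume "i \<in> fv p"
      then show "i \<in> {..<Suc n}" using * by (cases i) auto
    qed
  qed auto
  then show ?case using Uni by simp
qed auto

lemma ex_bounded_fm: "\<exists>n. bounded_fm (n + k) p"
proof -
  obtain m where "fv p \<subseteq> {..<m}" using finite_fv finite_nat_bounded by blast
  then show ?thesis by (auto simp: bounded_fm_iff intro!: exI[of _ m])
qed

text \<open>In a structure with finite domain every element is a singleton by pairing, so there is no empty set.\<close>

lemma ZF_no_finite_model: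
  assumes "finite D" and e: "range e \<subseteq> D"
  shows "\<exists>h\<in>ZF. \<not> sat D E e h"
proof (rule ccontr)
  assume "\<not> ?thesis"
  then have "sat D E e (ax_pairing 0)" "sat D E e (ax_infinity 0)"
    by (auto simp: ZF_def)
  then have pairing: "\<forall>a\<in>D. \<forall>b\<in>D. \<exists>p\<in>D. \<forall>x\<in>D. E x p \<longleftrightarrow> x = a \<or> x = b"
    and empty: "\<exists>z\<in>D. \<forall>x\<in>D. \<not> E x z"
    by (auto simp: ax_pairing_def ax_infinity_def is_inductive_def is_empty_def is_upair_def sat_form)
  have "\<forall>a\<in>D. \<exists>p\<in>D. \<forall>x\<in>D. E x p \<longleftrightarrow> x = a" using pairing by meson
  then obtain s where s: "\<And>a. a \<in> D \<Longrightarrow> s a \<in> D \<and> (\<forall>x\<in>D. E x (s a) \<longleftrightarrow> x = a)" by metis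
  have "inj_on s D" by (rule inj_onI) (metis s)
  then have "s ` D = D" using s \<open>finite D\<close> by (intro endo_inj_surj) auto
  then show False using empty s by (metis imageE)
qed


section \<open>Definable predicates of a structure\<close>

locale mem_structure =
  fixes E :: "'m \<Rightarrow> 'm \<Rightarrow> bool"  (infix "\<epsilon>" 50)
begin

text \<open>Even indices carry the free variables and odd indices an infinite supply of parameters.
  A formula uses only finitely many of them, so their number never has to be recorded.\<close>

definition interleave :: "(nat \<Rightarrow> 'm) \<Rightarrow> (nat \<Rightarrow> 'm) \<Rightarrow> nat \<Rightarrow> 'm" where
  "interleave e c i = (if even i then e (i div 2) else c (i div 2))"

definition dpred :: "((nat \<Rightarrow> 'm) \<Rightarrow> bool) \<Rightarrow> bool" where
  "dpred P \<longleftrightarrow> (\<exists>p c. \<forall>e. P e \<longleftrightarrow> sat UNIV E (interleave e c) p)"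

text \<open>Definability of the graph, with the value at index 0 and the arguments shifted up by
  one.\<close>

definition dfun :: "((nat \<Rightarrow> 'm) \<Rightarrow> 'm) \<Rightarrow> bool" where
  "dfun t \<longleftrightarrow> dpred (\<lambda>e. e 0 = t (\<lambda>i. e (Suc i)))"

named_theorems dintro

lemma dpred_ren:
  assumes "dpred P"
  shows "dpred (\<lambda>e. P (\<lambda>i. e (r i)))"
proof -
  obtain p c where p: "\<And>e. P e \<longleftrightarrow> sat UNIV E (interleave e c) p"
    using assms unfolding dpred_def by blast
  let ?r = "\<lambda>i. if even i then 2 * r (i div 2) else i"
  have "interleave (\<lambda>i. e (r i)) c = (\<lambda>i. interleave e c (?r i))" for e
    by (auto simp: interleave_def)
  then have "P (\<lambda>i. e (r i)) \<longleftrightarrow> sat UNIV E (interleave e c) (ren ?r p)" for e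
    using p by (simp add: sat_ren)
  then show ?thesis unfolding dpred_def by blast
qed

lemma dpred_const [dintro]: "dpred (\<lambda>e. B)"
proof (cases B)
  case True
  then show ?thesis unfolding dpred_def by (intro exI[of _ "Imp Fls Fls"]) simp
next
  case False
  then show ?thesis unfolding dpred_def by (intro exI[of _ "Fls"]) simp
qed

lemma dpred_imp [dintro]:
  assumes "dpred P" "dpred Q"
  shows "dpred (\<lambda>e. P e \<longrightarrow> Q e)"
proof -
  obtain p c where p: "\<And>e. P e \<longleftrightarrow> sat UNIV E (interleave e c) p"
    using assms unfolding dpred_def by blast
  obtain q b where q: "\<And>e. Q e \<longleftrightarrow> sat UNIV E (interleave e b) q"
    using assms unfolding dpred_def by blast
  \<comment> \<open>The two parameter sequences are merged into \<open>interleave c b\<close>: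
    parameter \<open>m\<close> of the first formula moves to place \<open>2 * m\<close>, which has
    index \<open>4 * m + 1\<close>, and that of the second to the next place, which has index
    \<open>4 * m + 3\<close>.\<close>
  let ?r = "\<lambda>i. if even i then i else 4 * (i div 2) + 1" and ?s = "\<lambda>i. if even i then i else 4 * (i div 2) + 3"
  have div: "(4 * m + 3) div 2 = Suc (2 * m)" for m :: nat
    by presburger
  have "interleave e (interleave c b) (?r i) = interleave e c i" for e i
    by (cases "even i") (auto simp: interleave_def elim!: oddE)
  moreover have "interleave e (interleave c b) (?s i) = interleave e b i" for e i
    by (cases "even i") (auto simp: interleave_def div elim!: oddE)
  ultimately have "(P e \<longrightarrow> Q e) \<longleftrightarrow>
      sat UNIV E (interleave e (interleave c b)) (Imp (ren ?r p) (ren ?s q))" for e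
    using p q by (simp add: sat_ren)
  then show ?thesis unfolding dpred_def by blast
qed

lemma dpred_all [dintro]:
  assumes "dpred (\<lambda>e. P (e 0) (\<lambda>i. e (Suc i)))"
  shows "dpred (\<lambda>e. \<forall>x. P x e)"
proof -
  obtain p c where "\<And>e. P (e 0) (\<lambda>i. e (Suc i)) \<longleftrightarrow> sat UNIV E (interleave e c) p"
    using assms unfolding dpred_def by blast
  from this[of "case_nat x e" for x e]
  have p: "\<And>x e. P x e \<longleftrightarrow> sat UNIV E (interleave (case_nat x e) c) p" by simp
  \<comment> \<open>The new quantifier shifts the whole interleaved sequence by one, but only the
    free variables should make room: variable \<open>j\<close>, expected at
    \<open>2 * j + 2\<close>, is found at \<open>2 * j + 1\<close>, and every parameter has moved up
    by one.\<close>
  let ?r = "\<lambda>i. if i = 0 then 0 else if even i then i - 1 else Suc i"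
  have "case_nat x (interleave e c) (?r i) = interleave (case_nat x e) c i" for x e i
  proof (cases "even i")
    case True
    then obtain j where "i = 2 * j" by (elim evenE)
    then show ?thesis by (cases j) (simp_all add: interleave_def)
  next
    case False
    then have "i \<noteq> 0" by presburger
    then show ?thesis using False by (simp add: interleave_def split: nat.split)
  qed
  then have "(\<forall>x. P x e) \<longleftrightarrow> sat UNIV E (interleave e c) (Uni (ren ?r p))" for e
    using p by (simp add: sat_ren)
  then show ?thesis unfolding dpred_def by blast
qed

lemma dpred_not [dintro]: "dpred P \<Longrightarrow> dpred (\<lambda>e. \<not> P e)"
  using dpred_imp[OF _ dpred_const[of False], of P] by simp

lemma dpred_or [dintro]: "dpred P \<Longrightarrow> dpred Q \<Longrightarrow> dpred (\<lambda>e. P e \<or> Q e)"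
  using dpred_imp[OF dpred_not[of P], of Q] by (simp add: disj_imp)

lemma dpred_and [dintro]: "dpred P \<Longrightarrow> dpred Q \<Longrightarrow> dpred (\<lambda>e. P e \<and> Q e)"
  using dpred_not[OF dpred_imp[OF _ dpred_not, of P Q]] by simp

lemma dpred_iff [dintro]: "dpred P \<Longrightarrow> dpred Q \<Longrightarrow> dpred (\<lambda>e. P e \<longleftrightarrow> Q e)"
  using dpred_and[OF dpred_imp[of P Q] dpred_imp[of Q P]] by (simp add: iff_conv_conj_imp)

lemma dpred_ex [dintro]:
  "dpred (\<lambda>e. P (e 0) (\<lambda>i. e (Suc i))) \<Longrightarrow> dpred (\<lambda>e. \<exists>x. P x e)"
  using dpred_not[OF dpred_all[OF dpred_not]] by simp

lemma dfun_const [dintro]: "dfun (\<lambda>e. c)"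
proof -
  have "\<forall>e. e 0 = c \<longleftrightarrow> sat UNIV E (interleave e (\<lambda>_. c)) (Eql 0 1)" by (simp add: interleave_def)
  then show ?thesis unfolding dfun_def dpred_def by meson
qed

lemma dfun_var [dintro]: "dfun (\<lambda>e. e i)"
proof -
  have "\<forall>e. e 0 = e (Suc i) \<longleftrightarrow> sat UNIV E (interleave e c) (Eql 0 (2 * Suc i))" for c
    by (simp add: interleave_def)
  then show ?thesis unfolding dfun_def dpred_def by meson
qed

lemma dfun_ren: "dfun t \<Longrightarrow> dfun (\<lambda>e. t (\<lambda>i. e (r i)))"
  unfolding dfun_def
  using dpred_ren[of "\<lambda>e. e 0 = t (\<lambda>i. e (Suc i))" "case_nat 0 (\<lambda>i. Suc (r i))"] by simp

text \<open>Variables are the only terms of the language, so a definable value enters a predicate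
  through \<open>\<exists>x. x = t e \<and> P x e\<close>.\<close>

lemma dpred_subst:
  assumes "dpred (\<lambda>e. P (e 0) (\<lambda>i. e (Suc i)))" "dfun t"
  shows "dpred (\<lambda>e. P (t e) e)"
proof -
  have "dpred (\<lambda>e. \<exists>x. x = t e \<and> P x e)"
    using assms by (intro dpred_ex dpred_and) (auto simp: dfun_def)
  then show ?thesis by simp
qed

lemma dpred_comp1: "dpred (\<lambda>e. R (e 0)) \<Longrightarrow> dfun t \<Longrightarrow> dpred (\<lambda>e. R (t e))"
  using dpred_subst[of "\<lambda>x e. R x"] by simp

text \<open>A relation need only be checked on variables; definable arguments are then filled in one
  at a time. The swap of variables in between is due to \<open>dpred_subst\<close>, which fills
  index 0 only.\<close>

lemma dpred_comp2:
  assumes R: "dpred (\<lambda>e. R (e 0) (e 1))" and t: "dfun t" and u: "dfun u"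
  shows "dpred (\<lambda>e. R (t e) (u e))"
proof -
  have "dpred (\<lambda>e. R (e 1) (e 0))" using dpred_ren[OF R, of "case_nat 1 (\<lambda>_. 0)"] by simp
  then have "dpred (\<lambda>e. R (e 0) (u (\<lambda>i. e (Suc i))))"
    using dpred_subst[of "\<lambda>y e. R (e 0) y" "\<lambda>e. u (\<lambda>i. e (Suc i))"] dfun_ren[OF u] by simp
  then show ?thesis using dpred_subst[of "\<lambda>x e. R x (u e)"] t by simp
qed

lemma dpred_comp3:
  assumes R: "dpred (\<lambda>e. R (e 0) (e 1) (e 2))" and t: "dfun t" and u: "dfun u" and v: "dfun v"
  shows "dpred (\<lambda>e. R (t e) (u e) (v e))"
proof -
  have "dpred (\<lambda>e. R (e 1) (e 2) (e 0))"
    using dpred_ren[OF R, of "case_nat 1 (case_nat 2 (\<lambda>_. 0))"] by (simp add: numeral_2_eq_2)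
  then have "dpred (\<lambda>e. R (e 0) (e 1) (v (\<lambda>i. e (i + 2))))"
    using dpred_subst[of "\<lambda>y e. R (e 0) (e 1) y" "\<lambda>e. v (\<lambda>i. e (i + 2))"] dfun_ren[OF v]
    by (simp add: numeral_2_eq_2)
  from dpred_ren[OF this, of "\<lambda>i. case i of 0 \<Rightarrow> 1 | Suc j \<Rightarrow> (case j of 0 \<Rightarrow> 0 | Suc k \<Rightarrow> Suc j)"]
  have "dpred (\<lambda>e. R (e 1) (e 0) (v (\<lambda>i. e (i + 2))))"
    by simp
  then have "dpred (\<lambda>e. R (e 0) (u (\<lambda>i. e (Suc i))) (v (\<lambda>i. e (Suc i))))"
    using dpred_subst[of "\<lambda>y e. R (e 0) y (v (\<lambda>i. e (Suc i)))" "\<lambda>e. u (\<lambda>i. e (Suc i))"] dfun_ren[OF u]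
    by simp
  then show ?thesis using dpred_subst[of "\<lambda>x e. R x (u e) (v e)"] t by simp
qed

lemma dfun_comp1:
  assumes "dfun (\<lambda>e. f (e 0))" "dfun t"
  shows "dfun (\<lambda>e. f (t e))"
  using dpred_comp2[of "\<lambda>y x. y = f x" "\<lambda>e. e 0" "\<lambda>e. t (\<lambda>i. e (Suc i))"] assms
    dfun_var[of 0] dfun_ren[of t Suc] by (simp add: dfun_def)

lemma dfun_comp2:
  assumes "dfun (\<lambda>e. f (e 0) (e 1))" "dfun t" "dfun u"
  shows "dfun (\<lambda>e. f (t e) (u e))"
  using dpred_comp3[of "\<lambda>z x y. z = f x y" "\<lambda>e. e 0" "\<lambda>e. t (\<lambda>i. e (Suc i))"
      "\<lambda>e. u (\<lambda>i. e (Suc i))"] assms dfun_var[of 0] dfun_ren[of t Suc] dfun_ren[of u Suc]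
  by (simp add: dfun_def numeral_2_eq_2)

lemma dpred_mem [dintro]: "dfun t \<Longrightarrow> dfun u \<Longrightarrow> dpred (\<lambda>e. t e \<epsilon> u e)"
proof (rule dpred_comp2)
  have "\<forall>e. e 0 \<epsilon> e 1 \<longleftrightarrow> sat UNIV E (interleave e c) (Mem 0 2)" for c by (simp add: interleave_def)
  then show "dpred (\<lambda>e. e 0 \<epsilon> e 1)" unfolding dpred_def by meson
qed

lemma dpred_eq [dintro]: "dfun t \<Longrightarrow> dfun u \<Longrightarrow> dpred (\<lambda>e. t e = u e)"
proof (rule dpred_comp2)
  have "\<forall>e. e 0 = e 1 \<longleftrightarrow> sat UNIV E (interleave e c) (Eql 0 2)" for c by (simp add: interleave_def)
  then show "dpred (\<lambda>e. e 0 = e 1)" unfolding dpred_def by meson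
qed

lemma dfun_if [dintro]:
  assumes "dpred P" "dfun t" "dfun u"
  shows "dfun (\<lambda>e. if P e then t e else u e)"
proof -
  have "dpred (\<lambda>e. (P (\<lambda>i. e (Suc i)) \<longrightarrow> e 0 = t (\<lambda>i. e (Suc i))) \<and>
      (\<not> P (\<lambda>i. e (Suc i)) \<longrightarrow> e 0 = u (\<lambda>i. e (Suc i))))"
    using assms(2,3) dpred_ren[OF assms(1), of Suc] unfolding dfun_def
    by (intro dpred_and dpred_imp dpred_not)
  moreover have "(\<lambda>e. (P (\<lambda>i. e (Suc i)) \<longrightarrow> e 0 = t (\<lambda>i. e (Suc i))) \<and>
      (\<not> P (\<lambda>i. e (Suc i)) \<longrightarrow> e 0 = u (\<lambda>i. e (Suc i)))) =
      (\<lambda>e. e 0 = (if P (\<lambda>i. e (Suc i)) then t (\<lambda>i. e (Suc i)) else u (\<lambda>i. e (Suc i))))"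
    by auto
  ultimately show ?thesis unfolding dfun_def by simp
qed

end


section \<open>Models of ZF\<close>

locale zf_model = mem_structure E for E :: "'m \<Rightarrow> 'm \<Rightarrow> bool"  (infix "\<epsilon>" 50) +
  assumes ZF_sat: "\<exists>e. \<forall>h\<in>ZF. sat UNIV E e h"
begin

abbreviation holds :: "(nat \<Rightarrow> 'm) \<Rightarrow> nat \<Rightarrow> form \<Rightarrow> bool" where
  "holds e d F \<equiv> sat UNIV E e (F d)"

section \<open>The axioms in semantic form\<close>

lemma extensionality: "(\<And>x. x \<epsilon> a \<longleftrightarrow> x \<epsilon> b) \<Longrightarrow> a = b"
proof -
  assume ab: "\<And>x. x \<epsilon> a \<longleftrightarrow> x \<epsilon> b"
  have "\<exists>e. sat UNIV E e (ax_extensionality 0)" using ZF_sat by (auto simp: ZF_def)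
  then show "a = b" using ab by (simp add: ax_extensionality_def sat_form)
qed

lemma foundation: "x \<epsilon> a \<Longrightarrow> \<exists>x. x \<epsilon> a \<and> (\<forall>y. y \<epsilon> x \<longrightarrow> \<not> y \<epsilon> a)"
proof -
  assume x: "x \<epsilon> a"
  have "\<exists>e. sat UNIV E e (ax_foundation 0)" using ZF_sat by (auto simp: ZF_def)
  then show ?thesis using x by (simp add: ax_foundation_def is_empty_def sat_form) blast
qed

lemma pairing: "\<exists>p. \<forall>x. x \<epsilon> p \<longleftrightarrow> x = a \<or> x = b"
proof -
  have "\<exists>e. sat UNIV E e (ax_pairing 0)" using ZF_sat by (auto simp: ZF_def)
  then show ?thesis by (simp add: ax_pairing_def is_upair_def sat_form)
qed

lemma union: "\<exists>u. \<forall>x. x \<epsilon> u \<longleftrightarrow> (\<exists>y. y \<epsilon> a \<and> x \<epsilon> y)"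
proof -
  have "\<exists>e. sat UNIV E e (ax_union 0)" using ZF_sat by (auto simp: ZF_def)
  then show ?thesis by (simp add: ax_union_def is_Union_def sat_form)
qed

lemma separation_fm:
  "\<exists>b. \<forall>x. x \<epsilon> b \<longleftrightarrow> x \<epsilon> a \<and> sat UNIV E (case_nat x (case_nat a f)) p"
proof -
  obtain n where n: "bounded_fm (n + 2) p" using ex_bounded_fm by blast
  then have "univ_closure n (ax_separation p) \<in> ZF" by (auto simp: ZF_def)
  then obtain e where "sat UNIV E e (univ_closure n (ax_separation p))" using ZF_sat by blast
  \<comment> \<open>Levels count from the outside and indices from the inside: at depth
    \<open>n\<close> the parameter of level \<open>j\<close> has index \<open>n - 1 - j\<close>, so
    \<open>g\<close> lists the values \<open>f\<close> in reverse.\<close>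
  define g where "g i = (if i < n then f (n - 1 - i) else e (i - n))" for i
  have "sat UNIV E g (ax_separation p n)"
    using \<open>sat UNIV E e (univ_closure n (ax_separation p))\<close> unfolding g_def univ_closure_def sat_Uni_power by (rule spec)
  have *: "sat UNIV E (case_nat x (case_nat a (vl h d))) p \<longleftrightarrow>
      sat UNIV E (case_nat x (case_nat a f)) p" if "\<And>j. j < n \<Longrightarrow> vl h d j = f j" for x h d
    by (rule sat_cong) (use n that in \<open>auto simp: bounded_fm_iff split: nat.split\<close>)
  have "vl g n j = f j" if "j < n" for j
    using that by (simp add: vl_def g_def)
  then have eq: "sat UNIV E (case_nat x (case_nat a
        (vl (case_nat x (case_nat b (case_nat a g))) (Suc (Suc (Suc n)))))) p \<longleftrightarrow>
      sat UNIV E (case_nat x (case_nat a f)) p" for x b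
    by (intro *) simp
  have "\<forall>a. \<exists>b. \<forall>x. x \<epsilon> b \<longleftrightarrow> x \<epsilon> a \<and> sat UNIV E (case_nat x (case_nat a
        (vl (case_nat x (case_nat b (case_nat a g))) (Suc (Suc (Suc n)))))) p"
    using \<open>sat UNIV E g (ax_separation p n)\<close>
    by (simp add: ax_separation_def sat_form sat_schema_inst2)
  from spec[OF this, of a] show ?thesis unfolding eq .
qed

lemma replacement_fm:
  assumes "\<And>x y z. x \<epsilon> a \<Longrightarrow> sat UNIV E (case_nat x (case_nat y (case_nat a f))) p \<Longrightarrow>
    sat UNIV E (case_nat x (case_nat z (case_nat a f))) p \<Longrightarrow> y = z"
  shows "\<exists>b. \<forall>y. y \<epsilon> b \<longleftrightarrow> (\<exists>x. x \<epsilon> a \<and> sat UNIV E (case_nat x (case_nat y (case_nat a f))) p)"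
proof -
  obtain n where n: "bounded_fm (n + 3) p" using ex_bounded_fm by blast
  then have "univ_closure n (ax_replacement p) \<in> ZF" by (auto simp: ZF_def)
  then obtain e where "sat UNIV E e (univ_closure n (ax_replacement p))" using ZF_sat by blast
  define g where "g i = (if i < n then f (n - 1 - i) else e (i - n))" for i
  have ax: "sat UNIV E g (ax_replacement p n)"
    using \<open>sat UNIV E e (univ_closure n (ax_replacement p))\<close> unfolding g_def univ_closure_def sat_Uni_power by (rule spec)
  have *: "sat UNIV E (case_nat x (case_nat y (case_nat a (vl h d)))) p \<longleftrightarrow>
      sat UNIV E (case_nat x (case_nat y (case_nat a f))) p"
    if "\<And>j. j < n \<Longrightarrow> vl h d j = f j" for x y h d
    by (rule sat_cong) (use n that in \<open>auto simp: bounded_fm_iff split: nat.split\<close>)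
  have g: "vl g n j = f j" if "j < n" for j
    using that by (simp add: vl_def g_def)
  have "sat UNIV E (case_nat x (case_nat y (case_nat a
        (vl (case_nat u (case_nat v (case_nat w (case_nat a g)))) (Suc (Suc (Suc (Suc n)))))))) p \<longleftrightarrow>
      sat UNIV E (case_nat x (case_nat y (case_nat a f))) p" for x y u v w
    by (intro *) (simp add: g)
  note eq = this
  let ?vl = "\<lambda>u v w a. vl (case_nat u (case_nat v (case_nat w (case_nat a g)))) (Suc (Suc (Suc (Suc n))))"
  have "\<forall>a. (\<forall>x y z. x \<epsilon> a \<and> sat UNIV E (case_nat x (case_nat y (case_nat a (?vl z y x a)))) p \<and>
           sat UNIV E (case_nat x (case_nat z (case_nat a (?vl z y x a)))) p \<longrightarrow> y = z) \<longrightarrow>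
         (\<exists>b. \<forall>y. y \<epsilon> b \<longleftrightarrow>
           (\<exists>x. x \<epsilon> a \<and> sat UNIV E (case_nat x (case_nat y (case_nat a (?vl x y b a)))) p))"
    using ax by (simp add: ax_replacement_def sat_form sat_schema_inst3)
  from spec[OF this, of a] show ?thesis unfolding eq using assms by blast
qed

lemma separation:
  assumes "dpred (\<lambda>e. P (e 0))"
  shows "\<exists>b. \<forall>x. x \<epsilon> b \<longleftrightarrow> x \<epsilon> a \<and> P x"
proof -
  obtain p c where "\<And>e. P (e 0) \<longleftrightarrow> sat UNIV E (interleave e c) p"
    using assms unfolding dpred_def by blast
  from this[of "\<lambda>_. x" for x] have p: "\<And>x. P x \<longleftrightarrow> sat UNIV E (interleave (\<lambda>_. x) c) p" .
  \<comment> \<open>Only the first free variable matters, so all even indices go to the element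
    \<open>x\<close>. Index 1 is occupied by the set \<open>a\<close>, and the parameters start at
    2.\<close>
  let ?r = "\<lambda>i. if even i then 0 else 2 + i div 2"
  have "(\<lambda>i. case_nat x (case_nat a c) (?r i)) = interleave (\<lambda>_. x) c" for x
    by (auto simp: interleave_def)
  then show ?thesis using separation_fm[of a c "ren ?r p"] p by (simp add: sat_ren)
qed

lemma replacement:
  assumes "dfun (\<lambda>e. t (e 0))"
  shows "\<exists>b. \<forall>y. y \<epsilon> b \<longleftrightarrow> (\<exists>x. x \<epsilon> a \<and> y = t x)"
proof -
  obtain p c where "\<And>e. e 0 = t (e 1) \<longleftrightarrow> sat UNIV E (interleave e c) p"
    using assms unfolding dpred_def dfun_def by auto
  from this[of "case_nat y (\<lambda>_. x)" for x y]
  have p: "\<And>x y. y = t x \<longleftrightarrow> sat UNIV E (interleave (case_nat y (\<lambda>_. x)) c) p" by simp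
  \<comment> \<open>In the axiom schema the argument has index 0, the value index 1 and the set
    \<open>a\<close> index 2. The graph of \<open>t\<close> has its value at 0, hence the exchange,
    and the parameters start at 3.\<close>
  let ?r = "\<lambda>i. if i = 0 then 1 else if even i then 0 else 3 + i div 2"
  have "(\<lambda>i. case_nat x (case_nat y (case_nat a c)) (?r i)) = interleave (case_nat y (\<lambda>_. x)) c" for x y
  proof
    fix i
    show "case_nat x (case_nat y (case_nat a c)) (?r i) = interleave (case_nat y (\<lambda>_. x)) c i"
    proof (cases "even i")
      case True
      then obtain j where "i = 2 * j" by (elim evenE)
      then show ?thesis by (cases j) (simp_all add: interleave_def)
    next
      case False
      then have "i \<noteq> 0" by presburger
      then show ?thesis using False by (simp add: interleave_def numeral_3_eq_3)
    qed
  qed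
  then have q: "sat UNIV E (case_nat x (case_nat y (case_nat a c))) (ren ?r p) \<longleftrightarrow> y = t x" for x y
    using p by (simp add: sat_ren)
  show ?thesis using replacement_fm[of a c "ren ?r p"] unfolding q by blast
qed

end


context zf_model
begin

subsection \<open>Definite descriptions and comprehension\<close>

definition emp :: 'm where
  "emp = (THE z. \<forall>x. \<not> x \<epsilon> z)"

text \<open>Unlike \<open>THE\<close>, the junk value does not depend on the predicate, which makes \<open>dthe\<close> definable.\<close>

definition dthe :: "('m \<Rightarrow> bool) \<Rightarrow> 'm" where
  "dthe P = (if \<exists>!x. P x then THE x. P x else emp)"

text \<open>Set formation by description instead of choice, so that a set built from a definable
  predicate is a definable value. It is meaningful only where the set exists, as
  \<open>mem_mk\<close> demands.\<close>

definition mk :: "('m \<Rightarrow> bool) \<Rightarrow> 'm" where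
  "mk P = dthe (\<lambda>b. \<forall>x. x \<epsilon> b \<longleftrightarrow> P x)"

lemma dthe_eq: "P y \<Longrightarrow> (\<And>z. P z \<Longrightarrow> z = y) \<Longrightarrow> dthe P = y"
  unfolding dthe_def by (metis the_equality)

lemma dfun_dthe [dintro]:
  assumes "dpred (\<lambda>e. P (e 0) (\<lambda>i. e (Suc i)))"
  shows "dfun (\<lambda>e. dthe (\<lambda>x. P x e))"
proof -
  have 1: "dpred (\<lambda>e. P (e 0) (\<lambda>i. e (Suc (Suc i))))"
    using dpred_ren[OF assms, of "case_nat 0 (\<lambda>i. Suc (Suc i))"] by simp
  have 2: "dpred (\<lambda>e. P (e 0) (\<lambda>i. e (Suc (Suc (Suc i)))))"
    using dpred_ren[OF assms, of "case_nat 0 (\<lambda>i. Suc (Suc (Suc i)))"] by simp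
  have "dpred (\<lambda>e. P (e 0) (\<lambda>i. e (Suc i)) \<and> (\<forall>z. P z (\<lambda>i. e (Suc i)) \<longrightarrow> z = e 0) \<or>
      e 0 = emp \<and> \<not> (\<exists>y. P y (\<lambda>i. e (Suc i)) \<and> (\<forall>z. P z (\<lambda>i. e (Suc i)) \<longrightarrow> z = y)))"
    by (intro assms 1 2 dintro)
  moreover have "y = dthe Q \<longleftrightarrow> Q y \<and> (\<forall>z. Q z \<longrightarrow> z = y) \<or>
      y = emp \<and> \<not> (\<exists>y. Q y \<and> (\<forall>z. Q z \<longrightarrow> z = y))" for y Q
  proof (cases "\<exists>!x. Q x")
    case True
    then obtain x where x: "Q x" "\<And>z. Q z \<Longrightarrow> z = x" by blast
    then have "dthe Q = x" by (rule dthe_eq)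
    then show ?thesis using x by blast
  next
    case False
    then have "dthe Q = emp" by (simp add: dthe_def)
    moreover have "\<not> (\<exists>x. Q x \<and> (\<forall>z. Q z \<longrightarrow> z = x))" using False unfolding Ex1_def .
    ultimately show ?thesis by metis
  qed
  ultimately show ?thesis unfolding dfun_def by simp
qed

lemma dfun_mk [dintro]:
  assumes "dpred (\<lambda>e. P (e 0) (\<lambda>i. e (Suc i)))"
  shows "dfun (\<lambda>e. mk (\<lambda>x. P x e))"
proof -
  have "dpred (\<lambda>e. P (e 0) (\<lambda>i. e (Suc (Suc i))))"
    using dpred_ren[OF assms, of "case_nat 0 (\<lambda>i. Suc (Suc i))"] by simp
  then show ?thesis unfolding mk_def by (intro dintro)
qed

lemma mem_mk: "\<exists>b. \<forall>x. x \<epsilon> b \<longleftrightarrow> P x \<Longrightarrow> x \<epsilon> mk P \<longleftrightarrow> P x"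
proof -
  assume "\<exists>b. \<forall>x. x \<epsilon> b \<longleftrightarrow> P x"
  then obtain b where b: "\<forall>x. x \<epsilon> b \<longleftrightarrow> P x" by blast
  have "mk P = b" unfolding mk_def by (rule dthe_eq) (use b in \<open>auto intro: extensionality\<close>)
  then show ?thesis using b by simp
qed

lemma emp_iff: "z = emp \<longleftrightarrow> (\<forall>x. \<not> x \<epsilon> z)"
proof -
  obtain z where z: "\<forall>x. \<not> x \<epsilon> z"
    using separation[of "\<lambda>_. False"] by (auto intro: dintro)
  then have "emp = z" unfolding emp_def by (intro the_equality) (auto intro: extensionality)
  then show ?thesis using z by (auto intro: extensionality)
qed

lemma not_mem_emp [simp]: "\<not> x \<epsilon> emp"
  using emp_iff by blast

definition sub :: "'m \<Rightarrow> 'm \<Rightarrow> bool" where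
  "sub a b \<longleftrightarrow> (\<forall>x. x \<epsilon> a \<longrightarrow> x \<epsilon> b)"

definition upair :: "'m \<Rightarrow> 'm \<Rightarrow> 'm" where
  "upair a b = mk (\<lambda>x. x = a \<or> x = b)"

definition pair :: "'m \<Rightarrow> 'm \<Rightarrow> 'm" where
  "pair a b = upair (upair a a) (upair a b)"

definition sep :: "'m \<Rightarrow> ('m \<Rightarrow> bool) \<Rightarrow> 'm" where
  "sep a P = mk (\<lambda>x. x \<epsilon> a \<and> P x)"

definition img :: "('m \<Rightarrow> 'm) \<Rightarrow> 'm \<Rightarrow> 'm" where
  "img t a = mk (\<lambda>y. \<exists>x. x \<epsilon> a \<and> y = t x)"

definition bigU :: "'m \<Rightarrow> 'm" where
  "bigU a = mk (\<lambda>x. \<exists>y. y \<epsilon> a \<and> x \<epsilon> y)"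

definition adj :: "'m \<Rightarrow> 'm \<Rightarrow> 'm" where
  "adj a b = mk (\<lambda>x. x \<epsilon> a \<or> x = b)"

abbreviation succ :: "'m \<Rightarrow> 'm" where
  "succ n \<equiv> adj n n"

definition times :: "'m \<Rightarrow> 'm \<Rightarrow> 'm" where
  "times a b = bigU (img (\<lambda>x. img (pair x) b) a)"

lemma mem_upair [simp]: "x \<epsilon> upair a b \<longleftrightarrow> x = a \<or> x = b"
  unfolding upair_def by (rule mem_mk, rule pairing)

lemma mem_sep: "dpred (\<lambda>e. P (e 0)) \<Longrightarrow> x \<epsilon> sep a P \<longleftrightarrow> x \<epsilon> a \<and> P x"
  unfolding sep_def by (rule mem_mk, rule separation)

lemma mem_img: "dfun (\<lambda>e. t (e 0)) \<Longrightarrow> y \<epsilon> img t a \<longleftrightarrow> (\<exists>x. x \<epsilon> a \<and> y = t x)"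
  unfolding img_def by (rule mem_mk, rule replacement)

lemma mem_bigU [simp]: "x \<epsilon> bigU a \<longleftrightarrow> (\<exists>y. y \<epsilon> a \<and> x \<epsilon> y)"
  unfolding bigU_def by (rule mem_mk, rule union)

lemma mem_adj [simp]: "x \<epsilon> adj a b \<longleftrightarrow> x \<epsilon> a \<or> x = b"
  unfolding adj_def
  by (rule mem_mk, rule exI[of _ "bigU (upair a (upair b b))"]) auto

lemma eq_upair_iff: "p = upair a b \<longleftrightarrow> (\<forall>x. x \<epsilon> p \<longleftrightarrow> x = a \<or> x = b)"
  by (auto intro: extensionality)

lemma eq_bigU_iff: "u = bigU a \<longleftrightarrow> (\<forall>x. x \<epsilon> u \<longleftrightarrow> (\<exists>y. y \<epsilon> a \<and> x \<epsilon> y))"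
  by (auto intro: extensionality)

lemma eq_adj_iff: "s = adj a b \<longleftrightarrow> (\<forall>x. x \<epsilon> s \<longleftrightarrow> x \<epsilon> a \<or> x = b)"
  by (auto intro: extensionality)

lemma upair_eq_iff: "upair a b = upair c d \<longleftrightarrow> a = c \<and> b = d \<or> a = d \<and> b = c"
proof
  assume "upair a b = upair c d"
  then have "x = a \<or> x = b \<longleftrightarrow> x = c \<or> x = d" for x by (metis mem_upair)
  then show "a = c \<and> b = d \<or> a = d \<and> b = c" by metis
qed (auto intro: extensionality)

lemma pair_eq_iff [simp]: "pair a b = pair c d \<longleftrightarrow> a = c \<and> b = d"
  unfolding pair_def upair_eq_iff by auto

lemma dfun_upair [dintro]: "dfun t \<Longrightarrow> dfun u \<Longrightarrow> dfun (\<lambda>e. upair (t e) (u e))"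
  by (rule dfun_comp2) (unfold upair_def, intro dintro)

lemma dfun_pair [dintro]: "dfun t \<Longrightarrow> dfun u \<Longrightarrow> dfun (\<lambda>e. pair (t e) (u e))"
  unfolding pair_def by (intro dintro)

lemma dfun_adj [dintro]: "dfun t \<Longrightarrow> dfun u \<Longrightarrow> dfun (\<lambda>e. adj (t e) (u e))"
  by (rule dfun_comp2) (unfold adj_def, intro dintro)

lemma dfun_sep [dintro]:
  assumes "dfun t" "dpred (\<lambda>e. P (e 0) (\<lambda>i. e (Suc i)))"
  shows "dfun (\<lambda>e. sep (t e) (\<lambda>x. P x e))"
  unfolding sep_def by (intro dintro assms dfun_ren[OF assms(1), of Suc])

lemma dfun_img [dintro]:
  assumes "dfun t" "dfun (\<lambda>e. u (e 0) (\<lambda>i. e (Suc i)))"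
  shows "dfun (\<lambda>e. img (\<lambda>x. u x e) (t e))"
proof -
  have "dfun (\<lambda>e. u (e 0) (\<lambda>i. e (Suc (Suc i))))"
    using dfun_ren[OF assms(2), of "case_nat 0 (\<lambda>i. Suc (Suc i))"] by simp
  then show ?thesis
    unfolding img_def by (intro dintro dfun_ren[OF assms(1), of "\<lambda>i. Suc (Suc i)"])
qed

lemma mem_times: "p \<epsilon> times a b \<longleftrightarrow> (\<exists>x y. x \<epsilon> a \<and> y \<epsilon> b \<and> p = pair x y)"
proof -
  have "q \<epsilon> img (pair x) b \<longleftrightarrow> (\<exists>y. y \<epsilon> b \<and> q = pair x y)" for q x
    by (rule mem_img) (intro dintro)
  moreover have "q \<epsilon> img (\<lambda>x. img (pair x) b) a \<longleftrightarrow> (\<exists>x. x \<epsilon> a \<and> q = img (pair x) b)" for q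
    by (rule mem_img) (intro dintro)
  ultimately show ?thesis unfolding times_def by auto
qed

lemma eq_times_iff:
  "q = times a b \<longleftrightarrow> (\<forall>p. p \<epsilon> q \<longleftrightarrow> (\<exists>x y. x \<epsilon> a \<and> y \<epsilon> b \<and> p = pair x y))"
  by (auto simp: mem_times intro: extensionality)


subsection \<open>Functions\<close>

definition isfun :: "'m \<Rightarrow> 'm \<Rightarrow> bool" where
  "isfun f a \<longleftrightarrow> (\<forall>p. p \<epsilon> f \<longrightarrow> (\<exists>x y. x \<epsilon> a \<and> p = pair x y)) \<and>
     (\<forall>x. x \<epsilon> a \<longrightarrow> (\<exists>y. pair x y \<epsilon> f \<and> (\<forall>z. pair x z \<epsilon> f \<longrightarrow> z = y)))"

definition app :: "'m \<Rightarrow> 'm \<Rightarrow> 'm" where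
  "app f x = dthe (\<lambda>y. pair x y \<epsilon> f)"

definition lam :: "'m \<Rightarrow> ('m \<Rightarrow> 'm) \<Rightarrow> 'm" where
  "lam a t = img (\<lambda>x. pair x (t x)) a"

definition isbij :: "'m \<Rightarrow> 'm \<Rightarrow> 'm \<Rightarrow> bool" where
  "isbij f a b \<longleftrightarrow> (isfun f a \<and> (\<forall>x y. pair x y \<epsilon> f \<longrightarrow> y \<epsilon> b)) \<and>
     (\<forall>x y z. pair x z \<epsilon> f \<and> pair y z \<epsilon> f \<longrightarrow> x = y) \<and> (\<forall>y. y \<epsilon> b \<longrightarrow> (\<exists>x. pair x y \<epsilon> f))"

definition equip :: "'m \<Rightarrow> 'm \<Rightarrow> bool" where
  "equip a b \<longleftrightarrow> (\<exists>f. isbij f a b)"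

lemma dpred_isfun [dintro]: "dfun t \<Longrightarrow> dfun u \<Longrightarrow> dpred (\<lambda>e. isfun (t e) (u e))"
  by (rule dpred_comp2) (unfold isfun_def, intro dintro)

lemma dfun_app [dintro]: "dfun t \<Longrightarrow> dfun u \<Longrightarrow> dfun (\<lambda>e. app (t e) (u e))"
  by (rule dfun_comp2) (unfold app_def, intro dintro)

lemma dpred_equip [dintro]: "dfun t \<Longrightarrow> dfun u \<Longrightarrow> dpred (\<lambda>e. equip (t e) (u e))"
  by (rule dpred_comp2) (unfold equip_def isbij_def isfun_def, intro dintro)

lemma isfun_app_iff: "isfun f a \<Longrightarrow> pair x y \<epsilon> f \<longleftrightarrow> x \<epsilon> a \<and> y = app f x"
proof -
  assume f: "isfun f a"
  show ?thesis
  proof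
    assume xy: "pair x y \<epsilon> f"
    then have x: "x \<epsilon> a" using f unfolding isfun_def by auto
    then have "\<And>z. pair x z \<epsilon> f \<Longrightarrow> z = y" using f xy unfolding isfun_def by metis
    then have "app f x = y" unfolding app_def using xy by (intro dthe_eq)
    then show "x \<epsilon> a \<and> y = app f x" using x by simp
  next
    assume xy: "x \<epsilon> a \<and> y = app f x"
    then obtain z where z: "pair x z \<epsilon> f" "\<And>w. pair x w \<epsilon> f \<Longrightarrow> w = z"
      using f unfolding isfun_def by metis
    then have "app f x = z" unfolding app_def by (rule dthe_eq)
    then show "pair x y \<epsilon> f" using xy z(1) by simp
  qed
qed

lemma
  assumes t: "dfun (\<lambda>e. t (e 0))"
  shows isfun_lam: "isfun (lam a t) a"
    and app_lam: "x \<epsilon> a \<Longrightarrow> app (lam a t) x = t x"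
proof -
  have mem: "p \<epsilon> lam a t \<longleftrightarrow> (\<exists>x. x \<epsilon> a \<and> p = pair x (t x))" for p
    unfolding lam_def by (rule mem_img) (intro dintro t)
  show "isfun (lam a t) a" unfolding isfun_def mem by auto
  show "x \<epsilon> a \<Longrightarrow> app (lam a t) x = t x" unfolding app_def by (rule dthe_eq) (auto simp: mem)
qed

lemma isbij_iff:
  "isbij f a b \<longleftrightarrow> isfun f a \<and> (\<forall>x. x \<epsilon> a \<longrightarrow> app f x \<epsilon> b) \<and>
     (\<forall>x y. x \<epsilon> a \<longrightarrow> y \<epsilon> a \<longrightarrow> app f x = app f y \<longrightarrow> x = y) \<and>
     (\<forall>y. y \<epsilon> b \<longrightarrow> (\<exists>x. x \<epsilon> a \<and> app f x = y))"
proof (cases "isfun f a")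
  case True
  then show ?thesis unfolding isbij_def isfun_app_iff[OF True] by (intro iffI conjI; metis)
qed (simp add: isbij_def)

lemma equipI:
  assumes t: "dfun (\<lambda>e. t (e 0))" and "\<And>x. x \<epsilon> a \<Longrightarrow> t x \<epsilon> b"
    and "\<And>x y. x \<epsilon> a \<Longrightarrow> y \<epsilon> a \<Longrightarrow> t x = t y \<Longrightarrow> x = y" and "\<And>y. y \<epsilon> b \<Longrightarrow> \<exists>x. x \<epsilon> a \<and> t x = y"
  shows "equip a b"
proof -
  have "\<exists>x. x \<epsilon> a \<and> app (lam a t) x = y" if y: "y \<epsilon> b" for y
  proof -
    from assms(4)[OF y] obtain x where "x \<epsilon> a" "t x = y" by blast
    then show ?thesis using app_lam[OF t, of x a] by blast
  qed
  moreover have "x = y" if "x \<epsilon> a" "y \<epsilon> a" "app (lam a t) x = app (lam a t) y" for x y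
    using assms(3)[OF that(1,2)] that by (simp add: app_lam[OF t])
  moreover have "app (lam a t) x \<epsilon> b" if "x \<epsilon> a" for x
    using assms(2)[OF that] that by (simp add: app_lam[OF t])
  ultimately show ?thesis unfolding equip_def isbij_iff using isfun_lam[OF t] by blast
qed


subsection \<open>The natural numbers\<close>

definition isind :: "'m \<Rightarrow> bool" where
  "isind w \<longleftrightarrow> emp \<epsilon> w \<and> (\<forall>n. n \<epsilon> w \<longrightarrow> succ n \<epsilon> w)"

definition omega :: 'm where
  "omega = (THE w. isind w \<and> (\<forall>v. isind v \<longrightarrow> sub w v))"

lemma dpred_isind [dintro]: "dfun t \<Longrightarrow> dpred (\<lambda>e. isind (t e))"
  by (rule dpred_comp1) (unfold isind_def, intro dintro)

lemma omega_iff: "w = omega \<longleftrightarrow> isind w \<and> (\<forall>v. isind v \<longrightarrow> sub w v)"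
proof -
  have "\<exists>e. sat UNIV E e (ax_infinity 0)" using ZF_sat by (auto simp: ZF_def)
  then obtain v where v: "isind v"
    by (auto simp: ax_infinity_def is_inductive_def is_empty_def is_succ_def sat_form isind_def
        eq_adj_iff[symmetric] emp_iff[symmetric])
  \<comment> \<open>The least inductive set is cut out of a single inductive set \<open>v\<close> as
    the part common to all inductive sets.\<close>
  have mem: "n \<epsilon> sep v (\<lambda>n. \<forall>u. isind u \<longrightarrow> n \<epsilon> u) \<longleftrightarrow> n \<epsilon> v \<and> (\<forall>u. isind u \<longrightarrow> n \<epsilon> u)" for n
    by (rule mem_sep) (intro dintro)
  let ?w = "sep v (\<lambda>n. \<forall>u. isind u \<longrightarrow> n \<epsilon> u)"
  define Q where "Q w \<longleftrightarrow> isind w \<and> (\<forall>v. isind v \<longrightarrow> sub w v)" for w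
  have "isind ?w" using v unfolding isind_def[of ?w] mem by (simp add: isind_def)
  then have Q: "Q ?w" unfolding Q_def sub_def mem by blast
  have unique: "w = w'" if "Q w" "Q w'" for w w'
    using that unfolding Q_def sub_def by (intro extensionality) blast
  have "omega = ?w" unfolding omega_def Q_def[symmetric] by (rule the_equality[of Q, OF Q]) (rule unique[OF _ Q])
  then show ?thesis using Q unique unfolding Q_def[symmetric] by metis
qed

lemma emp_omega [simp]: "emp \<epsilon> omega" and succ_omega [simp]: "n \<epsilon> omega \<Longrightarrow> succ n \<epsilon> omega"
  using omega_iff[of omega] by (auto simp: isind_def)

text \<open>Separation has to produce the set of all \<open>n\<close> with \<open>P n\<close>, which
  is then inductive. For an arbitrary predicate of HOL the rule would fail in a model with
  non-standard numbers, hence the case \<open>definable\<close>.\<close>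

lemma omega_induct [consumes 1, case_names definable emp succ]:
  assumes "n \<epsilon> omega" and P: "dpred (\<lambda>e. P (e 0))"
    and "P emp" and "\<And>n. n \<epsilon> omega \<Longrightarrow> P n \<Longrightarrow> P (succ n)"
  shows "P n"
proof -
  have "isind (sep omega P)" unfolding isind_def mem_sep[OF P] using assms by simp
  then have "sub omega (sep omega P)" using omega_iff[of omega] by blast
  then show ?thesis using assms unfolding sub_def mem_sep[OF P] by blast
qed

lemma mem_asym: "x \<epsilon> y \<Longrightarrow> \<not> y \<epsilon> x"
  using foundation[of x "upair x y"] by auto

lemma mem_irrefl [simp]: "\<not> x \<epsilon> x"
  using mem_asym by blast

lemma succ_inject [simp]: "succ m = succ n \<longleftrightarrow> m = n"
  by (metis mem_adj mem_asym)

lemma succ_neq_emp [simp]: "succ n \<noteq> emp" "emp \<noteq> succ n"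
  by (metis mem_adj not_mem_emp)+

lemma mem_omega_trans: "n \<epsilon> omega \<Longrightarrow> m \<epsilon> n \<Longrightarrow> m \<epsilon> omega"
proof -
  assume "n \<epsilon> omega" "m \<epsilon> n"
  moreover have "\<forall>m. m \<epsilon> n \<longrightarrow> m \<epsilon> omega" if "n \<epsilon> omega" for n
    using that by (induction rule: omega_induct) (intro dintro, auto)
  ultimately show ?thesis by blast
qed

lemma omega_linear:
  assumes "m \<epsilon> omega" "n \<epsilon> omega"
  shows "m \<epsilon> n \<or> m = n \<or> n \<epsilon> m"
proof -
  have emp: "n = emp \<or> emp \<epsilon> n" if "n \<epsilon> omega" for n
    using that by (induction rule: omega_induct) (intro dintro, auto)
  have succ: "\<forall>m. m \<epsilon> n \<longrightarrow> succ m = n \<or> succ m \<epsilon> n" if "n \<epsilon> omega" for n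
    using that by (induction rule: omega_induct) (intro dintro, auto)
  have "\<forall>n. n \<epsilon> omega \<longrightarrow> m \<epsilon> n \<or> m = n \<or> n \<epsilon> m"
    using assms(1)
  proof (induction rule: omega_induct)
    case emp
    then show ?case using \<open>\<And>n. n \<epsilon> omega \<Longrightarrow> n = emp \<or> emp \<epsilon> n\<close> by blast
  next
    case (succ m)
    then show ?case using \<open>\<And>n. n \<epsilon> omega \<Longrightarrow> \<forall>m. m \<epsilon> n \<longrightarrow> succ m = n \<or> succ m \<epsilon> n\<close> by auto
  qed (intro dintro)
  then show ?thesis using assms by blast
qed

text \<open>The pigeonhole principle of the model shows that \<open>omega\<close> is not finite, so
  that countable multiple choice applies to families indexed by it. The induction quantifies over
  \<open>f\<close> inside the model.\<close>

lemma no_inj_omega: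
  assumes "n \<epsilon> omega" "isfun f omega" "\<And>m. m \<epsilon> omega \<Longrightarrow> app f m \<epsilon> n"
  shows "\<exists>k l. k \<epsilon> omega \<and> l \<epsilon> omega \<and> k \<noteq> l \<and> app f k = app f l"
proof -
  have "\<forall>f. isfun f omega \<longrightarrow> (\<forall>m. m \<epsilon> omega \<longrightarrow> app f m \<epsilon> n) \<longrightarrow>
      (\<exists>k l. k \<epsilon> omega \<and> l \<epsilon> omega \<and> k \<noteq> l \<and> app f k = app f l)"
    using assms(1)
  proof (induction rule: omega_induct)
    case emp
    then show ?case using emp_omega not_mem_emp by blast
  next
    case (succ n)
    show ?case
    proof (intro allI impI)
      fix f
      assume f: "isfun f omega" "\<forall>m. m \<epsilon> omega \<longrightarrow> app f m \<epsilon> succ n"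
      \<comment> \<open>Shifting \<open>f\<close> by one frees the value \<open>app f emp\<close>,
        which then replaces the forbidden value \<open>n\<close>; an injective \<open>f\<close>
        would make \<open>t\<close> an injection into \<open>n\<close>.\<close>
      define t where "t m = (if app f (succ m) = n then app f emp else app f (succ m))" for m
      have t: "dfun (\<lambda>e. t (e 0))" unfolding t_def by (intro dintro)
      show "\<exists>k l. k \<epsilon> omega \<and> l \<epsilon> omega \<and> k \<noteq> l \<and> app f k = app f l"
      proof (rule ccontr)
        assume inj: "\<not> ?thesis"
        have "t m \<epsilon> n" if "m \<epsilon> omega" for m
        proof (cases "app f (succ m) = n")
          case True
          then have "app f emp \<noteq> n" using inj that succ_omega emp_omega succ_neq_emp by metis
          then show ?thesis using f(2) True by (simp add: t_def) (metis emp_omega mem_adj)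
        next
          case False
          then show ?thesis using f(2) that by (simp add: t_def) (metis succ_omega mem_adj)
        qed
        then have "\<forall>m. m \<epsilon> omega \<longrightarrow> app (lam omega t) m \<epsilon> n" using app_lam[OF t] by simp
        then obtain k l where kl: "k \<epsilon> omega" "l \<epsilon> omega" "k \<noteq> l" "t k = t l"
          using succ(2) isfun_lam[OF t] app_lam[OF t] by metis
        have inj': "x = y" if "app f x = app f y" "x \<epsilon> omega" "y \<epsilon> omega" for x y
          using inj that by blast
        have "succ k \<noteq> succ l" using kl by simp
        then show False
          using kl inj'[of "succ k" "succ l"] inj'[of "succ k" emp] inj'[of "succ l" emp]
          by (auto simp: t_def split: if_splits)
      qed
    qed
  qed (intro dintro)
  then show ?thesis using assms by blast
qed

text \<open>The graph of the recursively defined function is the least relation containing \<open>(0, a)\<close> and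
  closed under \<open>(n, y) \<mapsto> (n + 1, s y)\<close>.\<close>

lemma omega_recursion:
  assumes s: "dfun (\<lambda>e. s (e 0))" and a: "a \<epsilon> b" and closed: "\<And>y. y \<epsilon> b \<Longrightarrow> s y \<epsilon> b"
  shows "\<exists>c. dfun (\<lambda>e. c (e 0)) \<and> c emp = a \<and> (\<forall>n. n \<epsilon> omega \<longrightarrow> c n \<epsilon> b \<and> c (succ n) = s (c n))"
proof -
  define cl where "cl h \<longleftrightarrow> pair emp a \<epsilon> h \<and>
    (\<forall>m z. m \<epsilon> omega \<longrightarrow> pair m z \<epsilon> h \<longrightarrow> pair (succ m) (s z) \<epsilon> h)" for h
  define G where "G n y \<longleftrightarrow> (\<forall>h. cl h \<longrightarrow> pair n y \<epsilon> h)" for n y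
  note ds = dfun_comp1[OF s]
  have dcl: "dfun t \<Longrightarrow> dpred (\<lambda>e. cl (t e))" for t
    by (rule dpred_comp1) (unfold cl_def, intro dintro ds)
  have dG: "dfun t \<Longrightarrow> dfun u \<Longrightarrow> dpred (\<lambda>e. G (t e) (u e))" for t u
    by (rule dpred_comp2) (unfold G_def, intro dintro dcl)
  have cl_times: "cl (times omega b)"
    using a closed by (auto simp: cl_def mem_times)
  have G_emp: "G emp a" and G_succ: "\<And>n y. n \<epsilon> omega \<Longrightarrow> G n y \<Longrightarrow> G (succ n) (s y)"
    by (auto simp: G_def cl_def)
  have G_times: "n \<epsilon> omega \<and> y \<epsilon> b" if "G n y" for n y
    using that cl_times by (auto simp: G_def mem_times)
  have unique: "\<exists>y. G n y \<and> (\<forall>z. G n z \<longrightarrow> z = y)" if "n \<epsilon> omega" for n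
    using that
  proof (induction rule: omega_induct)
    case emp
    have "z = a" if "G emp z" for z
    proof (rule ccontr)
      assume z: "z \<noteq> a"
      \<comment> \<open>No successor equals \<open>emp\<close>, so deleting this pair leaves a
        closed relation, and the least one cannot contain it.\<close>
      let ?h = "sep (times omega b) (\<lambda>p. p \<noteq> pair emp z)"
      have mem: "p \<epsilon> ?h \<longleftrightarrow> p \<epsilon> times omega b \<and> p \<noteq> pair emp z" for p
        by (rule mem_sep) (intro dintro)
      have "cl ?h" using cl_times z unfolding cl_def mem by auto
      then show False using that unfolding G_def using mem by blast
    qed
    then show ?case using G_emp by blast
  next
    case (succ n)
    then obtain y where y: "G n y" "\<And>z. G n z \<Longrightarrow> z = y" by blast
    have "z = s y" if "G (succ n) z" for z
    proof (rule ccontr)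
      assume z: "z \<noteq> s y"
      \<comment> \<open>Deleting the pair from the full product would not do, as another value at
        \<open>n\<close> could be mapped to \<open>z\<close>. Inside \<open>G\<close> the only value
        at \<open>n\<close> is \<open>y\<close>, and \<open>s y\<close> differs from
        \<open>z\<close>.\<close>
      let ?h = "sep (times omega b) (\<lambda>p. (\<exists>m x. p = pair m x \<and> G m x) \<and> p \<noteq> pair (succ n) z)"
      have mem: "p \<epsilon> ?h \<longleftrightarrow> p \<epsilon> times omega b \<and> (\<exists>m x. p = pair m x \<and> G m x) \<and> p \<noteq> pair (succ n) z"
        for p by (rule mem_sep) (intro dintro dG)
      have h: "pair m x \<epsilon> ?h \<longleftrightarrow> G m x \<and> \<not> (m = succ n \<and> x = z)" for m x
        using G_times unfolding mem mem_times pair_eq_iff by blast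
      have "cl ?h"
        unfolding cl_def h using G_emp G_succ z y(2) by (metis succ_inject succ_neq_emp(2))
      then have "pair (succ n) z \<epsilon> ?h" by (rule that[unfolded G_def, rule_format])
      then show False unfolding h by blast
    qed
    then show ?case using G_succ[OF succ(1) y(1)] by blast
  qed (intro dintro dG)
  define c where "c n = dthe (G n)" for n
  have "dfun (\<lambda>e. c (e 0))" unfolding c_def by (intro dintro dG)
  moreover have c: "c n = y" if "G n y" for n y
    unfolding c_def using unique G_times that by (intro dthe_eq) metis+
  moreover have "c n \<epsilon> b \<and> c (succ n) = s (c n)" if "n \<epsilon> omega" for n
    using unique[OF that] c G_succ[OF that] G_times by metis
  ultimately show ?thesis using G_emp by metis
qed


subsection \<open>Finite and countable sets\<close>

definition fin :: "'m \<Rightarrow> bool" where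
  "fin a \<longleftrightarrow> (\<exists>n. n \<epsilon> omega \<and> equip a n)"

definition ctb :: "'m \<Rightarrow> bool" where
  "ctb a \<longleftrightarrow> (\<exists>s. sub s omega \<and> equip a s)"

lemma not_fin_omega: "\<not> fin omega"
  using no_inj_omega unfolding fin_def equip_def isbij_iff by metis

text \<open>Every value is represented by its least index, which foundation supplies; a possibly
  non-injective sequence thus still has a countable range without any choice.\<close>

lemma ctb_img_omega:
  assumes t: "dfun (\<lambda>e. t (e 0))"
  shows "ctb (img t omega)"
proof -
  note dt = dfun_comp1[OF t]
  define s where "s = sep omega (\<lambda>n. \<forall>m. m \<epsilon> n \<longrightarrow> t m \<noteq> t n)"
  have mem_s: "n \<epsilon> s \<longleftrightarrow> n \<epsilon> omega \<and> (\<forall>m. m \<epsilon> n \<longrightarrow> t m \<noteq> t n)" for n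
    unfolding s_def by (rule mem_sep) (intro dintro dt)
  define r where "r u = dthe (\<lambda>n. n \<epsilon> s \<and> t n = u)" for u
  have ex: "\<exists>n. n \<epsilon> s \<and> t n = t k" if "k \<epsilon> omega" for k
  proof -
    let ?a = "sep omega (\<lambda>m. t m = t k)"
    have mem: "m \<epsilon> ?a \<longleftrightarrow> m \<epsilon> omega \<and> t m = t k" for m
      by (rule mem_sep) (intro dintro dt)
    then have "k \<epsilon> ?a" using that by simp
    from foundation[OF this] obtain n where "n \<epsilon> ?a" "\<forall>m. m \<epsilon> n \<longrightarrow> \<not> m \<epsilon> ?a"
      by blast
    then show ?thesis using mem mem_s mem_omega_trans by metis
  qed
  have unique: "m = n" if "m \<epsilon> s" "n \<epsilon> s" "t m = t n" for m n
    using that omega_linear[of m n] mem_s by metis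
  have r: "r (t n) = n" if "n \<epsilon> s" for n
    unfolding r_def using that unique by (intro dthe_eq) auto
  have "equip (img t omega) s"
  proof (rule equipI)
    show "dfun (\<lambda>e. r (e 0))" unfolding r_def by (intro dintro dt)
  next
    fix u
    assume "u \<epsilon> img t omega"
    then show "r u \<epsilon> s" using ex r by (auto simp: mem_img[OF t]) metis
  next
    fix u v
    assume "u \<epsilon> img t omega" "v \<epsilon> img t omega" "r u = r v"
    then show "u = v" using ex r by (auto simp: mem_img[OF t]) metis
  next
    fix n
    assume "n \<epsilon> s"
    then show "\<exists>u. u \<epsilon> img t omega \<and> r u = n" using r mem_s by (auto simp: mem_img[OF t])
  qed
  moreover have "sub s omega" by (simp add: sub_def mem_s)
  ultimately show ?thesis unfolding ctb_def by blast
qed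

lemma ctb_omega: "ctb omega"
proof -
  have "equip omega omega" by (rule equipI[of "\<lambda>x. x"]) (intro dintro, auto)
  then show ?thesis unfolding ctb_def sub_def by blast
qed

text \<open>Induction on the number of elements in the model: removing the preimage of the last
  number \<open>n\<close> from a set equipotent to \<open>succ n\<close> leaves one equipotent to
  \<open>n\<close>.\<close>

lemma fin_induct [consumes 1, case_names definable emp adj]:
  assumes "fin a" and P: "dpred (\<lambda>e. P (e 0))" and "P emp" and adj: "\<And>a x. P a \<Longrightarrow> P (adj a x)"
  shows "P a"
proof -
  obtain n where n: "n \<epsilon> omega" "equip a n" using assms(1) unfolding fin_def by blast
  have "\<forall>a. equip a n \<longrightarrow> P a" using n(1)
  proof (induction rule: omega_induct)
    show "dpred (\<lambda>e. \<forall>a. equip a (e 0) \<longrightarrow> P a)" by (intro dintro dpred_comp1[OF P])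
  next
    case emp
    have "a = emp" if "equip a emp" for a
      using that unfolding equip_def isbij_iff emp_iff[of a] by auto
    then show ?case using assms(3) by blast
  next
    case (succ n)
    show ?case
    proof (intro allI impI)
      fix a
      assume "equip a (succ n)"
      then obtain f where f: "isfun f a" "\<And>x. x \<epsilon> a \<Longrightarrow> app f x \<epsilon> succ n"
        "\<And>x y. x \<epsilon> a \<Longrightarrow> y \<epsilon> a \<Longrightarrow> app f x = app f y \<Longrightarrow> x = y"
        "\<And>y. y \<epsilon> succ n \<Longrightarrow> \<exists>x. x \<epsilon> a \<and> app f x = y"
        unfolding equip_def isbij_iff by blast
      obtain x where x: "x \<epsilon> a" "app f x = n" using f(4)[of n] by auto
      let ?b = "sep a (\<lambda>y. y \<noteq> x)"
      have mem: "y \<epsilon> ?b \<longleftrightarrow> y \<epsilon> a \<and> y \<noteq> x" for y by (rule mem_sep) (intro dintro)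
      have "equip ?b n"
      proof (rule equipI[of "app f"])
        show "dfun (\<lambda>e. app f (e 0))" by (intro dintro)
        show "y \<epsilon> ?b \<Longrightarrow> app f y \<epsilon> n" for y using f(2,3)[of y] x mem f(3) by force
        show "y \<epsilon> ?b \<Longrightarrow> z \<epsilon> ?b \<Longrightarrow> app f y = app f z \<Longrightarrow> y = z" for y z using f(3) mem by blast
        fix y
        assume "y \<epsilon> n"
        then obtain z where "z \<epsilon> a" "app f z = y" using f(4)[of y] by auto
        then show "\<exists>z. z \<epsilon> ?b \<and> app f z = y" using x \<open>y \<epsilon> n\<close> mem mem_irrefl by blast
      qed
      then have "P (adj ?b x)" using succ adj by blast
      moreover have "adj ?b x = a" using mem x by (intro extensionality) auto
      ultimately show "P a" by simp
    qed
  qed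
  then show ?thesis using n(2) by blast
qed


subsection \<open>Interpretation of the formulas\<close>

lemma sat_sets [simp]:
  "a < d \<Longrightarrow> b < d \<Longrightarrow> holds e d (a \<^bold>\<subseteq> b) \<longleftrightarrow> sub (vl e d a) (vl e d b)"
  "a < d \<Longrightarrow> holds e d (is_empty a) \<longleftrightarrow> vl e d a = emp"
  "a < d \<Longrightarrow> b < d \<Longrightarrow> holds e d (is_Union a b) \<longleftrightarrow> vl e d a = bigU (vl e d b)"
  "a < d \<Longrightarrow> b < d \<Longrightarrow> c < d \<Longrightarrow>
     holds e d (is_inter c a b) \<longleftrightarrow> (\<forall>x. x \<epsilon> vl e d c \<longleftrightarrow> x \<epsilon> vl e d a \<and> x \<epsilon> vl e d b)"
  "a < d \<Longrightarrow> b < d \<Longrightarrow> c < d \<Longrightarrow>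
     holds e d (is_diff c a b) \<longleftrightarrow> (\<forall>x. x \<epsilon> vl e d c \<longleftrightarrow> x \<epsilon> vl e d a \<and> \<not> x \<epsilon> vl e d b)"
  "a < d \<Longrightarrow> b < d \<Longrightarrow> c < d \<Longrightarrow>
     holds e d (is_upair c a b) \<longleftrightarrow> vl e d c = upair (vl e d a) (vl e d b)"
  "a < d \<Longrightarrow> b < d \<Longrightarrow> holds e d (is_succ a b) \<longleftrightarrow> vl e d a = succ (vl e d b)"
  by (simp_all add: is_sub_def is_empty_def is_Union_def is_inter_def is_diff_def is_upair_def
      is_succ_def sat_form sub_def emp_iff eq_bigU_iff eq_upair_iff eq_adj_iff)

lemma sat_Inter [simp]:
  "a < d \<Longrightarrow> b < d \<Longrightarrow> holds e d (is_Inter a b) \<longleftrightarrow>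
     vl e d b \<noteq> emp \<and> (\<forall>x. x \<epsilon> vl e d a \<longleftrightarrow> (\<forall>y. y \<epsilon> vl e d b \<longrightarrow> x \<epsilon> y))"
  by (simp add: is_Inter_def sat_form)

lemma sat_pair [simp]:
  "a < d \<Longrightarrow> b < d \<Longrightarrow> c < d \<Longrightarrow> holds e d (is_pair c a b) \<longleftrightarrow> vl e d c = pair (vl e d a) (vl e d b)"
  by (simp add: is_pair_def sat_form pair_def)

lemma sat_prod [simp]:
  "a < d \<Longrightarrow> b < d \<Longrightarrow> c < d \<Longrightarrow> holds e d (is_prod c a b) \<longleftrightarrow> vl e d c = times (vl e d a) (vl e d b)"
  by (simp add: is_prod_def sat_form eq_times_iff)

lemma sat_maps [simp]:
  "a < d \<Longrightarrow> b < d \<Longrightarrow> c < d \<Longrightarrow> holds e d (maps c a b) \<longleftrightarrow> pair (vl e d a) (vl e d b) \<epsilon> vl e d c"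
  by (simp add: maps_def sat_form)

lemma sat_fun_on [simp]:
  "a < d \<Longrightarrow> b < d \<Longrightarrow> holds e d (fun_on a b) \<longleftrightarrow> isfun (vl e d a) (vl e d b)"
  by (simp add: fun_on_def sat_form isfun_def)

lemma sat_fun_to [simp]:
  "a < d \<Longrightarrow> b < d \<Longrightarrow> c < d \<Longrightarrow> holds e d (fun_to a b c) \<longleftrightarrow>
     isfun (vl e d a) (vl e d b) \<and> (\<forall>x y. pair x y \<epsilon> vl e d a \<longrightarrow> y \<epsilon> vl e d c)"
  by (simp add: fun_to_def sat_form)

lemma sat_equipotent [simp]:
  "a < d \<Longrightarrow> b < d \<Longrightarrow> holds e d (equipotent a b) \<longleftrightarrow> equip (vl e d a) (vl e d b)"
  by (simp add: equipotent_def is_bij_def sat_form equip_def isbij_def)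

lemma sat_preimage [simp]:
  "a < d \<Longrightarrow> b < d \<Longrightarrow> c < d \<Longrightarrow> holds e d (is_preimage c a b) \<longleftrightarrow>
     (\<forall>x. x \<epsilon> vl e d c \<longleftrightarrow> (\<exists>y. y \<epsilon> vl e d b \<and> pair x y \<epsilon> vl e d a))"
  by (simp add: is_preimage_def sat_form)

lemma sat_omega [simp]: "a < d \<Longrightarrow> holds e d (is_omega a) \<longleftrightarrow> vl e d a = omega"
proof -
  have ind: "b < d \<Longrightarrow> holds e d (is_inductive b) \<longleftrightarrow> isind (vl e d b)" for b d e
    by (simp add: is_inductive_def sat_form isind_def)
  show "a < d \<Longrightarrow> holds e d (is_omega a) \<longleftrightarrow> vl e d a = omega"
    by (simp add: is_omega_def sat_form ind omega_iff)
qed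

lemma sat_finite [simp]: "a < d \<Longrightarrow> holds e d (is_finite a) \<longleftrightarrow> fin (vl e d a)"
  by (simp add: is_finite_def sat_form fin_def)

lemma sat_countable [simp]: "a < d \<Longrightarrow> holds e d (is_countable a) \<longleftrightarrow> ctb (vl e d a)"
  by (simp add: is_countable_def sat_form ctb_def)

text \<open>The right-hand side mentions neither \<open>e\<close> nor \<open>d\<close>, so the truth
  of CMC can be moved from one depth to any other.\<close>

lemma sat_CMC: "holds e d CMC \<longleftrightarrow>
  (\<forall>J A. \<not> fin J \<and> ctb J \<and> isfun A J \<and> (\<forall>j B. pair j B \<epsilon> A \<longrightarrow> B \<noteq> emp) \<longrightarrow>
    (\<exists>g. isfun g J \<and> (\<forall>j F B. pair j F \<epsilon> g \<and> pair j B \<epsilon> A \<longrightarrow> sub F B \<and> F \<noteq> emp \<and> fin F)))"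
  by (simp add: CMC_def is_denumerable_def is_mult_choice_fun_def sat_form)

end


section \<open>Reals in a model of ZF\<close>

text \<open>The type \<open>'r\<close> lists the elements of the real field \<open>R\<close> of the model.  It is complete only for
  sets of the model.\<close>

locale zf_reals = zf_model E for E :: "'m \<Rightarrow> 'm \<Rightarrow> bool"  (infix "\<epsilon>" 50) +
  fixes R P L :: 'm and \<iota> :: "'r :: linordered_field \<Rightarrow> 'm"
  assumes inj_iota: "inj \<iota>"
    and range_iota: "x \<epsilon> R \<longleftrightarrow> x \<in> range \<iota>"
    and add_iff: "pair (pair x y) z \<epsilon> P \<longleftrightarrow> (\<exists>a b. x = \<iota> a \<and> y = \<iota> b \<and> z = \<iota> (a + b))"
    and lt_iff: "pair x y \<epsilon> L \<longleftrightarrow> (\<exists>a b. x = \<iota> a \<and> y = \<iota> b \<and> a < b)"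
    and complete: "\<exists>a. \<iota> a \<epsilon> s \<Longrightarrow> \<exists>b. \<forall>a. \<iota> a \<epsilon> s \<longrightarrow> a \<le> b \<Longrightarrow>
      \<exists>b. (\<forall>a. \<iota> a \<epsilon> s \<longrightarrow> a \<le> b) \<and> (\<forall>c. (\<forall>a. \<iota> a \<epsilon> s \<longrightarrow> a \<le> c) \<longrightarrow> b \<le> c)"
begin

lemma iota_eq_iff [simp]: "\<iota> a = \<iota> b \<longleftrightarrow> a = b"
  using inj_iota by (auto dest: injD)

lemma iota_mem [simp]: "\<iota> a \<epsilon> R"
  by (simp add: range_iota)

text \<open>The fixed default 0 outside \<open>R\<close> makes \<open>\<iota> (\<rho> x)\<close> a
  total definable function, so arguments of real functions can be decoded without side
  conditions.\<close>

definition \<rho> :: "'m \<Rightarrow> 'r" where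
  "\<rho> x = (if x \<epsilon> R then inv \<iota> x else 0)"

lemma rho_iota [simp]: "\<rho> (\<iota> a) = a"
  by (simp add: \<rho>_def inv_f_f[OF inj_iota])

lemma iota_rho: "\<iota> (\<rho> x) = (if x \<epsilon> R then x else \<iota> 0)"
  by (auto simp: \<rho>_def range_iota f_inv_into_f)

lemma iota_rho_mem [simp]: "x \<epsilon> R \<Longrightarrow> \<iota> (\<rho> x) = x"
  by (simp add: iota_rho)

text \<open>Values in the type \<open>'r\<close> count as definable when their codes in the model
  are.\<close>

definition dreal :: "((nat \<Rightarrow> 'm) \<Rightarrow> 'r) \<Rightarrow> bool" where
  "dreal t \<longleftrightarrow> dfun (\<lambda>e. \<iota> (t e))"

lemma dfun_iota [dintro]: "dreal t \<Longrightarrow> dfun (\<lambda>e. \<iota> (t e))"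
  by (simp add: dreal_def)

lemma dreal_const [dintro]: "dreal (\<lambda>e. c)"
  unfolding dreal_def by (intro dintro)

lemma dreal_rho [dintro]: "dfun t \<Longrightarrow> dreal (\<lambda>e. \<rho> (t e))"
  unfolding dreal_def iota_rho by (intro dintro)

lemma dpred_real_comp1: "dpred (\<lambda>e. Q (\<rho> (e 0))) \<Longrightarrow> dreal t \<Longrightarrow> dpred (\<lambda>e. Q (t e))"
  using dpred_comp1[of "\<lambda>x. Q (\<rho> x)" "\<lambda>e. \<iota> (t e)"] by (simp add: dreal_def)

lemma dpred_real_comp2:
  "dpred (\<lambda>e. Q (e 0) (\<rho> (e 1))) \<Longrightarrow> dfun t \<Longrightarrow> dreal u \<Longrightarrow> dpred (\<lambda>e. Q (t e) (u e))"
  using dpred_comp2[of "\<lambda>x y. Q x (\<rho> y)" t "\<lambda>e. \<iota> (u e)"] by (simp add: dreal_def)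

lemma dreal_real_comp1: "dreal (\<lambda>e. g (\<rho> (e 0))) \<Longrightarrow> dreal t \<Longrightarrow> dreal (\<lambda>e. g (t e))"
  using dfun_comp1[of "\<lambda>x. \<iota> (g (\<rho> x))" "\<lambda>e. \<iota> (t e)"] by (simp add: dreal_def)

lemma dreal_comp1: "dreal (\<lambda>e. g (e 0)) \<Longrightarrow> dfun t \<Longrightarrow> dreal (\<lambda>e. g (t e))"
  using dfun_comp1[of "\<lambda>x. \<iota> (g x)" t] by (simp add: dreal_def)

lemma dpred_real_all [dintro]:
  "dpred (\<lambda>e. Q (\<rho> (e 0)) (\<lambda>i. e (Suc i))) \<Longrightarrow> dpred (\<lambda>e. \<forall>a. Q a e)"
proof -
  assume "dpred (\<lambda>e. Q (\<rho> (e 0)) (\<lambda>i. e (Suc i)))"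
  then have "dpred (\<lambda>e. \<forall>x. Q (\<rho> x) e)" by (rule dpred_all)
  moreover have "(\<forall>x. Q (\<rho> x) e) \<longleftrightarrow> (\<forall>a. Q a e)" for e by (metis rho_iota)
  ultimately show ?thesis by simp
qed

lemma dpred_real_eq [dintro]: "dreal t \<Longrightarrow> dreal u \<Longrightarrow> dpred (\<lambda>e. t e = u e)"
  using dpred_eq[of "\<lambda>e. \<iota> (t e)" "\<lambda>e. \<iota> (u e)"] by (simp add: dreal_def)

lemma dpred_less [dintro]: "dreal t \<Longrightarrow> dreal u \<Longrightarrow> dpred (\<lambda>e. t e < u e)"
  using dpred_mem[OF dfun_pair[of "\<lambda>e. \<iota> (t e)" "\<lambda>e. \<iota> (u e)"] dfun_const[of L]]
  by (simp add: dreal_def lt_iff)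

lemma dpred_le [dintro]: "dreal t \<Longrightarrow> dreal u \<Longrightarrow> dpred (\<lambda>e. t e \<le> u e)"
  using dpred_not[OF dpred_less[of u t]] by (simp add: not_less)

lemma dreal_if [dintro]:
  "dpred Q \<Longrightarrow> dreal t \<Longrightarrow> dreal u \<Longrightarrow> dreal (\<lambda>e. if Q e then t e else u e)"
  using dfun_if[of Q "\<lambda>e. \<iota> (t e)" "\<lambda>e. \<iota> (u e)"] by (simp add: dreal_def if_distrib[of \<iota>])

lemma dreal_diff [dintro]: "dreal t \<Longrightarrow> dreal u \<Longrightarrow> dreal (\<lambda>e. t e - u e)"
proof -
  have "dreal (\<lambda>e. \<rho> (e 0) - \<rho> (e 1))"
  proof -
    have "\<iota> (\<rho> x - \<rho> y) = dthe (\<lambda>z. pair (pair z (\<iota> (\<rho> y))) (\<iota> (\<rho> x)) \<epsilon> P)" for x y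
      by (rule dthe_eq[symmetric]) (auto simp: add_iff)
    then show ?thesis unfolding dreal_def by simp (intro dintro)
  qed
  moreover assume "dreal t" "dreal u"
  ultimately show ?thesis
    using dfun_comp2[of "\<lambda>x y. \<iota> (\<rho> x - \<rho> y)" "\<lambda>e. \<iota> (t e)" "\<lambda>e. \<iota> (u e)"] by (simp add: dreal_def)
qed

lemma dreal_uminus [dintro]: "dreal t \<Longrightarrow> dreal (\<lambda>e. - t e)"
  using dreal_diff[OF dreal_const[of 0], of t] by simp

lemma dreal_add [dintro]: "dreal t \<Longrightarrow> dreal u \<Longrightarrow> dreal (\<lambda>e. t e + u e)"
  using dreal_diff[OF _ dreal_uminus, of t u] by simp

lemma dreal_abs [dintro]: "dreal t \<Longrightarrow> dreal (\<lambda>e. \<bar>t e\<bar>)"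
  unfolding abs_if by (intro dintro)

text \<open>Half of \<open>x\<close> is described through the graph of addition, as the solution
  \<open>z\<close> of \<open>z + z = x\<close>.\<close>

lemma dreal_half [dintro]: "dreal t \<Longrightarrow> dreal (\<lambda>e. t e / 2)"
proof -
  have "\<iota> (\<rho> x / 2) = dthe (\<lambda>z. pair (pair z z) (\<iota> (\<rho> x)) \<epsilon> P)" for x
  proof (rule dthe_eq[symmetric])
    show "pair (pair (\<iota> (\<rho> x / 2)) (\<iota> (\<rho> x / 2))) (\<iota> (\<rho> x)) \<epsilon> P"
      unfolding add_iff by (intro exI[of _ "\<rho> x / 2"]) simp
  qed (auto simp: add_iff)
  then have "dreal (\<lambda>e. \<rho> (e 0) / 2)" unfolding dreal_def by simp (intro dintro)
  then show "dreal t \<Longrightarrow> dreal (\<lambda>e. t e / 2)" by (rule dreal_real_comp1)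
qed

definition lub :: "('r \<Rightarrow> bool) \<Rightarrow> 'r \<Rightarrow> bool" where
  "lub A b \<longleftrightarrow> (\<forall>a. A a \<longrightarrow> a \<le> b) \<and> (\<forall>c. (\<forall>a. A a \<longrightarrow> a \<le> c) \<longrightarrow> b \<le> c)"

text \<open>Suprema exist only for predicates whose extension is a set of the model, so each use of
  completeness comes with a definability goal.\<close>

lemma ex_lub:
  assumes A: "dpred (\<lambda>e. A (\<rho> (e 0)))" and "A a" and "\<And>a. A a \<Longrightarrow> a \<le> b"
  shows "\<exists>s. lub A s"
proof -
  have "\<iota> a \<epsilon> sep R (\<lambda>x. A (\<rho> x)) \<longleftrightarrow> A a" for a
    using mem_sep[OF A, of "\<iota> a" R] by simp
  then show ?thesis using complete[of "sep R (\<lambda>x. A (\<rho> x))"] assms(2,3) unfolding lub_def by auto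
qed


subsection \<open>The distance to a closed set\<close>

definition closed_pred :: "('r \<Rightarrow> bool) \<Rightarrow> bool" where
  "closed_pred K \<longleftrightarrow> (\<forall>a. \<not> K a \<longrightarrow> (\<exists>\<delta>>0. \<forall>b. \<bar>a - b\<bar> < \<delta> \<longrightarrow> \<not> K b))"

definition lipschitz :: "('r \<Rightarrow> 'r) \<Rightarrow> bool" where
  "lipschitz g \<longleftrightarrow> (\<forall>a b. \<bar>g a - g b\<bar> \<le> \<bar>a - b\<bar>)"

text \<open>The function is the minimum of 1 and the distance to \<open>K\<close>, so that \<open>K\<close> may be empty.\<close>

lemma closed_pred_lipschitz:
  assumes K: "dpred (\<lambda>e. K (\<rho> (e 0)))" and closed: "closed_pred K"
  shows "\<exists>g. dreal (\<lambda>e. g (\<rho> (e 0))) \<and> lipschitz g \<and> (\<forall>a. g a = 0 \<longleftrightarrow> K a)"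
proof -
  note dK = dpred_real_comp1[OF K]
  \<comment> \<open>The truncated distance is the supremum of its non-negative lower bounds; this
    form fits \<open>ex_lub\<close>, which provides suprema.\<close>
  define G where "G a s \<longleftrightarrow> 0 \<le> s \<and> s \<le> 1 \<and> (\<forall>k. K k \<longrightarrow> s \<le> \<bar>a - k\<bar>)" for a s
  \<comment> \<open>Suprema are unique, so \<open>dthe\<close> can name the value and
    \<open>g\<close> stays definable.\<close>
  define g where "g a = \<rho> (dthe (\<lambda>z. z \<epsilon> R \<and> lub (G a) (\<rho> z)))" for a
  have lub: "lub (G a) (g a)" for a
  proof -
    have "\<exists>s. lub (G a) s"
    proof (rule ex_lub)
      show "dpred (\<lambda>e. G a (\<rho> (e 0)))" unfolding G_def by (intro dintro dK)
      show "G a 0" by (simp add: G_def)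
      show "G a s \<Longrightarrow> s \<le> 1" for s by (simp add: G_def)
    qed
    then obtain s where s: "lub (G a) s" by blast
    have "s' = s" if "lub (G a) s'" for s'
      using s that unfolding lub_def by (meson antisym)
    then have "dthe (\<lambda>z. z \<epsilon> R \<and> lub (G a) (\<rho> z)) = \<iota> s"
      using s by (intro dthe_eq) (metis iota_mem rho_iota, metis iota_rho_mem)
    then show ?thesis using s by (simp add: g_def)
  qed
  have G_iff: "G a s \<Longrightarrow> s \<le> g a" and G_g: "G a (g a)" for a s
  proof -
    show le: "G a s \<Longrightarrow> s \<le> g a" for s using lub[of a] by (simp add: lub_def)
    have "g a \<le> c" if "\<And>s. G a s \<Longrightarrow> s \<le> c" for c
      using lub[of a] that by (simp add: lub_def)
    then show "G a (g a)" using le[of 0] by (simp add: G_def)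
  qed
  have "dreal (\<lambda>e. g (\<rho> (e 0)))"
    unfolding g_def lub_def G_def by (intro dintro dK)
  moreover have "lipschitz g"
  proof -
    have "g a \<le> g b + \<bar>a - b\<bar>" for a b
    proof (cases "g a \<le> \<bar>a - b\<bar>")
      case True
      then show ?thesis using G_g[of b] by (simp add: G_def)
    next
      case False
      \<comment> \<open>By the triangle inequality a lower bound for the distances from
        \<open>a\<close>, lowered by \<open>\<bar>a - b\<bar>\<close>, is one for the distances from
        \<open>b\<close>.\<close>
      have "G b (g a - \<bar>a - b\<bar>)"
        unfolding G_def
      proof (intro conjI allI impI)
        fix k
        assume "K k"
        then have "g a \<le> \<bar>a - k\<bar>" using G_g[of a] by (simp add: G_def)
        then show "g a - \<bar>a - b\<bar> \<le> \<bar>b - k\<bar>" by linarith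
      qed (use False G_g[of a] in \<open>auto simp: G_def intro: order_trans[of _ "g a"]\<close>)
      then show ?thesis using G_iff[of b] by (smt (verit) add.commute diff_le_eq)
    qed
    then have "g a \<le> g b + \<bar>a - b\<bar> \<and> g b \<le> g a + \<bar>a - b\<bar>" for a b
      by (metis abs_minus_commute)
    then show ?thesis unfolding lipschitz_def abs_le_iff by (simp add: algebra_simps)
  qed
  moreover have "g a = 0 \<longleftrightarrow> K a" for a
  proof
    assume "K a"
    then have "g a \<le> 0" "0 \<le> g a" using G_g[of a] by (auto simp: G_def)
    then show "g a = 0" by simp
  next
    assume 0: "g a = 0"
    show "K a"
    proof (rule ccontr)
      assume "\<not> K a"
      then obtain \<delta> where \<delta>: "\<delta> > 0" "\<And>b. \<bar>a - b\<bar> < \<delta> \<Longrightarrow> \<not> K b"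
        using closed unfolding closed_pred_def by blast
      then have "G a (min \<delta> 1)" unfolding G_def by (auto simp: min_le_iff_disj not_less[symmetric])
      then show False using G_iff[of a] 0 \<delta>(1) by fastforce
    qed
  qed
  ultimately show ?thesis by blast
qed


subsection \<open>Two sequences of reals\<close>

lemma ex_null_sequence:
  "\<exists>c. dreal (\<lambda>e. c (e 0)) \<and> (\<forall>n. n \<epsilon> omega \<longrightarrow> 0 < c n) \<and> (\<forall>a>0. \<exists>n. n \<epsilon> omega \<and> c n < a)"
proof -
  have "dfun (\<lambda>e. \<iota> (\<rho> (e 0) / 2))" by (intro dintro)
  from omega_recursion[OF this, of "\<iota> 1" R] obtain c' where c': "dfun (\<lambda>e. c' (e 0))" "c' emp = \<iota> 1"
    "\<And>n. n \<epsilon> omega \<Longrightarrow> c' n \<epsilon> R \<and> c' (succ n) = \<iota> (\<rho> (c' n) / 2)"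
    by auto
  define c where "c n = \<rho> (c' n)" for n
  have dc: "dreal (\<lambda>e. c (e 0))" unfolding c_def by (intro dintro c'(1))
  note dc' = dreal_comp1[OF dc]
  have c_emp: "c emp = 1" and c_succ: "\<And>n. n \<epsilon> omega \<Longrightarrow> c (succ n) = c n / 2"
    using c' by (auto simp: c_def)
  have pos: "0 < c n" if "n \<epsilon> omega" for n
    using that
  proof (induction rule: omega_induct)
    case definable
    show ?case by (intro dintro dc')
  next
    case emp
    show ?case by (simp add: c_emp)
  next
    case (succ n)
    show ?case unfolding c_succ[OF succ(1)] using succ(2) by simp
  qed
  have "\<exists>n. n \<epsilon> omega \<and> c n < a" if "a > 0" for a
  proof (rule ccontr)
    assume "\<not> ?thesis"
    then have a: "\<And>n. n \<epsilon> omega \<Longrightarrow> a \<le> c n" by (auto simp: not_less)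
    let ?A = "\<lambda>s. \<forall>n. n \<epsilon> omega \<longrightarrow> s \<le> c n"
    have "\<exists>s. lub ?A s"
    proof (rule ex_lub)
      show "dpred (\<lambda>e. ?A (\<rho> (e 0)))" by (intro dintro dc')
      show "?A a" using a by simp
      show "?A s \<Longrightarrow> s \<le> 1" for s using c_emp emp_omega by metis
    qed
    then obtain b where b: "lub ?A b" by blast
    have "a \<le> b" using b a unfolding lub_def by blast
    have "b \<le> c n" if "n \<epsilon> omega" for n
      using b that unfolding lub_def by blast
    then have "?A (2 * b)" using c_succ succ_omega by fastforce
    then have "2 * b \<le> b" using b unfolding lub_def by blast
    then show False using \<open>a \<le> b\<close> \<open>a > 0\<close> by linarith
  qed
  then show ?thesis using dc pos by blast
qed

text \<open>The sequence \<open>0, \<eta>, -\<eta>, 2\<eta>, -2\<eta>, \<dots>\<close>\<close>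

lemma ex_cofinal_sequence:
  assumes "\<eta> > 0"
  shows "\<exists>c. dreal (\<lambda>e. c (e 0)) \<and> (\<forall>a. \<exists>n. n \<epsilon> omega \<and> \<bar>a - c n\<bar> \<le> \<eta>)"
proof -
  \<comment> \<open>No parity counter is required: a positive term is followed by its negative, and
    a term \<open>- a\<close> with \<open>a \<ge> 0\<close> by \<open>a + \<eta>\<close>.\<close>
  have "dfun (\<lambda>e. \<iota> (if 0 < \<rho> (e 0) then - \<rho> (e 0) else \<eta> - \<rho> (e 0)))" by (intro dintro)
  from omega_recursion[OF this, of "\<iota> 0" R] obtain c' where c': "dfun (\<lambda>e. c' (e 0))" "c' emp = \<iota> 0"
    "\<And>n. n \<epsilon> omega \<Longrightarrow> c' n \<epsilon> R \<and>
      c' (succ n) = \<iota> (if 0 < \<rho> (c' n) then - \<rho> (c' n) else \<eta> - \<rho> (c' n))"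
    by auto
  define c where "c n = \<rho> (c' n)" for n
  have dc: "dreal (\<lambda>e. c (e 0))" unfolding c_def by (intro dintro c'(1))
  note dc' = dreal_comp1[OF dc]
  define J where "J a \<longleftrightarrow> (\<exists>n. n \<epsilon> omega \<and> c n = a)" for a
  have dJ: "dpred (\<lambda>e. J (\<rho> (e 0)))" unfolding J_def by (intro dintro dc')
  have c_succ: "c (succ n) = (if 0 < c n then - c n else \<eta> - c n)" if "n \<epsilon> omega" for n
    using c'(3)[OF that] by (simp add: c_def)
  have J0: "J 0" unfolding J_def c_def using c'(2) by (intro exI[of _ emp]) simp
  have J: "J (if 0 < a then - a else \<eta> - a)" if "J a" for a
    using that c_succ succ_omega unfolding J_def by metis
  have J_neg: "J (- a)" if "J a" "0 \<le> a" for a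
    using J[OF that(1)] that J0 by (cases "a = 0") auto
  have J_step: "J (a + \<eta>)" if "J a" "0 \<le> a" for a
    using J[OF J_neg[OF that]] that by (simp add: add.commute)
  have *: "\<exists>b. J b \<and> 0 \<le> b \<and> \<bar>a - b\<bar> \<le> \<eta>" if "a \<ge> 0" for a
  proof -
    let ?A = "\<lambda>b. J b \<and> 0 \<le> b \<and> b \<le> a"
    have "\<exists>s. lub ?A s"
    proof (rule ex_lub)
      show "dpred (\<lambda>e. ?A (\<rho> (e 0)))" by (intro dintro dpred_real_comp1[OF dJ])
      show "?A 0" using J0 \<open>a \<ge> 0\<close> by simp
      show "?A b \<Longrightarrow> b \<le> a" for b by simp
    qed
    then obtain s where s: "lub ?A s" by blast
    \<comment> \<open>Some term \<open>b\<close> lies above \<open>s - \<eta>\<close>. Then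
      \<open>b + \<eta>\<close> exceeds the supremum, hence also \<open>a\<close>, which puts
      \<open>a\<close> within \<open>\<eta>\<close> of \<open>b\<close>.\<close>
    have "\<not> s \<le> s - \<eta>" using \<open>\<eta> > 0\<close> by simp
    then obtain b where b: "?A b" "\<not> b \<le> s - \<eta>" using s unfolding lub_def by blast
    then have "\<not> ?A (b + \<eta>)" using s unfolding lub_def by (metis le_diff_eq)
    moreover have "J (b + \<eta>)" "0 \<le> b + \<eta>" using b J_step \<open>\<eta> > 0\<close> by auto
    ultimately have "a < b + \<eta>" by auto
    then show ?thesis using b(1) by (intro exI[of _ b]) auto
  qed
  have "\<exists>b. J b \<and> \<bar>a - b\<bar> \<le> \<eta>" for a
  proof (cases "a \<ge> 0")
    case False
    then obtain b where "J b" "0 \<le> b" "\<bar>- a - b\<bar> \<le> \<eta>" using *[of "- a"] by auto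
    then show ?thesis using J_neg[of b] by (intro exI[of _ "- b"]) (auto simp: abs_if split: if_splits)
  qed (use * in blast)
  then show ?thesis using dc unfolding J_def by blast
qed


subsection \<open>Formulas about real numbers and spaces\<close>

definition rle :: "'m \<Rightarrow> 'm \<Rightarrow> bool" where
  "rle x y \<longleftrightarrow> (\<exists>a b. x = \<iota> a \<and> y = \<iota> b \<and> a < b) \<or> x = y"

lemma rle_iota: "rle (\<iota> a) y \<longleftrightarrow> (\<exists>b. y = \<iota> b \<and> a \<le> b)"
  by (auto simp: rle_def order_le_less)

definition vars_below :: "real_vars \<Rightarrow> nat \<Rightarrow> bool" where
  "vars_below S d \<longleftrightarrow> car S < d \<and> add S < d \<and> lt S < d \<and> r_zero S < d"

definition reals_at :: "(nat \<Rightarrow> 'm) \<Rightarrow> nat \<Rightarrow> real_vars \<Rightarrow> bool" where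
  "reals_at e d S \<longleftrightarrow>
     vl e d (car S) = R \<and> vl e d (add S) = P \<and> vl e d (lt S) = L \<and> vl e d (r_zero S) = \<iota> 0"

lemma vars_below [simp]:
  "vars_below S d \<Longrightarrow> vars_below S (Suc d)"
  "vars_below S d \<Longrightarrow> car S < d" "vars_below S d \<Longrightarrow> add S < d"
  "vars_below S d \<Longrightarrow> lt S < d" "vars_below S d \<Longrightarrow> r_zero S < d"
  by (auto simp: vars_below_def)

lemma reals_at [simp]:
  "vars_below S d \<Longrightarrow> reals_at e d S \<Longrightarrow> reals_at (case_nat x e) (Suc d) S"
  "reals_at e d S \<Longrightarrow> vl e d (car S) = R" "reals_at e d S \<Longrightarrow> vl e d (add S) = P"
  "reals_at e d S \<Longrightarrow> vl e d (lt S) = L" "reals_at e d S \<Longrightarrow> vl e d (r_zero S) = \<iota> 0"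
  by (simp_all add: reals_at_def)

lemma sat_reals [simp]:
  assumes "vars_below S d" "reals_at e d S" "a < d" "b < d"
  shows "holds e d (r_less S a b) \<longleftrightarrow> (\<exists>r s. vl e d a = \<iota> r \<and> vl e d b = \<iota> s \<and> r < s)"
    "holds e d (r_le S a b) \<longleftrightarrow> rle (vl e d a) (vl e d b)"
    "c < d \<Longrightarrow> holds e d (r_sum S a b c) \<longleftrightarrow>
      (\<exists>r s. vl e d a = \<iota> r \<and> vl e d b = \<iota> s \<and> vl e d c = \<iota> (r + s))"
  using assms by (auto simp: r_less_def r_le_def r_sum_def sat_form lt_iff add_iff rle_def)

lemma bounded_quantifier_iota:
  "(\<exists>x. (\<exists>a. x = \<iota> a \<and> A a) \<and> Q x) \<longleftrightarrow> (\<exists>a. A a \<and> Q (\<iota> a))"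
  "(\<forall>x. (\<exists>a. x = \<iota> a \<and> A a) \<longrightarrow> Q x) \<longleftrightarrow> (\<forall>a. A a \<longrightarrow> Q (\<iota> a))"
  by blast+

lemma sat_dist [simp]:
  assumes "vars_below S d" "reals_at e d S" "a < d" "b < d" "c < d"
  shows "holds e d (is_dist S c a b) \<longleftrightarrow>
    (\<exists>r s. vl e d a = \<iota> r \<and> vl e d b = \<iota> s \<and> vl e d c = \<iota> \<bar>r - s\<bar>)"
proof -
  have "holds e d (is_dist S c a b) \<longleftrightarrow>
    (\<exists>u. (\<exists>r s. vl e d b = \<iota> r \<and> u = \<iota> s \<and> vl e d a = \<iota> (r + s)) \<and>
      ((\<exists>s. u = \<iota> s \<and> 0 \<le> s) \<and> vl e d c = u \<or>
       (\<exists>s. u = \<iota> s \<and> s < 0) \<and> (\<exists>r s. u = \<iota> r \<and> vl e d c = \<iota> s \<and> 0 = r + s)))"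
    using assms by (simp add: is_dist_def sat_form rle_iota)
  also have "\<dots> \<longleftrightarrow> (\<exists>r s. vl e d a = \<iota> r \<and> vl e d b = \<iota> s \<and> vl e d c = \<iota> \<bar>r - s\<bar>)"
  proof (intro iffI; elim exE conjE disjE)
    fix r s
    assume *: "vl e d a = \<iota> r" "vl e d b = \<iota> s" "vl e d c = \<iota> \<bar>r - s\<bar>"
    show "\<exists>u. (\<exists>r s. vl e d b = \<iota> r \<and> u = \<iota> s \<and> vl e d a = \<iota> (r + s)) \<and>
      ((\<exists>s. u = \<iota> s \<and> 0 \<le> s) \<and> vl e d c = u \<or>
       (\<exists>s. u = \<iota> s \<and> s < 0) \<and> (\<exists>r s. u = \<iota> r \<and> vl e d c = \<iota> s \<and> 0 = r + s))"
      using * by (intro exI[of _ "\<iota> (r - s)"]) (auto simp: abs_if)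
  next
    fix u r s t
    assume "vl e d b = \<iota> r" "u = \<iota> s" "vl e d a = \<iota> (r + s)" "u = \<iota> t" "0 \<le> t" "vl e d c = u"
    then show "\<exists>r s. vl e d a = \<iota> r \<and> vl e d b = \<iota> s \<and> vl e d c = \<iota> \<bar>r - s\<bar>"
      by (intro exI[of _ "r + s"] exI[of _ r]) simp
  next
    fix u r s t q p
    assume "vl e d b = \<iota> r" "u = \<iota> s" "vl e d a = \<iota> (r + s)" "t < 0" "u = \<iota> t" "u = \<iota> q"
      "vl e d c = \<iota> p" "0 = q + p"
    then show "\<exists>r s. vl e d a = \<iota> r \<and> vl e d b = \<iota> s \<and> vl e d c = \<iota> \<bar>r - s\<bar>"
      by (intro exI[of _ "r + s"] exI[of _ r]) (simp add: eq_neg_iff_add_eq_0 add.commute)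
  qed
  finally show ?thesis .
qed

definition open_real :: "'m \<Rightarrow> bool" where
  "open_real W \<longleftrightarrow> (\<forall>x. x \<epsilon> W \<longrightarrow> x \<epsilon> R) \<and>
     (\<forall>a. \<iota> a \<epsilon> W \<longrightarrow> (\<exists>\<delta>>0. \<forall>b. \<bar>a - b\<bar> < \<delta> \<longrightarrow> \<iota> b \<epsilon> W))"

lemma sat_open_real [simp]:
  assumes "vars_below S d" "reals_at e d S" "a < d"
  shows "holds e d (is_open_real S a) \<longleftrightarrow> open_real (vl e d a)"
proof -
  have "holds e d (is_open_real S a) \<longleftrightarrow> sub (vl e d a) R \<and>
    (\<forall>x. x \<epsilon> vl e d a \<longrightarrow> (\<exists>\<delta>>0. \<forall>y c. (\<exists>r s. x = \<iota> r \<and> y = \<iota> s \<and> c = \<iota> \<bar>r - s\<bar>) \<and>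
      (\<exists>r. c = \<iota> r \<and> r < \<delta>) \<longrightarrow> y \<epsilon> vl e d a))"
    using assms by (simp add: is_open_real_def sat_form bounded_quantifier_iota)
  also have "\<dots> \<longleftrightarrow> open_real (vl e d a)"
  proof -
    have key: "(\<forall>y c. (\<exists>r s. \<iota> a' = \<iota> r \<and> y = \<iota> s \<and> c = \<iota> \<bar>r - s\<bar>) \<and> (\<exists>r. c = \<iota> r \<and> r < \<delta>) \<longrightarrow> y \<epsilon> W)
      \<longleftrightarrow> (\<forall>b. \<bar>a' - b\<bar> < \<delta> \<longrightarrow> \<iota> b \<epsilon> W)" for a' \<delta> W
      by auto
    have all: "(\<forall>x. x \<epsilon> W \<longrightarrow> Q x) \<longleftrightarrow> (\<forall>a. \<iota> a \<epsilon> W \<longrightarrow> Q (\<iota> a))" if "sub W R" for W Q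
      using that unfolding sub_def range_iota by blast
    show ?thesis
      unfolding open_real_def sub_def[symmetric]
    proof (rule conj_cong[OF refl])
      assume "sub (vl e d a) R"
      note all = all[OF this]
      show "(\<forall>x. x \<epsilon> vl e d a \<longrightarrow> (\<exists>\<delta>>0. \<forall>y c. (\<exists>r s. x = \<iota> r \<and> y = \<iota> s \<and> c = \<iota> \<bar>r - s\<bar>) \<and>
          (\<exists>r. c = \<iota> r \<and> r < \<delta>) \<longrightarrow> y \<epsilon> vl e d a)) \<longleftrightarrow>
        (\<forall>r. \<iota> r \<epsilon> vl e d a \<longrightarrow> (\<exists>\<delta>>0. \<forall>s. \<bar>r - s\<bar> < \<delta> \<longrightarrow> \<iota> s \<epsilon> vl e d a))"
        unfolding all key ..
    qed
  qed
  finally show ?thesis .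
qed

definition cont :: "'m \<Rightarrow> 'm \<Rightarrow> 'm \<Rightarrow> bool" where
  "cont X t f \<longleftrightarrow> (isfun f X \<and> (\<forall>x y. pair x y \<epsilon> f \<longrightarrow> y \<epsilon> R)) \<and>
     (\<forall>W v. open_real W \<and> (\<forall>x. x \<epsilon> v \<longleftrightarrow> (\<exists>y. y \<epsilon> W \<and> pair x y \<epsilon> f)) \<longrightarrow> v \<epsilon> t)"

lemma sat_in_C [simp]:
  assumes "vars_below S d" "reals_at e d S" "X < d" "t < d" "f < d"
  shows "holds e d (in_C S X t f) \<longleftrightarrow> cont (vl e d X) (vl e d t) (vl e d f)"
  using assms by (simp add: in_C_def sat_form cont_def)

definition zero_set :: "'m \<Rightarrow> 'm \<Rightarrow> 'm \<Rightarrow> bool" where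
  "zero_set X t Z \<longleftrightarrow> (\<exists>f. cont X t f \<and> (\<forall>x. x \<epsilon> Z \<longleftrightarrow> pair x (\<iota> 0) \<epsilon> f))"

lemma sat_zero_set [simp]:
  assumes "vars_below S d" "reals_at e d S" "X < d" "t < d" "Z < d"
  shows "holds e d (is_zero_set S X t Z) \<longleftrightarrow> zero_set (vl e d X) (vl e d t) (vl e d Z)"
  using assms by (simp add: is_zero_set_def sat_form zero_set_def)

definition clopen :: "'m \<Rightarrow> 'm \<Rightarrow> 'm \<Rightarrow> bool" where
  "clopen X t u \<longleftrightarrow> u \<epsilon> t \<and> (\<exists>c. (\<forall>x. x \<epsilon> c \<longleftrightarrow> x \<epsilon> X \<and> \<not> x \<epsilon> u) \<and> c \<epsilon> t)"

lemma sat_clopen [simp]: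
  "X < d \<Longrightarrow> t < d \<Longrightarrow> u < d \<Longrightarrow>
    holds e d (is_clopen X t u) \<longleftrightarrow> clopen (vl e d X) (vl e d t) (vl e d u)"
  by (simp add: is_clopen_def sat_form clopen_def)

lemma sat_clopen_family [simp]:
  "X < d \<Longrightarrow> t < d \<Longrightarrow> u < d \<Longrightarrow>
    holds e d (clopen_family X t u) \<longleftrightarrow> (\<forall>v. v \<epsilon> vl e d u \<longrightarrow> clopen (vl e d X) (vl e d t) v)"
  by (simp add: clopen_family_def sat_form)

definition osc_le :: "'m \<Rightarrow> 'm \<Rightarrow> 'm \<Rightarrow> bool" where
  "osc_le s f a \<longleftrightarrow> rle (\<iota> 0) s \<and> (\<forall>x y r r'. x \<epsilon> a \<and> y \<epsilon> a \<and> pair x (\<iota> r) \<epsilon> f \<and> pair y (\<iota> r') \<epsilon> f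
     \<longrightarrow> rle (\<iota> \<bar>r - r'\<bar>) s)"

lemma sat_osc [simp]:
  assumes "vars_below S d" "reals_at e d S" "s < d" "f < d" "a < d"
  shows "holds e d (is_osc S s f a) \<longleftrightarrow> osc_le (vl e d s) (vl e d f) (vl e d a) \<and>
    (\<forall>s'. osc_le s' (vl e d f) (vl e d a) \<longrightarrow> rle (vl e d s) s')"
proof -
  have "holds e d (osc_bound S s f a) \<longleftrightarrow> osc_le (vl e d s) (vl e d f) (vl e d a)"
    if "vars_below S d" "reals_at e d S" "s < d" "f < d" "a < d" for e d s f a
    using that unfolding osc_bound_def osc_le_def by (simp add: sat_form) metis
  then show ?thesis using assms by (simp add: is_osc_def sat_form)
qed

lemma sat_in_A:
  assumes "vars_below S d" "reals_at e d S" "X < d" "t < d" "f < d"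
  shows "holds e d (in_A S X t f) \<longleftrightarrow> cont (vl e d X) (vl e d t) (vl e d f) \<and>
    (\<forall>W v. open_real W \<and> (\<forall>x. x \<epsilon> v \<longleftrightarrow> (\<exists>y. y \<epsilon> W \<and> pair x y \<epsilon> vl e d f)) \<longrightarrow>
      (\<exists>U. ctb U \<and> (\<forall>u. u \<epsilon> U \<longrightarrow> clopen (vl e d X) (vl e d t) u) \<and> v = bigU U))"
  using assms by (simp add: in_A_def sat_form)

lemma sat_in_U:
  assumes "vars_below S d" "reals_at e d S" "X < d" "t < d" "f < d"
  shows "holds e d (in_U S X t f) \<longleftrightarrow> cont (vl e d X) (vl e d t) (vl e d f) \<and>
    (\<forall>\<eta>>0. \<exists>U. ctb U \<and> (\<forall>u. u \<epsilon> U \<longrightarrow> clopen (vl e d X) (vl e d t) u) \<and> vl e d X = bigU U \<and>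
      (\<forall>a. a \<epsilon> U \<longrightarrow> (\<exists>s. (osc_le s (vl e d f) a \<and> (\<forall>s'. osc_le s' (vl e d f) a \<longrightarrow> rle s s')) \<and>
        rle s (\<iota> \<eta>))))"
  using assms by (simp add: in_U_def sat_form bounded_quantifier_iota)

lemma sat_strongly_zero_dim:
  assumes "vars_below S d" "reals_at e d S" "X < d" "t < d" and szd: "holds e d (is_strongly_zero_dim S X t)"
  shows "\<And>u. u \<epsilon> vl e d t \<Longrightarrow> sub u (vl e d X)" "vl e d X \<epsilon> vl e d t" "emp \<epsilon> vl e d t"
    "\<And>a. sub a (vl e d t) \<Longrightarrow> bigU a \<epsilon> vl e d t"
    "\<And>u v w. u \<epsilon> vl e d t \<Longrightarrow> v \<epsilon> vl e d t \<Longrightarrow> (\<And>x. x \<epsilon> w \<longleftrightarrow> x \<epsilon> u \<and> x \<epsilon> v) \<Longrightarrow> w \<epsilon> vl e d t"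
    "\<And>Z Z'. zero_set (vl e d X) (vl e d t) Z \<Longrightarrow> zero_set (vl e d X) (vl e d t) Z' \<Longrightarrow>
      (\<And>x. \<not> (x \<epsilon> Z \<and> x \<epsilon> Z')) \<Longrightarrow>
      \<exists>u. clopen (vl e d X) (vl e d t) u \<and> sub Z u \<and> (\<forall>x. x \<epsilon> u \<longrightarrow> \<not> x \<epsilon> Z')"
proof -
  have "holds e d (\<^bold>\<forall>Z\<^sub>1 Z\<^sub>2. is_zero_set S X t Z\<^sub>1 \<^bold>\<and> is_zero_set S X t Z\<^sub>2 \<^bold>\<and> \<^bold>\<not> (\<^bold>\<exists>x. x \<^bold>\<in> Z\<^sub>1 \<^bold>\<and> x \<^bold>\<in> Z\<^sub>2) \<^bold>\<longrightarrow>
        (\<^bold>\<exists>U c. is_clopen X t U \<^bold>\<and> Z\<^sub>1 \<^bold>\<subseteq> U \<^bold>\<and> is_diff c X Z\<^sub>2 \<^bold>\<and> U \<^bold>\<subseteq> c))"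
    using szd unfolding is_strongly_zero_dim_def is_completely_regular_def sat_form(5) by blast
  then have sep: "\<forall>Z Z'. zero_set (vl e d X) (vl e d t) Z \<and> zero_set (vl e d X) (vl e d t) Z' \<and>
      \<not> (\<exists>x. x \<epsilon> Z \<and> x \<epsilon> Z') \<longrightarrow>
      (\<exists>u c. clopen (vl e d X) (vl e d t) u \<and> sub Z u \<and> (\<forall>x. x \<epsilon> c \<longleftrightarrow> x \<epsilon> vl e d X \<and> \<not> x \<epsilon> Z') \<and> sub u c)"
    using assms(1-4) by (simp add: sat_form)
  fix Z Z'
  assume "zero_set (vl e d X) (vl e d t) Z" "zero_set (vl e d X) (vl e d t) Z'" "\<And>x. \<not> (x \<epsilon> Z \<and> x \<epsilon> Z')"
  then have "\<exists>u c. clopen (vl e d X) (vl e d t) u \<and> sub Z u \<and>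
      (\<forall>x. x \<epsilon> c \<longleftrightarrow> x \<epsilon> vl e d X \<and> \<not> x \<epsilon> Z') \<and> sub u c"
    by (intro sep[rule_format] conjI) simp_all
  then show "\<exists>u. clopen (vl e d X) (vl e d t) u \<and> sub Z u \<and> (\<forall>x. x \<epsilon> u \<longrightarrow> \<not> x \<epsilon> Z')"
    by (elim exE conjE) (simp only: sub_def, blast)
next
  have "holds e d (is_topology X t) \<longleftrightarrow> (\<forall>u. u \<epsilon> vl e d t \<longrightarrow> sub u (vl e d X)) \<and> emp \<epsilon> vl e d t \<and> vl e d X \<epsilon> vl e d t \<and>
      (\<forall>a. sub a (vl e d t) \<longrightarrow> bigU a \<epsilon> vl e d t) \<and>
      (\<forall>u v w. u \<epsilon> vl e d t \<and> v \<epsilon> vl e d t \<and> (\<forall>x. x \<epsilon> w \<longleftrightarrow> x \<epsilon> u \<and> x \<epsilon> v) \<longrightarrow> w \<epsilon> vl e d t)"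
    using assms(3,4) by (simp add: is_topology_def sat_form)
  moreover have "holds e d (is_topology X t)"
    using szd unfolding is_strongly_zero_dim_def is_completely_regular_def sat_form(5) by blast
  ultimately have top: "(\<forall>u. u \<epsilon> vl e d t \<longrightarrow> sub u (vl e d X))" "emp \<epsilon> vl e d t" "vl e d X \<epsilon> vl e d t"
      "\<forall>a. sub a (vl e d t) \<longrightarrow> bigU a \<epsilon> vl e d t"
      "\<forall>u v w. u \<epsilon> vl e d t \<and> v \<epsilon> vl e d t \<and> (\<forall>x. x \<epsilon> w \<longleftrightarrow> x \<epsilon> u \<and> x \<epsilon> v) \<longrightarrow> w \<epsilon> vl e d t"
    by blast+
  show "\<And>u. u \<epsilon> vl e d t \<Longrightarrow> sub u (vl e d X)" "vl e d X \<epsilon> vl e d t" "emp \<epsilon> vl e d t"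
    "\<And>a. sub a (vl e d t) \<Longrightarrow> bigU a \<epsilon> vl e d t"
    using top(1-4) by blast+
  fix u v w
  assume "u \<epsilon> vl e d t" "v \<epsilon> vl e d t" "\<And>x. x \<epsilon> w \<longleftrightarrow> x \<epsilon> u \<and> x \<epsilon> v"
  then have "u \<epsilon> vl e d t \<and> v \<epsilon> vl e d t \<and> (\<forall>x. x \<epsilon> w \<longleftrightarrow> x \<epsilon> u \<and> x \<epsilon> v)" by blast
  then show "w \<epsilon> vl e d t" by (rule top(5)[rule_format])
qed

end


section \<open>Strongly zero-dimensional spaces\<close>

text \<open>The hypotheses translated out of the object language; \<open>multiple_choice\<close> is
  CMC for the index set \<open>omega\<close>.\<close>

locale zf_space = zf_reals E R P L \<iota>
  for E :: "'m \<Rightarrow> 'm \<Rightarrow> bool"  (infix "\<epsilon>" 50) and R P L :: 'm and \<iota> :: "'r :: linordered_field \<Rightarrow> 'm" +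
  fixes X t :: 'm
  assumes open_sub: "u \<epsilon> t \<Longrightarrow> sub u X"
    and open_X: "X \<epsilon> t" and open_emp: "emp \<epsilon> t"
    and open_Union: "sub a t \<Longrightarrow> bigU a \<epsilon> t"
    and open_inter: "u \<epsilon> t \<Longrightarrow> v \<epsilon> t \<Longrightarrow> (\<And>x. x \<epsilon> w \<longleftrightarrow> x \<epsilon> u \<and> x \<epsilon> v) \<Longrightarrow> w \<epsilon> t"
    and separated: "zero_set X t Z \<Longrightarrow> zero_set X t Z' \<Longrightarrow> (\<And>x. \<not> (x \<epsilon> Z \<and> x \<epsilon> Z')) \<Longrightarrow>
      \<exists>u. clopen X t u \<and> sub Z u \<and> (\<forall>x. x \<epsilon> u \<longrightarrow> \<not> x \<epsilon> Z')"
    and multiple_choice: "isfun A omega \<Longrightarrow> (\<And>j B. pair j B \<epsilon> A \<Longrightarrow> B \<noteq> emp) \<Longrightarrow>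
      \<exists>g. isfun g omega \<and> (\<forall>j F B. pair j F \<epsilon> g \<and> pair j B \<epsilon> A \<longrightarrow> sub F B \<and> F \<noteq> emp \<and> fin F)"
begin

definition val :: "'m \<Rightarrow> 'm \<Rightarrow> 'r" where
  "val f x = \<rho> (app f x)"

definition compl :: "'m \<Rightarrow> 'm" where
  "compl u = sep X (\<lambda>x. \<not> x \<epsilon> u)"

lemma dreal_val [dintro]: "dfun f \<Longrightarrow> dfun x \<Longrightarrow> dreal (\<lambda>e. val (f e) (x e))"
  unfolding val_def by (intro dintro)

lemma mem_compl [simp]: "x \<epsilon> compl u \<longleftrightarrow> x \<epsilon> X \<and> \<not> x \<epsilon> u"
  unfolding compl_def by (rule mem_sep) (intro dintro)

lemma dfun_compl [dintro]: "dfun u \<Longrightarrow> dfun (\<lambda>e. compl (u e))"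
  by (rule dfun_comp1) (unfold compl_def, intro dintro)

section \<open>The Boolean algebra of clopen sets\<close>

lemma clopen_iff: "clopen X t u \<longleftrightarrow> u \<epsilon> t \<and> compl u \<epsilon> t"
proof -
  have "c = compl u" if "\<And>x. x \<epsilon> c \<longleftrightarrow> x \<epsilon> X \<and> \<not> x \<epsilon> u" for c
    using that by (intro extensionality) simp
  then show ?thesis unfolding clopen_def by (metis mem_compl)
qed

lemma dpred_clopen [dintro]: "dfun u \<Longrightarrow> dpred (\<lambda>e. clopen X t (u e))"
  unfolding clopen_iff by (intro dintro)

lemma clopen_sub: "clopen X t u \<Longrightarrow> x \<epsilon> u \<Longrightarrow> x \<epsilon> X"
  using open_sub unfolding clopen_def sub_def by blast

lemma clopen_X: "clopen X t X"
proof -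
  have "compl X = emp" by (simp add: emp_iff)
  then show ?thesis by (simp add: clopen_iff open_X open_emp)
qed

lemma clopen_compl: "clopen X t u \<Longrightarrow> clopen X t (compl u)"
proof -
  assume u: "clopen X t u"
  then have "compl (compl u) = u" using clopen_sub[OF u] by (intro extensionality) auto
  then show ?thesis using u by (simp add: clopen_iff)
qed

lemma clopen_inter:
  assumes "clopen X t u" "clopen X t v" and w: "\<And>x. x \<epsilon> w \<longleftrightarrow> x \<epsilon> u \<and> x \<epsilon> v"
  shows "clopen X t w"
proof -
  have uv: "u \<epsilon> t" "v \<epsilon> t" "compl u \<epsilon> t" "compl v \<epsilon> t" using assms(1,2) by (auto simp: clopen_iff)
  have "w \<epsilon> t" using uv(1,2) w by (rule open_inter)
  moreover have "compl w = bigU (upair (compl u) (compl v))"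
    using w by (intro extensionality) auto
  then have "compl w \<epsilon> t" using open_Union[of "upair (compl u) (compl v)"] uv(3,4) by (simp add: sub_def)
  ultimately show ?thesis by (simp add: clopen_iff)
qed

text \<open>Finiteness is that of the model, so the induction is \<open>fin_induct\<close> on a
  definable statement. Intersecting within \<open>X\<close> gives the empty family the intersection
  \<open>X\<close>.\<close>

lemma clopen_finite_Inter:
  assumes "fin F" and "\<And>v. v \<epsilon> F \<Longrightarrow> clopen X t v"
  shows "clopen X t (sep X (\<lambda>x. \<forall>v. v \<epsilon> F \<longrightarrow> x \<epsilon> v))"
proof -
  let ?I = "\<lambda>F. sep X (\<lambda>x. \<forall>v. v \<epsilon> F \<longrightarrow> x \<epsilon> v)"
  have mem: "x \<epsilon> ?I F \<longleftrightarrow> x \<epsilon> X \<and> (\<forall>v. v \<epsilon> F \<longrightarrow> x \<epsilon> v)" for x F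
    by (rule mem_sep) (intro dintro)
  have "(\<forall>v. v \<epsilon> F \<longrightarrow> clopen X t v) \<longrightarrow> clopen X t (?I F)" using assms(1)
  proof (induction rule: fin_induct)
    case definable
    show ?case by (intro dintro)
  next
    case emp
    have "?I emp = X" by (rule extensionality) (unfold mem, auto)
    then show ?case using clopen_X by metis
  next
    case (adj F u)
    show ?case
    proof
      assume cl: "\<forall>v. v \<epsilon> adj F u \<longrightarrow> clopen X t v"
      then have "clopen X t (?I F)" "clopen X t u" using adj by simp_all
      then show "clopen X t (?I (adj F u))"
      proof (rule clopen_inter)
        show "x \<epsilon> ?I (adj F u) \<longleftrightarrow> x \<epsilon> ?I F \<and> x \<epsilon> u" for x unfolding mem by auto
      qed
    qed
  qed
  then show ?thesis using assms(2) by blast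
qed

section \<open>Continuous functions and zero-sets\<close>

lemma cont_isfun: "cont X t f \<Longrightarrow> isfun f X"
  by (simp add: cont_def)

lemma cont_app: "cont X t f \<Longrightarrow> x \<epsilon> X \<Longrightarrow> app f x = \<iota> (val f x)"
proof -
  assume f: "cont X t f" and x: "x \<epsilon> X"
  have "pair x (app f x) \<epsilon> f" using isfun_app_iff[OF cont_isfun[OF f]] x by simp
  then have "app f x \<epsilon> R" using f unfolding cont_def by blast
  then show ?thesis by (simp add: val_def)
qed

lemma cont_pair_iff: "cont X t f \<Longrightarrow> pair x y \<epsilon> f \<longleftrightarrow> x \<epsilon> X \<and> y = \<iota> (val f x)"
  using isfun_app_iff[OF cont_isfun, of f x y] cont_app[of f x] by auto

lemma cont_preimage:
  assumes "cont X t f" "open_real W" "\<And>x. x \<epsilon> v \<longleftrightarrow> x \<epsilon> X \<and> \<iota> (val f x) \<epsilon> W"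
  shows "v \<epsilon> t"
proof -
  have "\<forall>x. x \<epsilon> v \<longleftrightarrow> (\<exists>y. y \<epsilon> W \<and> pair x y \<epsilon> f)"
    unfolding cont_pair_iff[OF assms(1)] assms(3) by blast
  then show ?thesis using assms(1,2) unfolding cont_def by blast
qed

text \<open>For open \<open>W\<close> the preimage of \<open>W\<close> under \<open>g\<close> is
  again open, since a radius good for \<open>W\<close> at \<open>g a\<close> is good at
  \<open>a\<close>. It is moreover a set of the model, so continuity of \<open>f\<close> applies to
  it.\<close>

lemma
  assumes f: "cont X t f" and g: "dreal (\<lambda>e. g (\<rho> (e 0)))" and lip: "lipschitz g"
  shows cont_lipschitz: "cont X t (lam X (\<lambda>x. \<iota> (g (val f x))))" (is "cont X t ?h")
    and val_lipschitz: "x \<epsilon> X \<Longrightarrow> val (lam X (\<lambda>x. \<iota> (g (val f x)))) x = g (val f x)"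
proof -
  note dg = dreal_real_comp1[OF g]
  have d: "dfun (\<lambda>e. \<iota> (g (val f (e 0))))" by (intro dintro dg)
  have isfun: "isfun ?h X" by (rule isfun_lam[OF d])
  have app: "app ?h x = \<iota> (g (val f x))" if "x \<epsilon> X" for x using that by (rule app_lam[OF d])
  then have pair: "pair x y \<epsilon> ?h \<longleftrightarrow> x \<epsilon> X \<and> y = \<iota> (g (val f x))" for x y
    unfolding isfun_app_iff[OF isfun] by auto
  show "cont X t ?h"
    unfolding cont_def
  proof (intro conjI allI impI)
    fix W v
    assume Wv: "open_real W \<and> (\<forall>x. x \<epsilon> v \<longleftrightarrow> (\<exists>y. y \<epsilon> W \<and> pair x y \<epsilon> ?h))"
    let ?W = "sep R (\<lambda>y. \<iota> (g (\<rho> y)) \<epsilon> W)"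
    have mem: "y \<epsilon> ?W \<longleftrightarrow> y \<epsilon> R \<and> \<iota> (g (\<rho> y)) \<epsilon> W" for y
      by (rule mem_sep) (intro dintro dg)
    have "open_real ?W"
      unfolding open_real_def
    proof (intro conjI allI impI)
      fix a
      assume "\<iota> a \<epsilon> ?W"
      then have "\<iota> (g a) \<epsilon> W" by (simp add: mem)
      then obtain \<delta> where \<delta>: "\<delta> > 0" "\<forall>b. \<bar>g a - b\<bar> < \<delta> \<longrightarrow> \<iota> b \<epsilon> W"
        using Wv unfolding open_real_def by blast
      have "\<iota> b \<epsilon> ?W" if "\<bar>a - b\<bar> < \<delta>" for b
      proof -
        have "\<bar>g a - g b\<bar> < \<delta>" using lip that unfolding lipschitz_def by (meson le_less_trans)
        then show ?thesis using \<delta>(2) by (simp add: mem)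
      qed
      then show "\<exists>\<delta>>0. \<forall>b. \<bar>a - b\<bar> < \<delta> \<longrightarrow> \<iota> b \<epsilon> ?W" using \<delta>(1) by blast
    qed (simp add: mem)
    moreover have "x \<epsilon> v \<longleftrightarrow> x \<epsilon> X \<and> \<iota> (val f x) \<epsilon> ?W" for x
      using Wv by (auto simp: pair mem)
    ultimately show "v \<epsilon> t" by (rule cont_preimage[OF f])
  qed (auto simp: isfun pair)
  show "x \<epsilon> X \<Longrightarrow> val ?h x = g (val f x)" by (simp add: val_def[of ?h] app)
qed

lemma zero_set_preimage:
  assumes f: "cont X t f" and K: "dpred (\<lambda>e. K (\<rho> (e 0)))" and closed: "closed_pred K"
  shows "zero_set X t (sep X (\<lambda>x. K (val f x)))"
proof -
  obtain g where g: "dreal (\<lambda>e. g (\<rho> (e 0)))" "lipschitz g" "\<And>a. g a = 0 \<longleftrightarrow> K a"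
    using closed_pred_lipschitz[OF K closed] by blast
  let ?h = "lam X (\<lambda>x. \<iota> (g (val f x)))"
  have h: "cont X t ?h" by (rule cont_lipschitz[OF f g(1,2)])
  have mem: "x \<epsilon> sep X (\<lambda>x. K (val f x)) \<longleftrightarrow> x \<epsilon> X \<and> K (val f x)" for x
    by (rule mem_sep) (intro dintro dpred_real_comp1[OF K])
  have "x \<epsilon> sep X (\<lambda>x. K (val f x)) \<longleftrightarrow> pair x (\<iota> 0) \<epsilon> ?h" for x
    unfolding mem cont_pair_iff[OF h] using val_lipschitz[OF f g(1,2)] g(3) by (metis iota_eq_iff)
  then show ?thesis unfolding zero_set_def using h by blast
qed

text \<open>Multiple choice gives finitely many separating clopen sets for each \<open>n\<close>; their intersection is
  again one.\<close>

lemma separating_sequence: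
  assumes f: "cont X t f"
    and k: "dpred (\<lambda>e. k (e 0) (\<rho> (e 1)))" and l: "dpred (\<lambda>e. l (e 0) (\<rho> (e 1)))"
    and closed: "\<And>n. n \<epsilon> omega \<Longrightarrow> closed_pred (k n)" "\<And>n. n \<epsilon> omega \<Longrightarrow> closed_pred (l n)"
    and disjoint: "\<And>n a. n \<epsilon> omega \<Longrightarrow> \<not> (k n a \<and> l n a)"
  shows "\<exists>u. dfun (\<lambda>e. u (e 0)) \<and> (\<forall>n. n \<epsilon> omega \<longrightarrow> clopen X t (u n) \<and>
    (\<forall>x. x \<epsilon> X \<longrightarrow> (k n (val f x) \<longrightarrow> x \<epsilon> u n) \<and> (l n (val f x) \<longrightarrow> \<not> x \<epsilon> u n)))"
proof -
  note dk = dpred_real_comp2[of k, OF k] and dl = dpred_real_comp2[of l, OF l]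
  define Q where "Q n u \<longleftrightarrow> clopen X t u \<and>
    (\<forall>x. x \<epsilon> X \<longrightarrow> (k n (val f x) \<longrightarrow> x \<epsilon> u) \<and> (l n (val f x) \<longrightarrow> \<not> x \<epsilon> u))" for n u
  \<comment> \<open>All separating clopen sets are collected, so that the family exists by
    separation and replacement; strong zero-dimensionality makes its members non-empty.\<close>
  define A where "A n = sep t (Q n)" for n
  have dQ: "dfun a \<Longrightarrow> dfun b \<Longrightarrow> dpred (\<lambda>e. Q (a e) (b e))" for a b
    by (rule dpred_comp2) (unfold Q_def, intro dintro dk dl)
  have mem_A: "u \<epsilon> A n \<longleftrightarrow> u \<epsilon> t \<and> Q n u" for u n
    unfolding A_def by (rule mem_sep) (intro dintro dQ)
  have dA: "dfun (\<lambda>e. A (e 0))" unfolding A_def by (intro dintro dQ)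
  have ne: "A n \<noteq> emp" if n: "n \<epsilon> omega" for n
  proof -
    have mem: "x \<epsilon> sep X (\<lambda>x. k n (val f x)) \<longleftrightarrow> x \<epsilon> X \<and> k n (val f x)"
      "x \<epsilon> sep X (\<lambda>x. l n (val f x)) \<longleftrightarrow> x \<epsilon> X \<and> l n (val f x)" for x
      by (rule mem_sep, intro dintro dk dl)+
    have "zero_set X t (sep X (\<lambda>x. k n (val f x)))"
      by (rule zero_set_preimage[OF f _ closed(1)[OF n]]) (intro dintro dk)
    moreover have "zero_set X t (sep X (\<lambda>x. l n (val f x)))"
      by (rule zero_set_preimage[OF f _ closed(2)[OF n]]) (intro dintro dl)
    moreover have "\<not> (x \<epsilon> sep X (\<lambda>x. k n (val f x)) \<and> x \<epsilon> sep X (\<lambda>x. l n (val f x)))" for x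
      unfolding mem using disjoint[OF n] by blast
    ultimately obtain u where u: "clopen X t u" "sub (sep X (\<lambda>x. k n (val f x))) u"
      "\<forall>x. x \<epsilon> u \<longrightarrow> \<not> x \<epsilon> sep X (\<lambda>x. l n (val f x))"
      using separated by blast
    have "Q n u" using u unfolding Q_def sub_def mem by blast
    then have "u \<epsilon> A n" using u(1) mem_A by (simp add: clopen_def)
    then show ?thesis by auto
  qed
  have isfun: "isfun (lam omega A) omega" by (rule isfun_lam[OF dA])
  have pair_A: "pair n B \<epsilon> lam omega A \<longleftrightarrow> n \<epsilon> omega \<and> B = A n" for n B
    unfolding isfun_app_iff[OF isfun] using app_lam[OF dA] by auto
  have "B \<noteq> emp" if "pair j B \<epsilon> lam omega A" for j B
    using ne[of j] that unfolding pair_A by simp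
  then have "\<exists>g. isfun g omega \<and>
      (\<forall>j F B. pair j F \<epsilon> g \<and> pair j B \<epsilon> lam omega A \<longrightarrow> sub F B \<and> F \<noteq> emp \<and> fin F)"
    by (rule multiple_choice[OF isfun])
  then obtain g where g: "isfun g omega"
    "\<forall>j F B. pair j F \<epsilon> g \<and> pair j B \<epsilon> lam omega A \<longrightarrow> sub F B \<and> F \<noteq> emp \<and> fin F"
    by (elim exE conjE)
  have g': "sub (app g n) (A n) \<and> app g n \<noteq> emp \<and> fin (app g n)" if "n \<epsilon> omega" for n
    using g(2)[rule_format, of n "app g n" "A n"] that unfolding pair_A isfun_app_iff[OF g(1)] by simp
  define u where "u n = sep X (\<lambda>x. \<forall>v. v \<epsilon> app g n \<longrightarrow> x \<epsilon> v)" for n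
  have mem_u: "x \<epsilon> u n \<longleftrightarrow> x \<epsilon> X \<and> (\<forall>v. v \<epsilon> app g n \<longrightarrow> x \<epsilon> v)" for x n
    unfolding u_def by (rule mem_sep) (intro dintro)
  have "dfun (\<lambda>e. u (e 0))" unfolding u_def by (intro dintro)
  moreover have "clopen X t (u n) \<and>
      (\<forall>x. x \<epsilon> X \<longrightarrow> (k n (val f x) \<longrightarrow> x \<epsilon> u n) \<and> (l n (val f x) \<longrightarrow> \<not> x \<epsilon> u n))" if n: "n \<epsilon> omega" for n
  proof -
    have Q: "Q n v" if "v \<epsilon> app g n" for v
      using g'[OF n] that unfolding sub_def mem_A by blast
    \<comment> \<open>The clause on \<open>k\<close> holds for any intersection of separating sets,
      the empty one included. Keeping the intersection away from \<open>l\<close> requires at least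
      one member, and this is where non-emptiness of \<open>app g n\<close> enters.\<close>
    obtain v where v: "v \<epsilon> app g n" using g'[OF n] emp_iff by blast
    have "clopen X t (u n)"
      unfolding u_def by (rule clopen_finite_Inter) (use g'[OF n] Q in \<open>auto simp: Q_def\<close>)
    moreover have "x \<epsilon> u n" if "x \<epsilon> X" "k n (val f x)" for x
      unfolding mem_u using Q that unfolding Q_def by blast
    moreover have "\<not> x \<epsilon> u n" if "x \<epsilon> X" "l n (val f x)" for x
      unfolding mem_u using Q[OF v] v that unfolding Q_def by blast
    ultimately show ?thesis by blast
  qed
  ultimately show ?thesis by blast
qed

section \<open>Clopen sequences for zero-sets, open preimages and covers\<close>

lemma closed_pred_ge: "closed_pred (\<lambda>a. c \<le> \<bar>a - b\<bar>)"
  unfolding closed_pred_def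
proof (intro allI impI)
  fix a
  assume "\<not> c \<le> \<bar>a - b\<bar>"
  then have "c - \<bar>a - b\<bar> > 0" by simp
  moreover have "\<not> c \<le> \<bar>a' - b\<bar>" if "\<bar>a - a'\<bar> < c - \<bar>a - b\<bar>" for a' using that by linarith
  ultimately show "\<exists>\<delta>>0. \<forall>a'. \<bar>a - a'\<bar> < \<delta> \<longrightarrow> \<not> c \<le> \<bar>a' - b\<bar>" by blast
qed

lemma closed_pred_le: "closed_pred (\<lambda>a. \<bar>a - b\<bar> \<le> c)"
  unfolding closed_pred_def
proof (intro allI impI)
  fix a
  assume "\<not> \<bar>a - b\<bar> \<le> c"
  then have "\<bar>a - b\<bar> - c > 0" by simp
  moreover have "\<not> \<bar>a' - b\<bar> \<le> c" if "\<bar>a - a'\<bar> < \<bar>a - b\<bar> - c" for a' using that by linarith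
  ultimately show "\<exists>\<delta>>0. \<forall>a'. \<bar>a - a'\<bar> < \<delta> \<longrightarrow> \<not> \<bar>a' - b\<bar> \<le> c" by blast
qed

lemma zero_set_clopen_sequence:
  assumes f: "cont X t f"
  shows "\<exists>u. dfun (\<lambda>e. u (e 0)) \<and> (\<forall>n. n \<epsilon> omega \<longrightarrow> clopen X t (u n)) \<and>
    (\<forall>x. x \<epsilon> X \<longrightarrow> (val f x = 0 \<longleftrightarrow> (\<forall>n. n \<epsilon> omega \<longrightarrow> x \<epsilon> u n)))"
proof -
  obtain c where c: "dreal (\<lambda>e. c (e 0))" "\<And>n. n \<epsilon> omega \<Longrightarrow> 0 < c n"
    "\<And>a. a > 0 \<Longrightarrow> \<exists>n. n \<epsilon> omega \<and> c n < a"
    using ex_null_sequence by blast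
  \<comment> \<open>The set {0} is written as a closed ball of radius 0, so that the two lemmas on
    closed predicates cover both cases. Disjointness is the positivity of
    \<open>c n\<close>.\<close>
  let ?k = "\<lambda>n a. \<bar>a - 0\<bar> \<le> 0" and ?l = "\<lambda>n a. c n \<le> \<bar>a - 0\<bar>"
  have "\<exists>u. dfun (\<lambda>e. u (e 0)) \<and> (\<forall>n. n \<epsilon> omega \<longrightarrow> clopen X t (u n) \<and>
    (\<forall>x. x \<epsilon> X \<longrightarrow> (?k n (val f x) \<longrightarrow> x \<epsilon> u n) \<and> (?l n (val f x) \<longrightarrow> \<not> x \<epsilon> u n)))"
  proof (rule separating_sequence[OF f])
    show "dpred (\<lambda>e. ?k (e 0) (\<rho> (e 1)))" "dpred (\<lambda>e. ?l (e 0) (\<rho> (e 1)))"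
      by (intro dintro dreal_comp1[OF c(1)])+
    show "\<not> (?k n a \<and> ?l n a)" if "n \<epsilon> omega" for n a using c(2)[OF that] by auto
  qed (rule closed_pred_ge closed_pred_le)+
  then obtain u where u: "dfun (\<lambda>e. u (e 0))" "\<And>n. n \<epsilon> omega \<Longrightarrow> clopen X t (u n)"
    "\<And>n x. n \<epsilon> omega \<Longrightarrow> x \<epsilon> X \<Longrightarrow> ?k n (val f x) \<Longrightarrow> x \<epsilon> u n"
    "\<And>n x. n \<epsilon> omega \<Longrightarrow> x \<epsilon> X \<Longrightarrow> ?l n (val f x) \<Longrightarrow> \<not> x \<epsilon> u n"
    by blast
  have "val f x = 0 \<longleftrightarrow> (\<forall>n. n \<epsilon> omega \<longrightarrow> x \<epsilon> u n)" if x: "x \<epsilon> X" for x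
  proof
    assume "val f x = 0"
    then show "\<forall>n. n \<epsilon> omega \<longrightarrow> x \<epsilon> u n" using u(3) x by simp
  next
    assume all: "\<forall>n. n \<epsilon> omega \<longrightarrow> x \<epsilon> u n"
    show "val f x = 0"
    proof (rule ccontr)
      assume "val f x \<noteq> 0"
      then obtain n where "n \<epsilon> omega" "c n < \<bar>val f x\<bar>" using c(3)[of "\<bar>val f x\<bar>"] by auto
      then show False using u(4)[of n x] x all by simp
    qed
  qed
  then show ?thesis using u(1,2) by blast
qed

theorem zero_set_countable_Inter:
  assumes "zero_set X t Z"
  shows "\<exists>U. ctb U \<and> (\<forall>u. u \<epsilon> U \<longrightarrow> clopen X t u) \<and> U \<noteq> emp \<and>
    (\<forall>x. x \<epsilon> Z \<longleftrightarrow> (\<forall>u. u \<epsilon> U \<longrightarrow> x \<epsilon> u))"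
proof -
  obtain f where f: "cont X t f" and Z: "\<And>x. x \<epsilon> Z \<longleftrightarrow> pair x (\<iota> 0) \<epsilon> f"
    using assms unfolding zero_set_def by blast
  obtain u where u: "dfun (\<lambda>e. u (e 0))" "\<And>n. n \<epsilon> omega \<Longrightarrow> clopen X t (u n)"
    "\<And>x. x \<epsilon> X \<Longrightarrow> val f x = 0 \<longleftrightarrow> (\<forall>n. n \<epsilon> omega \<longrightarrow> x \<epsilon> u n)"
    using zero_set_clopen_sequence[OF f] by blast
  have mem: "v \<epsilon> img u omega \<longleftrightarrow> (\<exists>n. n \<epsilon> omega \<and> v = u n)" for v by (rule mem_img[OF u(1)])
  have "x \<epsilon> Z \<longleftrightarrow> (\<forall>v. v \<epsilon> img u omega \<longrightarrow> x \<epsilon> v)" for x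
  proof (cases "x \<epsilon> X")
    case True
    then show ?thesis unfolding Z cont_pair_iff[OF f] mem using u(3)[of x] by auto
  next
    case False
    \<comment> \<open>The index \<open>emp\<close> guarantees a member of the family contained in
      \<open>X\<close>, so points outside \<open>X\<close> drop out of the intersection.\<close>
    then have "\<not> x \<epsilon> u emp" using clopen_sub[OF u(2)[OF emp_omega]] by blast
    then show ?thesis unfolding Z cont_pair_iff[OF f] mem using False emp_omega by blast
  qed
  moreover have "u emp \<epsilon> img u omega" unfolding mem using emp_omega by blast
  then have "img u omega \<noteq> emp" by auto
  moreover have "\<forall>v. v \<epsilon> img u omega \<longrightarrow> clopen X t v" unfolding mem using u(2) by blast
  ultimately show ?thesis using ctb_img_omega[OF u(1)] by blast
qed

text \<open>The complement of \<open>W\<close> is closed, so \<open>v\<close> is the co-zero set of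
  \<open>f\<close> followed by the distance to that complement; the complements of the clopen sets
  shrinking to the zero-set exhaust it.\<close>

theorem preimage_countable_Union:
  assumes f: "cont X t f" and W: "open_real W" and v: "\<And>x. x \<epsilon> v \<longleftrightarrow> (\<exists>y. y \<epsilon> W \<and> pair x y \<epsilon> f)"
  shows "\<exists>U. ctb U \<and> (\<forall>u. u \<epsilon> U \<longrightarrow> clopen X t u) \<and> v = bigU U"
proof -
  let ?K = "\<lambda>a. \<not> \<iota> a \<epsilon> W"
  have "dpred (\<lambda>e. ?K (\<rho> (e 0)))" by (intro dintro)
  moreover have "closed_pred ?K" using W unfolding closed_pred_def open_real_def by simp
  ultimately obtain g where g: "dreal (\<lambda>e. g (\<rho> (e 0)))" "lipschitz g" "\<And>a. g a = 0 \<longleftrightarrow> ?K a"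
    using closed_pred_lipschitz[of ?K] by blast
  let ?h = "lam X (\<lambda>x. \<iota> (g (val f x)))"
  have h: "cont X t ?h" by (rule cont_lipschitz[OF f g(1,2)])
  obtain u where u: "dfun (\<lambda>e. u (e 0))" "\<And>n. n \<epsilon> omega \<Longrightarrow> clopen X t (u n)"
    "\<And>x. x \<epsilon> X \<Longrightarrow> val ?h x = 0 \<longleftrightarrow> (\<forall>n. n \<epsilon> omega \<longrightarrow> x \<epsilon> u n)"
    using zero_set_clopen_sequence[OF h] by blast
  have d: "dfun (\<lambda>e. compl (u (e 0)))" by (intro dintro u(1))
  have mem: "w \<epsilon> img (\<lambda>n. compl (u n)) omega \<longleftrightarrow> (\<exists>n. n \<epsilon> omega \<and> w = compl (u n))" for w
    by (rule mem_img[OF d])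
  have iff: "\<iota> (val f x) \<epsilon> W \<longleftrightarrow> (\<exists>n. n \<epsilon> omega \<and> \<not> x \<epsilon> u n)" if "x \<epsilon> X" for x
    using u(3)[OF that] g(3)[of "val f x"] unfolding val_lipschitz[OF f g(1,2) that] by blast
  have "v = bigU (img (\<lambda>n. compl (u n)) omega)"
  proof (rule extensionality)
    fix x
    have "x \<epsilon> v \<longleftrightarrow> x \<epsilon> X \<and> \<iota> (val f x) \<epsilon> W" unfolding v cont_pair_iff[OF f] by blast
    also have "\<dots> \<longleftrightarrow> x \<epsilon> X \<and> (\<exists>n. n \<epsilon> omega \<and> \<not> x \<epsilon> u n)" using iff by blast
    also have "\<dots> \<longleftrightarrow> (\<exists>n. n \<epsilon> omega \<and> x \<epsilon> compl (u n))" unfolding mem_compl by blast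
    also have "\<dots> \<longleftrightarrow> x \<epsilon> bigU (img (\<lambda>n. compl (u n)) omega)" unfolding mem_bigU mem by blast
    finally show "x \<epsilon> v \<longleftrightarrow> x \<epsilon> bigU (img (\<lambda>n. compl (u n)) omega)" .
  qed
  moreover have "\<forall>w. w \<epsilon> img (\<lambda>n. compl (u n)) omega \<longrightarrow> clopen X t w"
    unfolding mem using u(2) clopen_compl by blast
  ultimately show ?thesis using ctb_img_omega[OF d] by blast
qed

lemma osc_le_iff:
  assumes f: "cont X t f" and a: "\<And>x. x \<epsilon> a \<Longrightarrow> x \<epsilon> X"
  shows "osc_le s f a \<longleftrightarrow>
    (\<exists>b. s = \<iota> b \<and> 0 \<le> b \<and> (\<forall>x y. x \<epsilon> a \<and> y \<epsilon> a \<longrightarrow> \<bar>val f x - val f y\<bar> \<le> b))"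
  unfolding osc_le_def rle_iota cont_pair_iff[OF f] using a by auto

lemma ex_oscillation:
  assumes f: "cont X t f" and a: "\<And>x. x \<epsilon> a \<Longrightarrow> x \<epsilon> X" and "0 \<le> \<eta>"
    and bound: "\<And>x y. x \<epsilon> a \<Longrightarrow> y \<epsilon> a \<Longrightarrow> \<bar>val f x - val f y\<bar> \<le> \<eta>"
  shows "\<exists>s. (osc_le s f a \<and> (\<forall>s'. osc_le s' f a \<longrightarrow> rle s s')) \<and> rle s (\<iota> \<eta>)"
proof -
  have iff: "osc_le s f a \<longleftrightarrow>
      (\<exists>b. s = \<iota> b \<and> 0 \<le> b \<and> (\<forall>x y. x \<epsilon> a \<and> y \<epsilon> a \<longrightarrow> \<bar>val f x - val f y\<bar> \<le> b))" for s
    by (rule osc_le_iff[OF f]) (rule a)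
  \<comment> \<open>Adjoining 0 changes no supremum of distances between points and makes it 0 for
    empty \<open>a\<close>, in accordance with \<open>is_osc\<close>.\<close>
  let ?D = "\<lambda>b. b = 0 \<or> (\<exists>x y. x \<epsilon> a \<and> y \<epsilon> a \<and> b = \<bar>val f x - val f y\<bar>)"
  have bound': "b \<le> \<eta>" if "?D b" for b using that bound \<open>0 \<le> \<eta>\<close> by auto
  have "\<exists>s. lub ?D s"
  proof (rule ex_lub[OF _ _ bound'])
    show "dpred (\<lambda>e. ?D (\<rho> (e 0)))" by (intro dintro)
    show "?D 0" by simp
  qed
  then obtain s where upper: "\<And>b. ?D b \<Longrightarrow> b \<le> s" and least: "\<And>c. (\<And>b. ?D b \<Longrightarrow> b \<le> c) \<Longrightarrow> s \<le> c"
    unfolding lub_def by blast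
  have "0 \<le> s" "\<And>x y. x \<epsilon> a \<Longrightarrow> y \<epsilon> a \<Longrightarrow> \<bar>val f x - val f y\<bar> \<le> s" using upper by blast+
  then have "osc_le (\<iota> s) f a" unfolding iff by blast
  moreover have "rle (\<iota> s) s'" if s': "osc_le s' f a" for s'
  proof -
    obtain b where b: "s' = \<iota> b" "0 \<le> b" "\<And>x y. x \<epsilon> a \<Longrightarrow> y \<epsilon> a \<Longrightarrow> \<bar>val f x - val f y\<bar> \<le> b"
      using s' unfolding iff by blast
    have "s \<le> b" by (rule least) (use b(2,3) in auto)
    then show ?thesis unfolding rle_iota using b(1) by blast
  qed
  moreover have "rle (\<iota> s) (\<iota> \<eta>)" unfolding rle_iota using least[OF bound'] by blast
  ultimately show ?thesis by blast
qed

theorem small_oscillation_cover: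
  assumes f: "cont X t f" and "\<eta> > 0"
  shows "\<exists>U. ctb U \<and> (\<forall>u. u \<epsilon> U \<longrightarrow> clopen X t u) \<and> X = bigU U \<and>
      (\<forall>a. a \<epsilon> U \<longrightarrow> (\<exists>s. (osc_le s f a \<and> (\<forall>s'. osc_le s' f a \<longrightarrow> rle s s')) \<and> rle s (\<iota> \<eta>)))"
proof -
  have "\<eta> / 4 > 0" using \<open>\<eta> > 0\<close> by simp
  then obtain c where c: "dreal (\<lambda>e. c (e 0))" "\<And>a. \<exists>n. n \<epsilon> omega \<and> \<bar>a - c n\<bar> \<le> \<eta> / 4"
    using ex_cofinal_sequence by blast
  \<comment> \<open>Every value is within \<open>\<eta> / 4\<close> of some \<open>c n\<close>, so
    the clopen sets cover \<open>X\<close>; each of them keeps the values within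
    \<open>\<eta> / 2\<close> of \<open>c n\<close>, so any two differ by less than
    \<open>\<eta>\<close>. The gap between the two radii gives disjointness.\<close>
  let ?k = "\<lambda>n a. \<bar>a - c n\<bar> \<le> \<eta> / 4" and ?l = "\<lambda>n a. \<eta> / 2 \<le> \<bar>a - c n\<bar>"
  have "\<exists>u. dfun (\<lambda>e. u (e 0)) \<and> (\<forall>n. n \<epsilon> omega \<longrightarrow> clopen X t (u n) \<and>
    (\<forall>x. x \<epsilon> X \<longrightarrow> (?k n (val f x) \<longrightarrow> x \<epsilon> u n) \<and> (?l n (val f x) \<longrightarrow> \<not> x \<epsilon> u n)))"
  proof (rule separating_sequence[OF f])
    show "dpred (\<lambda>e. ?k (e 0) (\<rho> (e 1)))" "dpred (\<lambda>e. ?l (e 0) (\<rho> (e 1)))"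
      by (intro dintro dreal_comp1[OF c(1)])+
    show "\<not> (?k n a \<and> ?l n a)" for n a using \<open>\<eta> > 0\<close> by auto
  qed (rule closed_pred_ge closed_pred_le)+
  then obtain u where u: "dfun (\<lambda>e. u (e 0))" "\<And>n. n \<epsilon> omega \<Longrightarrow> clopen X t (u n)"
    "\<And>n x. n \<epsilon> omega \<Longrightarrow> x \<epsilon> X \<Longrightarrow> ?k n (val f x) \<Longrightarrow> x \<epsilon> u n"
    "\<And>n x. n \<epsilon> omega \<Longrightarrow> x \<epsilon> X \<Longrightarrow> ?l n (val f x) \<Longrightarrow> \<not> x \<epsilon> u n"
    by blast
  have mem: "v \<epsilon> img u omega \<longleftrightarrow> (\<exists>n. n \<epsilon> omega \<and> v = u n)" for v by (rule mem_img[OF u(1)])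
  have "X = bigU (img u omega)"
  proof (rule extensionality)
    fix x
    show "x \<epsilon> X \<longleftrightarrow> x \<epsilon> bigU (img u omega)"
    proof
      assume x: "x \<epsilon> X"
      obtain n where "n \<epsilon> omega" "\<bar>val f x - c n\<bar> \<le> \<eta> / 4" using c(2) by blast
      then have "x \<epsilon> u n" using u(3) x by blast
      then show "x \<epsilon> bigU (img u omega)" unfolding mem_bigU mem using \<open>n \<epsilon> omega\<close> by blast
    next
      assume "x \<epsilon> bigU (img u omega)"
      then show "x \<epsilon> X" unfolding mem_bigU mem using clopen_sub[OF u(2)] by blast
    qed
  qed
  moreover have "\<exists>s. (osc_le s f (u n) \<and> (\<forall>s'. osc_le s' f (u n) \<longrightarrow> rle s s')) \<and> rle s (\<iota> \<eta>)"
    if n: "n \<epsilon> omega" for n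
  proof (rule ex_oscillation[OF f])
    show X: "x \<epsilon> u n \<Longrightarrow> x \<epsilon> X" for x by (rule clopen_sub[OF u(2)[OF n]])
    fix x y
    assume xy: "x \<epsilon> u n" "y \<epsilon> u n"
    have "\<bar>val f x - c n\<bar> < \<eta> / 2" "\<bar>val f y - c n\<bar> < \<eta> / 2"
      using u(4)[OF n X] xy by (meson not_less)+
    then show "\<bar>val f x - val f y\<bar> \<le> \<eta>" by linarith
  qed (use \<open>\<eta> > 0\<close> in simp)
  moreover have "\<forall>v. v \<epsilon> img u omega \<longrightarrow> clopen X t v" unfolding mem using u(2) by blast
  ultimately show ?thesis
    using ctb_img_omega[OF u(1)] unfolding mem by (intro exI[of _ "img u omega"]) (auto simp: mem)
qed

end


section \<open>The real field of a model as a type\<close>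

text \<open>An ordered field on a carrier set with operations of HOL mediates between the graphs
  that the model provides and the type class needed for arithmetic.\<close>

locale ordered_field_on =
  fixes C :: "'a set" and pl tm :: "'a \<Rightarrow> 'a \<Rightarrow> 'a" and ls :: "'a \<Rightarrow> 'a \<Rightarrow> bool" and ze on :: 'a
  assumes zero_mem: "ze \<in> C" and one_mem: "on \<in> C" and zero_neq_one: "ze \<noteq> on"
    and add_mem: "x \<in> C \<Longrightarrow> y \<in> C \<Longrightarrow> pl x y \<in> C"
    and mul_mem: "x \<in> C \<Longrightarrow> y \<in> C \<Longrightarrow> tm x y \<in> C"
    and add_commute: "x \<in> C \<Longrightarrow> y \<in> C \<Longrightarrow> pl x y = pl y x"
    and mul_commute: "x \<in> C \<Longrightarrow> y \<in> C \<Longrightarrow> tm x y = tm y x"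
    and add_assoc: "x \<in> C \<Longrightarrow> y \<in> C \<Longrightarrow> w \<in> C \<Longrightarrow> pl (pl x y) w = pl x (pl y w)"
    and mul_assoc: "x \<in> C \<Longrightarrow> y \<in> C \<Longrightarrow> w \<in> C \<Longrightarrow> tm (tm x y) w = tm x (tm y w)"
    and distrib: "x \<in> C \<Longrightarrow> y \<in> C \<Longrightarrow> w \<in> C \<Longrightarrow> tm (pl x y) w = pl (tm x w) (tm y w)"
    and add_zero: "x \<in> C \<Longrightarrow> pl x ze = x"
    and mul_one: "x \<in> C \<Longrightarrow> tm x on = x"
    and add_inverse: "x \<in> C \<Longrightarrow> \<exists>y\<in>C. pl x y = ze"
    and mul_inverse: "x \<in> C \<Longrightarrow> x \<noteq> ze \<Longrightarrow> \<exists>y\<in>C. tm x y = on"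
    and less_irrefl: "x \<in> C \<Longrightarrow> \<not> ls x x"
    and less_trans: "x \<in> C \<Longrightarrow> y \<in> C \<Longrightarrow> w \<in> C \<Longrightarrow> ls x y \<Longrightarrow> ls y w \<Longrightarrow> ls x w"
    and less_linear: "x \<in> C \<Longrightarrow> y \<in> C \<Longrightarrow> ls x y \<or> x = y \<or> ls y x"
    and add_less_mono: "x \<in> C \<Longrightarrow> y \<in> C \<Longrightarrow> w \<in> C \<Longrightarrow> ls x y \<Longrightarrow> ls (pl x w) (pl y w)"
    and mul_pos: "x \<in> C \<Longrightarrow> y \<in> C \<Longrightarrow> ls ze x \<Longrightarrow> ls ze y \<Longrightarrow> ls ze (tm x y)"

section \<open>From the graphs of the model to operations\<close>

context zf_model
begin

definition is_field_of :: "'m \<Rightarrow> 'm \<Rightarrow> 'm \<Rightarrow> 'm \<Rightarrow> 'm \<Rightarrow> bool" where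
  "is_field_of R P T z i \<longleftrightarrow>
     ((isfun P (times R R) \<and> (\<forall>x y. pair x y \<epsilon> P \<longrightarrow> y \<epsilon> R)) \<and>
      isfun T (times R R) \<and> (\<forall>x y. pair x y \<epsilon> T \<longrightarrow> y \<epsilon> R)) \<and>
     z \<epsilon> R \<and> i \<epsilon> R \<and> z \<noteq> i \<and>
     (\<forall>a b c. pair (pair a b) c \<epsilon> P \<longrightarrow> pair (pair b a) c \<epsilon> P) \<and>
     (\<forall>a b c. pair (pair a b) c \<epsilon> T \<longrightarrow> pair (pair b a) c \<epsilon> T) \<and>
     (\<forall>a b c u v w. pair (pair a b) u \<epsilon> P \<and> pair (pair b c) v \<epsilon> P \<longrightarrow>
       (pair (pair u c) w \<epsilon> P \<longleftrightarrow> pair (pair a v) w \<epsilon> P)) \<and>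
     (\<forall>a b c u v w. pair (pair a b) u \<epsilon> T \<and> pair (pair b c) v \<epsilon> T \<longrightarrow>
       (pair (pair u c) w \<epsilon> T \<longleftrightarrow> pair (pair a v) w \<epsilon> T)) \<and>
     (\<forall>a b c s u v w. pair (pair a b) s \<epsilon> P \<and> pair (pair a c) u \<epsilon> T \<and> pair (pair b c) v \<epsilon> T \<longrightarrow>
       (pair (pair s c) w \<epsilon> T \<longleftrightarrow> pair (pair u v) w \<epsilon> P)) \<and>
     (\<forall>a. a \<epsilon> R \<longrightarrow> pair (pair a z) a \<epsilon> P \<and> pair (pair a i) a \<epsilon> T) \<and>
     (\<forall>a. a \<epsilon> R \<longrightarrow> (\<exists>b. pair (pair a b) z \<epsilon> P)) \<and>
     (\<forall>a. a \<epsilon> R \<and> a \<noteq> z \<longrightarrow> (\<exists>b. pair (pair a b) i \<epsilon> T))"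

definition is_ordered_field_of :: "'m \<Rightarrow> 'm \<Rightarrow> 'm \<Rightarrow> 'm \<Rightarrow> 'm \<Rightarrow> 'm \<Rightarrow> bool" where
  "is_ordered_field_of R P T L z i \<longleftrightarrow>
     is_field_of R P T z i \<and> sub L (times R R) \<and>
     (\<forall>a. \<not> pair a a \<epsilon> L) \<and>
     (\<forall>a b c. pair a b \<epsilon> L \<and> pair b c \<epsilon> L \<longrightarrow> pair a c \<epsilon> L) \<and>
     (\<forall>a b. a \<epsilon> R \<and> b \<epsilon> R \<longrightarrow> pair a b \<epsilon> L \<or> a = b \<or> pair b a \<epsilon> L) \<and>
     (\<forall>a b c u v. pair a b \<epsilon> L \<and> pair (pair a c) u \<epsilon> P \<and> pair (pair b c) v \<epsilon> P \<longrightarrow> pair u v \<epsilon> L) \<and>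
     (\<forall>a b c. pair z a \<epsilon> L \<and> pair z b \<epsilon> L \<and> pair (pair a b) c \<epsilon> T \<longrightarrow> pair z c \<epsilon> L)"

definition is_complete_in :: "'m \<Rightarrow> 'm \<Rightarrow> bool" where
  "is_complete_in R L \<longleftrightarrow>
     (\<forall>s. sub s R \<and> s \<noteq> emp \<and> (\<exists>b. b \<epsilon> R \<and> (\<forall>x. x \<epsilon> s \<longrightarrow> pair x b \<epsilon> L \<or> x = b)) \<longrightarrow>
       (\<exists>b. (b \<epsilon> R \<and> (\<forall>x. x \<epsilon> s \<longrightarrow> pair x b \<epsilon> L \<or> x = b)) \<and>
         (\<forall>c. c \<epsilon> R \<and> (\<forall>x. x \<epsilon> s \<longrightarrow> pair x c \<epsilon> L \<or> x = c) \<longrightarrow> pair b c \<epsilon> L \<or> b = c)))"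

lemma sat_real_field:
  assumes "car S < d" "add S < d" "mul S < d" "lt S < d" "r_zero S < d" "r_one S < d"
  shows "holds e d (is_real_field S) \<longleftrightarrow>
    is_ordered_field_of (vl e d (car S)) (vl e d (add S)) (vl e d (mul S)) (vl e d (lt S))
      (vl e d (r_zero S)) (vl e d (r_one S)) \<and> is_complete_in (vl e d (car S)) (vl e d (lt S))"
proof -
  have "holds e d (is_field S) \<longleftrightarrow> is_field_of (vl e d (car S)) (vl e d (add S)) (vl e d (mul S))
      (vl e d (r_zero S)) (vl e d (r_one S))"
    using assms by (simp add: is_field_def is_field_of_def sat_form r_sum_def r_prod_def)
  then have "holds e d (is_ordered_field S) \<longleftrightarrow>
      is_ordered_field_of (vl e d (car S)) (vl e d (add S)) (vl e d (mul S)) (vl e d (lt S))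
        (vl e d (r_zero S)) (vl e d (r_one S))"
    using assms by (simp add: is_ordered_field_def is_ordered_field_of_def sat_form r_sum_def
        r_prod_def r_less_def)
  then show ?thesis
    using assms by (simp add: is_real_field_def is_complete_in_def sat_form is_upper_bound_def
        r_le_def r_less_def)
qed

lemma binary_op_iff:
  assumes "isfun P (times R R)"
  shows "pair (pair a b) c \<epsilon> P \<longleftrightarrow> a \<epsilon> R \<and> b \<epsilon> R \<and> c = app P (pair a b)"
  unfolding isfun_app_iff[OF assms] mem_times pair_eq_iff by blast

lemma ordered_field_on_model:
  assumes "is_ordered_field_of R P T L z i"
  shows "ordered_field_on {x. x \<epsilon> R} (\<lambda>x y. app P (pair x y)) (\<lambda>x y. app T (pair x y))
    (\<lambda>x y. pair x y \<epsilon> L) z i"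
proof -
  note o1 = assms[unfolded is_ordered_field_of_def]
  note o2 = o1[THEN conjunct2, THEN conjunct2]
  note o3 = o2[THEN conjunct2] note o4 = o3[THEN conjunct2] note o5 = o4[THEN conjunct2]
  note f0 = o1[THEN conjunct1, unfolded is_field_of_def]
  note f1 = f0[THEN conjunct2] note f2 = f1[THEN conjunct2] note f3 = f2[THEN conjunct2]
  note f4 = f3[THEN conjunct2] note f5 = f4[THEN conjunct2] note f6 = f5[THEN conjunct2]
  note f7 = f6[THEN conjunct2] note f8 = f7[THEN conjunct2] note f9 = f8[THEN conjunct2]
  note f10 = f9[THEN conjunct2]
  note P = f0[THEN conjunct1, THEN conjunct1, THEN conjunct1]
    and P_mem = f0[THEN conjunct1, THEN conjunct1, THEN conjunct2, rule_format]
    and T = f0[THEN conjunct1, THEN conjunct2, THEN conjunct1]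
    and T_mem = f0[THEN conjunct1, THEN conjunct2, THEN conjunct2, rule_format]
  note iff = binary_op_iff[OF P] binary_op_iff[OF T]
  have Pm: "app P (pair x y) \<epsilon> R" if "x \<epsilon> R" "y \<epsilon> R" for x y
    by (rule P_mem[of "pair x y"]) (simp add: iff that)
  have Tm: "app T (pair x y) \<epsilon> R" if "x \<epsilon> R" "y \<epsilon> R" for x y
    by (rule T_mem[of "pair x y"]) (simp add: iff that)
  note P_comm = f4[THEN conjunct1, rule_format, unfolded iff]
    and T_comm = f5[THEN conjunct1, rule_format, unfolded iff]
    and P_assoc = f6[THEN conjunct1, rule_format, unfolded iff]
    and T_assoc = f7[THEN conjunct1, rule_format, unfolded iff]
    and distrib = f8[THEN conjunct1, rule_format, unfolded iff]
    and neutral = f9[THEN conjunct1, rule_format, unfolded iff]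
    and P_inv = f10[THEN conjunct1, rule_format, unfolded iff]
    and T_inv = f10[THEN conjunct2, rule_format, unfolded iff]
  note irrefl = o2[THEN conjunct1, rule_format]
    and trans = o3[THEN conjunct1, rule_format]
    and linear = o4[THEN conjunct1, rule_format]
    and mono = o5[THEN conjunct1, rule_format, unfolded iff]
    and pos = o5[THEN conjunct2, rule_format, unfolded iff]
  show ?thesis
  proof (unfold_locales, unfold mem_Collect_eq Bex_def)
    show "z \<epsilon> R" by (rule f1[THEN conjunct1])
    show "i \<epsilon> R" by (rule f2[THEN conjunct1])
    show "z \<noteq> i" by (rule f3[THEN conjunct1])
    show "\<not> pair x x \<epsilon> L" for x by (rule irrefl)
  next
    fix x y
    assume xy: "x \<epsilon> R" "y \<epsilon> R"
    show "app P (pair x y) \<epsilon> R" using xy by (rule Pm)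
    show "app T (pair x y) \<epsilon> R" using xy by (rule Tm)
    show "app P (pair x y) = app P (pair y x)"
      using P_comm[of x y "app P (pair x y)"] xy by simp
    show "app T (pair x y) = app T (pair y x)"
      using T_comm[of x y "app T (pair x y)"] xy by simp
    show "pair x y \<epsilon> L \<or> x = y \<or> pair y x \<epsilon> L" using xy by (intro linear conjI)
    show "pair z (app T (pair x y)) \<epsilon> L" if "pair z x \<epsilon> L" "pair z y \<epsilon> L"
      by (rule pos[of x y]) (use xy that in simp)
    fix w
    assume w: "w \<epsilon> R"
    show "app P (pair (app P (pair x y)) w) = app P (pair x (app P (pair y w)))"
      using P_assoc[of x y "app P (pair x y)" w "app P (pair y w)"
          "app P (pair (app P (pair x y)) w)"] xy w Pm by simp
    show "app T (pair (app T (pair x y)) w) = app T (pair x (app T (pair y w)))"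
      using T_assoc[of x y "app T (pair x y)" w "app T (pair y w)"
          "app T (pair (app T (pair x y)) w)"] xy w Tm by simp
    show "app T (pair (app P (pair x y)) w) = app P (pair (app T (pair x w)) (app T (pair y w)))"
      using distrib[of x y "app P (pair x y)" w "app T (pair x w)" "app T (pair y w)"
          "app T (pair (app P (pair x y)) w)"] xy w Pm Tm by simp
    show "pair x w \<epsilon> L" if "pair x y \<epsilon> L" "pair y w \<epsilon> L"
      by (rule trans[of x y w]) (use that in simp)
    show "pair (app P (pair x w)) (app P (pair y w)) \<epsilon> L" if "pair x y \<epsilon> L"
      by (rule mono[of x y w]) (use xy w that in simp)
  next
    fix x
    assume x: "x \<epsilon> R"
    show "app P (pair x z) = x" "app T (pair x i) = x" using neutral[OF x] by simp_all
    show "\<exists>y. y \<epsilon> R \<and> app P (pair x y) = z" using P_inv[OF x] by metis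
    show "\<exists>y. y \<epsilon> R \<and> app T (pair x y) = i" if "x \<noteq> z" using T_inv[of x] x that by metis
  qed
qed

end

text \<open>The rationals, transported along a bijection with \<open>nat\<close>. They serve as the
  fallback that makes the type \<open>fld\<close> exist unconditionally.\<close>

lemma ex_ordered_field_on_nat:
  "\<exists>pl tm ls ze on. ordered_field_on (UNIV :: nat set) pl tm ls ze on"
proof -
  have "bij (from_nat_into (UNIV :: rat set))"
    by (rule bij_betw_from_nat_into) (simp_all add: infinite_UNIV_char_0)
  then obtain b :: "nat \<Rightarrow> rat" where b: "bij b" by blast
  have b_inv: "b (inv b q) = q" for q using b by (simp add: bij_is_surj surj_f_inv_f)
  have inv_b: "inv b (b n) = n" for n using b by (simp add: bij_is_inj)
  have inj: "b m = b n \<longleftrightarrow> m = n" for m n by (metis inv_b)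
  have ex: "(\<exists>n. Q n) \<longleftrightarrow> (\<exists>q. Q (inv b q))" for Q by (metis inv_b)
  have "ordered_field_on UNIV (\<lambda>x y. inv b (b x + b y)) (\<lambda>x y. inv b (b x * b y)) (\<lambda>x y. b x < b y)
      (inv b 0) (inv b 1)"
  proof (unfold_locales, unfold b_inv)
    show "inv b 0 \<noteq> inv b 1" by (metis b_inv zero_neq_one)
    show "\<exists>y\<in>UNIV. inv b (b x + b y) = inv b 0" for x
      by (intro bexI[of _ "inv b (- b x)"]) (simp_all add: b_inv)
    show "\<exists>y\<in>UNIV. inv b (b x * b y) = inv b 1" if "x \<noteq> inv b 0" for x
    proof -
      have "b x \<noteq> 0" using that by (metis inv_b)
      then show ?thesis by (intro bexI[of _ "inv b (inverse (b x))"]) (simp_all add: b_inv)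
    qed
    show "b x < b y \<or> x = y \<or> b y < b x" for x y using inj by (metis linorder_less_linear)
  qed (simp_all add: inv_b algebra_simps)
  then show ?thesis by blast
qed

text \<open>A type cannot depend on a model.  Linear arithmetic on the real field of a model is obtained by
  deriving a contradiction from a counterexample: \<open>the_field\<close> is the real field of some
  counterexample to the proposition if there is one and any ordered field on the natural numbers
  otherwise.  It is thus an ordered field unconditionally.\<close>

definition proposition_for :: "real_vars \<Rightarrow> form" where
  "proposition_for S =
     (\<^bold>\<forall>X t. is_strongly_zero_dim S X t \<^bold>\<longrightarrow>
        (\<^bold>\<forall>Z. is_zero_set S X t Z \<^bold>\<longrightarrow>
          (\<^bold>\<exists>U. is_countable U \<^bold>\<and> clopen_family X t U \<^bold>\<and> is_Inter Z U)) \<^bold>\<and>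
        (\<^bold>\<forall>f. in_A S X t f \<^bold>\<longleftrightarrow> in_U S X t f) \<^bold>\<and>
        (\<^bold>\<forall>f. in_U S X t f \<^bold>\<longleftrightarrow> in_C S X t f))"

type_synonym field_data =
  "nat set \<times> (nat \<Rightarrow> nat \<Rightarrow> nat) \<times> (nat \<Rightarrow> nat \<Rightarrow> nat) \<times> (nat \<Rightarrow> nat \<Rightarrow> bool) \<times> nat \<times> nat"

definition counterexample :: "(nat \<Rightarrow> nat \<Rightarrow> bool) \<Rightarrow> (nat \<Rightarrow> nat) \<Rightarrow> nat \<Rightarrow> real_vars \<Rightarrow> bool" where
  "counterexample E e d S \<longleftrightarrow> zf_model E \<and> sat UNIV E e (CMC d) \<and>
     car S < d \<and> add S < d \<and> mul S < d \<and> lt S < d \<and> r_zero S < d \<and> r_one S < d \<and>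
     sat UNIV E e (is_real_field S d) \<and> \<not> sat UNIV E e (proposition_for S d)"

definition field_of :: "(nat \<Rightarrow> nat \<Rightarrow> bool) \<Rightarrow> (nat \<Rightarrow> nat) \<Rightarrow> nat \<Rightarrow> real_vars \<Rightarrow> field_data" where
  "field_of E e d S =
     ({x. E x (vl e d (car S))},
      \<lambda>x y. zf_model.app E (vl e d (add S)) (zf_model.pair E x y),
      \<lambda>x y. zf_model.app E (vl e d (mul S)) (zf_model.pair E x y),
      \<lambda>x y. E (zf_model.pair E x y) (vl e d (lt S)), vl e d (r_zero S), vl e d (r_one S))"

definition the_field :: field_data where
  "the_field = (SOME s. (case s of (C, pl, tm, ls, ze, on) \<Rightarrow> ordered_field_on C pl tm ls ze on) \<and>
     ((\<exists>E e d S. counterexample E e d S) \<longrightarrow> (\<exists>E e d S. counterexample E e d S \<and> s = field_of E e d S)))"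

lemma the_field:
  "case the_field of (C, pl, tm, ls, ze, on) \<Rightarrow> ordered_field_on C pl tm ls ze on"
  "counterexample E e d S \<Longrightarrow> \<exists>E e d S. counterexample E e d S \<and> the_field = field_of E e d S"
proof -
  let ?ok = "\<lambda>s :: field_data. case s of (C, pl, tm, ls, ze, on) \<Rightarrow> ordered_field_on C pl tm ls ze on"
  let ?Q = "\<lambda>s. ?ok s \<and> ((\<exists>E e d S. counterexample E e d S) \<longrightarrow>
    (\<exists>E e d S. counterexample E e d S \<and> s = field_of E e d S))"
  have "\<exists>s. ?Q s"
  proof (cases "\<exists>E e d S. counterexample E e d S")
    case True
    then obtain E e d S where c: "counterexample E e d S" by blast
    then interpret zf_model E by (simp add: counterexample_def)
    have "is_ordered_field_of (vl e d (car S)) (vl e d (add S)) (vl e d (mul S)) (vl e d (lt S))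
        (vl e d (r_zero S)) (vl e d (r_one S))"
      using c sat_real_field[of S d e] unfolding counterexample_def by blast
    then have ok: "?ok (field_of E e d S)"
      unfolding field_of_def prod.case by (rule ordered_field_on_model)
    have "\<exists>E' e' d' S'. counterexample E' e' d' S' \<and> field_of E e d S = field_of E' e' d' S'"
      by (intro exI conjI, rule c, rule refl)
    with ok have "?Q (field_of E e d S)" by (intro conjI impI)
    then show ?thesis by (rule exI)
  next
    case False
    obtain pl tm ls ze on where "ordered_field_on (UNIV :: nat set) pl tm ls ze on"
      using ex_ordered_field_on_nat by blast
    then have ok: "?ok (UNIV, pl, tm, ls, ze, on)" by simp
    have "?Q (UNIV, pl, tm, ls, ze, on)" by (rule conjI[OF ok impI]) (erule notE[OF False])
    then show ?thesis by (rule exI)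
  qed
  then have "?Q the_field" unfolding the_field_def by (rule someI_ex)
  then show "?ok the_field" by (rule conjunct1)
  show "\<exists>E e d S. counterexample E e d S \<and> the_field = field_of E e d S" if "counterexample E e d S"
    by (rule \<open>?Q the_field\<close>[THEN conjunct2, THEN mp]) (intro exI, rule that)
qed

section \<open>The chosen field as a type\<close>

definition "fld_car = fst the_field"
definition "fld_add = fst (snd the_field)"
definition "fld_mul = fst (snd (snd the_field))"
definition "fld_less = fst (snd (snd (snd the_field)))"
definition "fld_zero = fst (snd (snd (snd (snd the_field))))"
definition "fld_one = snd (snd (snd (snd (snd the_field))))"

lemmas fld_defs = fld_car_def fld_add_def fld_mul_def fld_less_def fld_zero_def fld_one_def

interpretation fld: ordered_field_on fld_car fld_add fld_mul fld_less fld_zero fld_one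
  using the_field(1) by (simp add: fld_defs split_beta)

typedef fld = fld_car
  using fld.zero_mem by blast

setup_lifting type_definition_fld

instantiation fld :: linordered_field
begin

lift_definition zero_fld :: fld is fld_zero by (rule fld.zero_mem)
lift_definition one_fld :: fld is fld_one by (rule fld.one_mem)
lift_definition plus_fld :: "fld \<Rightarrow> fld \<Rightarrow> fld" is fld_add by (rule fld.add_mem)
lift_definition times_fld :: "fld \<Rightarrow> fld \<Rightarrow> fld" is fld_mul by (rule fld.mul_mem)
lift_definition less_fld :: "fld \<Rightarrow> fld \<Rightarrow> bool" is fld_less .

text \<open>The remaining operations are determined by the lifted ones. \<open>SOME\<close> picks
  additive inverses and inverses of non-zero elements, which are unique;
  \<open>inverse 0 = 0\<close> is the convention of the type class.\<close>

definition uminus_fld :: "fld \<Rightarrow> fld" where "uminus_fld a = (SOME b. a + b = 0)"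
definition minus_fld :: "fld \<Rightarrow> fld \<Rightarrow> fld" where "minus_fld a b = a + - b"
definition inverse_fld :: "fld \<Rightarrow> fld" where "inverse_fld a = (if a = 0 then 0 else SOME b. a * b = 1)"
definition divide_fld :: "fld \<Rightarrow> fld \<Rightarrow> fld" where "divide_fld a b = a * inverse b"
definition less_eq_fld :: "fld \<Rightarrow> fld \<Rightarrow> bool" where "less_eq_fld a b \<longleftrightarrow> a < b \<or> a = b"
definition abs_fld :: "fld \<Rightarrow> fld" where "abs_fld a = (if a < 0 then - a else a)"
definition sgn_fld :: "fld \<Rightarrow> fld" where "sgn_fld a = (if a = 0 then 0 else if 0 < a then 1 else - 1)"

instance
proof -
  have ac: "a + b + c = a + (b + c)" for a b c :: fld by transfer (rule fld.add_assoc)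
  have comm: "a + b = b + a" for a b :: fld by transfer (rule fld.add_commute)
  have a0: "a + 0 = a" for a :: fld by transfer (rule fld.add_zero)
  have mc: "a * b * c = a * (b * c)" for a b c :: fld by transfer (rule fld.mul_assoc)
  have mcomm: "a * b = b * a" for a b :: fld by transfer (rule fld.mul_commute)
  have m1: "a * 1 = a" for a :: fld by transfer (rule fld.mul_one)
  have distrib: "(a + b) * c = a * c + b * c" for a b c :: fld by transfer (rule fld.distrib)
  have "\<exists>b. a + b = 0" for a :: fld by transfer (simp add: fld.add_inverse)
  then have neg: "a + - a = 0" for a :: fld unfolding uminus_fld_def by (rule someI_ex)
  have cancel: "b = c" if "a + b = a + c" for a b c :: fld
    using arg_cong[OF that, of "\<lambda>x. - a + x"] unfolding ac[symmetric] comm[of "- a" a] neg comm[of 0] a0 .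
  have add_minus: "a + b + - a = b" for a b :: fld
    unfolding comm[of a b] ac neg a0 ..
  have minus_add: "- (b + c) = - b + - c" for b c :: fld
  proof (rule cancel[of "b + c"])
    have "b + c + (- b + - c) = b + c + - b + - c" by (simp only: ac)
    then show "b + c + - (b + c) = b + c + (- b + - c)" unfolding add_minus neg by (rule sym)
  qed
  have zero_mul: "0 * a = 0" for a :: fld
  proof (rule cancel[of "0 * a"])
    show "0 * a + 0 * a = 0 * a + 0" unfolding distrib[symmetric] a0 ..
  qed
  have ex_inv: "a \<noteq> 0 \<Longrightarrow> \<exists>b. a * b = 1" for a :: fld by transfer (simp add: fld.mul_inverse)
  have inv: "a \<noteq> 0 \<Longrightarrow> a * inverse a = 1" for a :: fld
    using someI_ex[OF ex_inv, of a] by (simp add: inverse_fld_def)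
  have irrefl: "\<not> a < a" for a :: fld by transfer (rule fld.less_irrefl)
  have trans: "a < b \<Longrightarrow> b < c \<Longrightarrow> a < c" for a b c :: fld by transfer (rule fld.less_trans)
  have linear: "a < b \<or> a = b \<or> b < a" for a b :: fld by transfer (rule fld.less_linear)
  have add_mono: "a < b \<Longrightarrow> a + c < b + c" for a b c :: fld
    by transfer (rule fld.add_less_mono)
  have mul_pos: "0 < a \<Longrightarrow> 0 < b \<Longrightarrow> 0 < a * b" for a b :: fld
    by transfer (rule fld.mul_pos)
  have mul_mono: "a < b \<Longrightarrow> 0 < c \<Longrightarrow> c * a < c * b" for a b c :: fld
  proof -
    assume "a < b" "0 < c"
    have "0 < b + - a" using add_mono[OF \<open>a < b\<close>, of "- a"] by (simp add: neg)
    then have "0 < c * (b + - a)" by (rule mul_pos[OF \<open>0 < c\<close>])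
    then have "0 + c * a < c * (b + - a) + c * a" by (rule add_mono)
    moreover have "c * (b + - a) + c * a = c * b"
      by (metis ac comm a0 neg distrib mcomm)
    ultimately show "c * a < c * b" by (metis a0 comm)
  qed
  show "OFCLASS(fld, linordered_field_class)"
  proof (intro_classes, unfold minus_fld_def divide_fld_def less_eq_fld_def abs_fld_def sgn_fld_def)
    fix a b c :: fld
    show "a + b + c = a + (b + c)" by (rule ac)
    show "a + b = b + a" by (rule comm)
    show "0 + a = a" by (metis a0 comm)
    show "- a + a = 0" by (metis neg comm)
    show "a * b * c = a * (b * c)" by (rule mc)
    show "a * b = b * a" by (rule mcomm)
    show "1 * a = a" by (metis m1 mcomm)
    show "(a + b) * c = a * c + b * c" by (rule distrib)
    show "(0 :: fld) \<noteq> 1" by transfer (rule fld.zero_neq_one)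
    show "a \<noteq> 0 \<Longrightarrow> inverse a * a = 1" by (metis inv mcomm)
    show "inverse (0 :: fld) = 0" by (simp add: inverse_fld_def)
    show "a < b \<longleftrightarrow> (a < b \<or> a = b) \<and> \<not> (b < a \<or> b = a)" using irrefl trans by metis
    show "a < b \<or> a = b \<Longrightarrow> b < c \<or> b = c \<Longrightarrow> a < c \<or> a = c" using trans by metis
    show "a < b \<or> a = b \<Longrightarrow> b < a \<or> b = a \<Longrightarrow> a = b" using irrefl trans by metis
    show "(a < b \<or> a = b) \<or> b < a \<or> b = a" using linear by metis
    show "a < b \<or> a = b \<Longrightarrow> c + a < c + b \<or> c + a = c + b" using add_mono comm by metis
    show "a < b \<Longrightarrow> 0 < c \<Longrightarrow> c * a < c * b" by (rule mul_mono)
    show "a + b + - a = b" by (rule add_minus)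
    show "a + - b + - c = a + - (b + c)" by (simp only: minus_add ac)
    show "0 * a = 0" by (rule zero_mul)
    show "a * 0 = 0" unfolding mcomm[of a] by (rule zero_mul)
  qed auto
qed

end


section \<open>The proposition\<close>

text \<open>For continuous \<open>f\<close> the extra conditions in \<open>in_A\<close> and
  \<open>in_U\<close> hold by \<open>preimage_countable_Union\<close> and
  \<open>small_oscillation_cover\<close>. All three memberships thus reduce to
  \<open>cont X t f\<close>, which settles both equalities at once.\<close>

lemma (in zf_reals) proposition_for_reals:
  assumes S: "vars_below S d" "reals_at e d S" and "holds e d CMC"
  shows "holds e d (proposition_for S)"
  unfolding proposition_for_def sat_form
proof (intro ballI impI)
  fix X t
  let ?e = "case_nat t (case_nat X e)" and ?d = "Suc (Suc d)"
  have S': "vars_below S ?d" "reals_at ?e ?d S" using S by simp_all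
  have Xt: "d < ?d" "Suc d < ?d" "vl ?e ?d d = X" "vl ?e ?d (Suc d) = t" by simp_all
  assume "sat UNIV (\<epsilon>) ?e (is_strongly_zero_dim S d (Suc d) ?d)"
  note top = sat_strongly_zero_dim[OF S' Xt(1,2) this, unfolded Xt(3,4)]
  interpret zf_space E R P L \<iota> X t
  proof (unfold_locales)
    fix A
    assume A: "isfun A omega" "\<And>j B. pair j B \<epsilon> A \<Longrightarrow> B \<noteq> emp"
    have "\<not> fin omega \<and> ctb omega \<and> isfun A omega \<and> (\<forall>j B. pair j B \<epsilon> A \<longrightarrow> B \<noteq> emp)"
      using A not_fin_omega ctb_omega by blast
    then show "\<exists>g. isfun g omega \<and>
        (\<forall>j F B. pair j F \<epsilon> g \<and> pair j B \<epsilon> A \<longrightarrow> sub F B \<and> F \<noteq> emp \<and> fin F)"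
      using assms(3) unfolding sat_CMC by blast
  qed (fact top)+
  have A: "sat UNIV (\<epsilon>) (case_nat f ?e) (in_A S d (Suc d) ?d (Suc ?d)) \<longleftrightarrow> cont X t f" for f
    using S' preimage_countable_Union[of f] by (subst sat_in_A) auto
  have U: "sat UNIV (\<epsilon>) (case_nat f ?e) (in_U S d (Suc d) ?d (Suc ?d)) \<longleftrightarrow> cont X t f" for f
    using S' small_oscillation_cover[of f] by (subst sat_in_U) auto
  have C: "sat UNIV (\<epsilon>) (case_nat f ?e) (in_C S d (Suc d) ?d (Suc ?d)) \<longleftrightarrow> cont X t f" for f
    using S' by simp
  have Z: "\<exists>U. sat UNIV (\<epsilon>) (case_nat U (case_nat Z ?e)) (is_countable (Suc ?d) (Suc (Suc ?d))) \<and>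
      sat UNIV (\<epsilon>) (case_nat U (case_nat Z ?e)) (clopen_family d (Suc d) (Suc ?d) (Suc (Suc ?d))) \<and>
      sat UNIV (\<epsilon>) (case_nat U (case_nat Z ?e)) (is_Inter ?d (Suc ?d) (Suc (Suc ?d)))"
    if "sat UNIV (\<epsilon>) (case_nat Z ?e) (is_zero_set S d (Suc d) ?d (Suc ?d))" for Z
  proof -
    have "zero_set X t Z" using that S' by simp
    then show ?thesis using zero_set_countable_Inter[of Z] by auto
  qed
  show "(\<forall>Z\<in>UNIV. sat UNIV (\<epsilon>) (case_nat Z ?e) (is_zero_set S d (Suc d) ?d (Suc ?d)) \<longrightarrow>
      (\<exists>U\<in>UNIV. sat UNIV (\<epsilon>) (case_nat U (case_nat Z ?e)) (is_countable (Suc ?d) (Suc (Suc ?d))) \<and>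
        sat UNIV (\<epsilon>) (case_nat U (case_nat Z ?e)) (clopen_family d (Suc d) (Suc ?d) (Suc (Suc ?d))) \<and>
        sat UNIV (\<epsilon>) (case_nat U (case_nat Z ?e)) (is_Inter ?d (Suc ?d) (Suc (Suc ?d))))) \<and>
    (\<forall>f\<in>UNIV. sat UNIV (\<epsilon>) (case_nat f ?e) (in_A S d (Suc d) ?d (Suc ?d)) \<longleftrightarrow>
      sat UNIV (\<epsilon>) (case_nat f ?e) (in_U S d (Suc d) ?d (Suc ?d))) \<and>
    (\<forall>f\<in>UNIV. sat UNIV (\<epsilon>) (case_nat f ?e) (in_U S d (Suc d) ?d (Suc ?d)) \<longleftrightarrow>
      sat UNIV (\<epsilon>) (case_nat f ?e) (in_C S d (Suc d) ?d (Suc ?d)))"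
    unfolding A U C using Z by blast
qed

lemma no_counterexample: "\<not> counterexample E e d S"
proof
  assume "counterexample E e d S"
  \<comment> \<open>The given counterexample is discarded in favour of one whose real field is
    \<open>the_field\<close>. For this one the elements of the model's real field are exactly the
    values of \<open>Rep_fld\<close>.\<close>
  then obtain E e d S where c: "counterexample E e d S" and field: "the_field = field_of E e d S"
    using the_field(2) by blast
  then interpret zf_model E by (simp add: counterexample_def)
  let ?v = "vl e d"
  have S: "car S < d" "add S < d" "mul S < d" "lt S < d" "r_zero S < d" "r_one S < d"
    using c by (simp_all add: counterexample_def)
  have o: "is_ordered_field_of (?v (car S)) (?v (add S)) (?v (mul S)) (?v (lt S)) (?v (r_zero S)) (?v (r_one S))"
    and complete: "is_complete_in (?v (car S)) (?v (lt S))"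
    using c sat_real_field[OF S, of e] unfolding counterexample_def by blast+
  have fld: "fld_car = {x. E x (?v (car S))}" "fld_add x y = app (?v (add S)) (pair x y)"
    "fld_less x y \<longleftrightarrow> E (pair x y) (?v (lt S))" "fld_zero = ?v (r_zero S)" for x y
    by (simp_all add: fld_defs field field_of_def)
  have isfun: "isfun (?v (add S)) (times (?v (car S)) (?v (car S)))"
    and L: "sub (?v (lt S)) (times (?v (car S)) (?v (car S)))"
    using o unfolding is_ordered_field_of_def is_field_of_def by blast+
  have range: "E x (?v (car S)) \<longleftrightarrow> (\<exists>a. x = Rep_fld a)" for x
    using Rep_fld_cases[of x] Rep_fld fld(1) by auto
  interpret zf_reals E "?v (car S)" "?v (add S)" "?v (lt S)" Rep_fld
  proof (unfold_locales)
    show "inj Rep_fld" by (rule injI) (simp add: Rep_fld_inject)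
    show "E x (?v (car S)) \<longleftrightarrow> x \<in> range Rep_fld" for x unfolding range by blast
    show "E (pair (pair x y) w) (?v (add S)) \<longleftrightarrow>
        (\<exists>a b. x = Rep_fld a \<and> y = Rep_fld b \<and> w = Rep_fld (a + b))" for x y w
      unfolding binary_op_iff[OF isfun] range plus_fld.rep_eq fld(2) by blast
    show less: "E (pair x y) (?v (lt S)) \<longleftrightarrow> (\<exists>a b. x = Rep_fld a \<and> y = Rep_fld b \<and> a < b)" for x y
    proof -
      have "(\<exists>a. x = Rep_fld a) \<and> (\<exists>b. y = Rep_fld b)" if "E (pair x y) (?v (lt S))"
      proof -
        have "E (pair x y) (times (?v (car S)) (?v (car S)))" using L that unfolding sub_def by simp
        then show ?thesis unfolding mem_times pair_eq_iff range[symmetric] by metis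
      qed
      then show ?thesis unfolding less_fld.rep_eq fld(3) by metis
    qed
    fix s
    assume ne: "\<exists>a. E (Rep_fld a) s" and bounded: "\<exists>b. \<forall>a. E (Rep_fld a) s \<longrightarrow> a \<le> b"
    \<comment> \<open>\<open>zf_reals\<close> asks for suprema of the real members of an arbitrary
      set of the model, whereas \<open>is_complete_in\<close> speaks of subsets of the field; hence
      the restriction of \<open>s\<close>.\<close>
    define s' where "s' = sep s (\<lambda>x. E x (?v (car S)))"
    have mem: "E x s' \<longleftrightarrow> E x s \<and> (\<exists>a. x = Rep_fld a)" for x
      unfolding s'_def range[symmetric] by (rule mem_sep) (intro dintro)
    have le: "E (pair (Rep_fld a) (Rep_fld b)) (?v (lt S)) \<or> Rep_fld a = Rep_fld b \<longleftrightarrow> a \<le> b" for a b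
      unfolding less Rep_fld_inject le_less by blast
    have upper: "(E b (?v (car S)) \<and> (\<forall>x. E x s' \<longrightarrow> E (pair x b) (?v (lt S)) \<or> x = b)) \<longleftrightarrow>
      (\<exists>b'. b = Rep_fld b' \<and> (\<forall>a. E (Rep_fld a) s \<longrightarrow> a \<le> b'))" for b
      unfolding range mem using le by blast
    have "sub s' (?v (car S))" unfolding sub_def mem range by simp
    moreover have "s' \<noteq> emp"
    proof -
      obtain a where "E (Rep_fld a) s" using ne by (elim exE)
      then have "E (Rep_fld a) s'" unfolding mem by blast
      then show ?thesis unfolding emp_iff by metis
    qed
    moreover have "\<exists>b. E b (?v (car S)) \<and> (\<forall>x. E x s' \<longrightarrow> E (pair x b) (?v (lt S)) \<or> x = b)"
      unfolding upper using bounded by simp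
    ultimately have "sub s' (?v (car S)) \<and> s' \<noteq> emp \<and>
        (\<exists>b. E b (?v (car S)) \<and> (\<forall>x. E x s' \<longrightarrow> E (pair x b) (?v (lt S)) \<or> x = b))"
      by (intro conjI)
    then have "\<exists>b. (E b (?v (car S)) \<and> (\<forall>x. E x s' \<longrightarrow> E (pair x b) (?v (lt S)) \<or> x = b)) \<and>
        (\<forall>c. E c (?v (car S)) \<and> (\<forall>x. E x s' \<longrightarrow> E (pair x c) (?v (lt S)) \<or> x = c) \<longrightarrow>
          E (pair b c) (?v (lt S)) \<or> b = c)"
      by (rule complete[unfolded is_complete_in_def, rule_format])
    then obtain b where b: "\<forall>a. E (Rep_fld a) s \<longrightarrow> a \<le> b"
      and least: "\<forall>c. (\<exists>c'. c = Rep_fld c' \<and> (\<forall>a. E (Rep_fld a) s \<longrightarrow> a \<le> c')) \<longrightarrow>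
        E (pair (Rep_fld b) c) (?v (lt S)) \<or> Rep_fld b = c"
      unfolding upper by (elim exE conjE) simp
    have "b \<le> c" if "\<forall>a. E (Rep_fld a) s \<longrightarrow> a \<le> c" for c
      unfolding le[symmetric] by (rule least[rule_format]) (rule exI[of _ c], rule conjI[OF refl that])
    then show "\<exists>b. (\<forall>a. E (Rep_fld a) s \<longrightarrow> a \<le> b) \<and> (\<forall>c. (\<forall>a. E (Rep_fld a) s \<longrightarrow> a \<le> c) \<longrightarrow> b \<le> c)"
      using b by blast
  qed
  have "vars_below S d" unfolding vars_below_def using S by blast
  moreover have "reals_at e d S" unfolding reals_at_def zero_fld.rep_eq fld(4) by (intro conjI refl)
  moreover have "sat UNIV E e (CMC d)" using c by (simp add: counterexample_def)
  ultimately have "sat UNIV E e (proposition_for S d)" by (rule proposition_for_reals)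
  then show False using c by (simp add: counterexample_def)
qed

theorem proposition3p1:
  shows "ZF \<turnstile>
    (CMC \<^bold>\<longrightarrow>
      (\<^bold>\<forall>\<^sub>\<real>S. \<^bold>\<forall>X t. is_strongly_zero_dim S X t \<^bold>\<longrightarrow>
        (\<^bold>\<forall>Z. is_zero_set S X t Z \<^bold>\<longrightarrow>
          (\<^bold>\<exists>U. is_countable U \<^bold>\<and> clopen_family X t U \<^bold>\<and> is_Inter Z U)) \<^bold>\<and>
        (\<^bold>\<forall>f. in_A S X t f \<^bold>\<longleftrightarrow> in_U S X t f) \<^bold>\<and>
        (\<^bold>\<forall>f. in_U S X t f \<^bold>\<longleftrightarrow> in_C S X t f))) 0"
proof (rule completeness)
  fix E :: "nat \<Rightarrow> nat \<Rightarrow> bool" and e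
  assume ZF: "\<forall>h\<in>ZF. sat UNIV E e h"
  interpret zf_model E using ZF by unfold_locales blast
  have "sat UNIV E e ((CMC \<^bold>\<longrightarrow> (\<^bold>\<forall>\<^sub>\<real>S. proposition_for S)) 0)"
    unfolding sat_form(4,8) for_reals_def
  proof (intro impI ballI)
    fix R P T L z i
    \<comment> \<open>The quantifiers over the reals are outermost: their variables have levels 0 to
      5, and what follows them stands at depth 6.\<close>
    let ?e = "case_nat i (case_nat z (case_nat L (case_nat T (case_nat P (case_nat R e)))))"
      and ?S = "\<lparr>car = 0, add = Suc 0, mul = Suc (Suc 0), lt = Suc (Suc (Suc 0)),
        r_zero = Suc (Suc (Suc (Suc 0))), r_one = Suc (Suc (Suc (Suc (Suc 0))))\<rparr>"
      and ?d = "Suc (Suc (Suc (Suc (Suc (Suc 0)))))"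
    assume "sat UNIV E e (CMC 0)" "sat UNIV E ?e (is_real_field ?S ?d)"
    \<comment> \<open>CMC was assumed at depth 0, outside these six quantifiers, while a
      counterexample refers to a single depth.\<close>
    moreover have "sat UNIV E ?e (CMC ?d) \<longleftrightarrow> sat UNIV E e (CMC 0)" unfolding sat_CMC ..
    ultimately show "sat UNIV E ?e (proposition_for ?S ?d)"
      using no_counterexample[of E ?e ?d ?S] zf_model_axioms unfolding counterexample_def by simp
  qed
  then show "sat UNIV E e ((CMC \<^bold>\<longrightarrow>
      (\<^bold>\<forall>\<^sub>\<real>S. \<^bold>\<forall>X t. is_strongly_zero_dim S X t \<^bold>\<longrightarrow>
        (\<^bold>\<forall>Z. is_zero_set S X t Z \<^bold>\<longrightarrow>
          (\<^bold>\<exists>U. is_countable U \<^bold>\<and> clopen_family X t U \<^bold>\<and> is_Inter Z U)) \<^bold>\<and>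
        (\<^bold>\<forall>f. in_A S X t f \<^bold>\<longleftrightarrow> in_U S X t f) \<^bold>\<and>
        (\<^bold>\<forall>f. in_U S X t f \<^bold>\<longleftrightarrow> in_C S X t f))) 0)"
    unfolding proposition_for_def .
qed (rule ZF_no_finite_model)

end
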